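(* Let $f\in L^2(\Omega)$ and let $\alpha\in L^1(\Omega)^+$, i.e. $\alpha:\Omega\to\mathbb{R}$ is nonnegative and integrable. Then there exists a unique solution in $W^{1,1}_{\Gamma_D}(\Omega)$ to the problem $$\min\ \frac12\int_\Omega |u(x)|^2\,dx-\int_\Omega f(x)u(x)\,dx\quad\text{over } u\in W^{1,1}_{\Gamma_D}(\Omega),\qquad\text{subject to } u\in K,$$ where $K=\{v\in W^{1,1}_{\Gamma_D}(\Omega): |\nabla v|_p\le \alpha \text{ a.e. in }\Omega\}$.
   Context: $\Omega\subset\mathbb{R}^{\mathrm d}$ is a bounded domain with Lipschitz boundary. The boundary $\partial\Omega$ is partitioned into $\Gamma_D$ and $\Gamma_N$, each composed of a finite number of connected parts, with $\overline{\Gamma}_D\cup\overline{\Gamma}_N=\partial\Omega$ and $\Gamma_D\cap\Gamma_N=\emptyset$. The exponent $p$ satisfies $1\le p\le+\infty$, and $|\nabla v|_p$ is the pointwise $\ell^p$-norm of the weak gradient. $W^{1,1}_{\Gamma_D}(\Omega)=\{v\in W^{1,1}(\Omega):\gamma_0(v)=0\text{ on }\Gamma_D\}$, where $\gamma_0:W^{1,1}(\Omega)\to L^1(\partial\Omega)$ is the trace operator. The objective is understood as $+\infty$ if $u\notin L^2(\Omega)$. *)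

theory Defs
  imports "HOL-Analysis.Analysis" "HOL-Library.Extended_Real"
begin

section \<open>Lipschitz domains and surface measure\<close>

text \<open>Near each boundary point, after a rigid change of coordinates in which the unit vector \<open>e\<close>
  is the last axis, the set is the strict epigraph of a Lipschitz function. The hyperplane
  orthogonal to \<open>e\<close> plays the role of the first \<open>d - 1\<close> coordinates.\<close>

definition lipschitz_boundary :: "(real^'d) set \<Rightarrow> bool" where
  "lipschitz_boundary \<Omega> \<longleftrightarrow>
     (\<forall>x0 \<in> frontier \<Omega>. \<exists>r>0. \<exists>e L \<gamma>. norm e = 1 \<and> L-lipschitz_on {z. z \<bullet> e = 0} \<gamma> \<and>
        (\<forall>y \<in> ball x0 r. y \<in> \<Omega> \<longleftrightarrow> y \<bullet> e > \<gamma> (y - (y \<bullet> e) *\<^sub>R e)))"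

definition bounded_lipschitz_domain :: "(real^'d) set \<Rightarrow> bool" where
  "bounded_lipschitz_domain \<Omega> \<longleftrightarrow>
     open \<Omega> \<and> connected \<Omega> \<and> \<Omega> \<noteq> {} \<and> bounded \<Omega> \<and> lipschitz_boundary \<Omega>"

definition boundary_partition :: "(real^'d) set \<Rightarrow> (real^'d) set \<Rightarrow> (real^'d) set \<Rightarrow> bool" where
  "boundary_partition \<Omega> \<Gamma>\<^sub>D \<Gamma>\<^sub>N \<longleftrightarrow>
     \<Gamma>\<^sub>D \<subseteq> frontier \<Omega> \<and> \<Gamma>\<^sub>N \<subseteq> frontier \<Omega> \<and>
     finite (components \<Gamma>\<^sub>D) \<and> finite (components \<Gamma>\<^sub>N) \<and>
     closure \<Gamma>\<^sub>D \<union> closure \<Gamma>\<^sub>N = frontier \<Omega> \<and> \<Gamma>\<^sub>D \<inter> \<Gamma>\<^sub>N = {}"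

text \<open>Empty covering sets are given weight 0 explicitly, because \<open>0 ^ 0 = 1\<close> would otherwise count
  them when \<open>s = 0\<close>; boundedness is required because \<^const>\<open>diameter\<close> is meaningless otherwise.
  With this normalisation the \<open>d\<close>-dimensional Hausdorff measure on \<open>real^'d\<close> is Lebesgue measure,
  and \<open>s = 0\<close> gives counting measure.\<close>

definition hausdorff_premeasure :: "nat \<Rightarrow> real \<Rightarrow> ('a::metric_space) set \<Rightarrow> ennreal" where
  "hausdorff_premeasure s \<delta> A =
     (INF E \<in> {E :: nat \<Rightarrow> 'a set. A \<subseteq> (\<Union>i. E i) \<and> (\<forall>i. bounded (E i) \<and> diameter (E i) \<le> \<delta>)}.
        \<Sum>i. if E i = {} then 0 else ennreal (unit_ball_vol (real s) * (diameter (E i) / 2) ^ s))"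

definition hausdorff_outer :: "nat \<Rightarrow> ('a::metric_space) set \<Rightarrow> ennreal" where
  "hausdorff_outer s A = (SUP \<delta> \<in> {0<..}. hausdorff_premeasure s \<delta> A)"

text \<open>\<^const>\<open>hausdorff_outer\<close> is a metric outer measure, hence countably additive on the Borel sets
  by Caratheodory's criterion, so \<^const>\<open>measure_of\<close> does not collapse to the zero measure.\<close>

definition hausdorff_measure :: "nat \<Rightarrow> ('a::metric_space) measure" where
  "hausdorff_measure s = measure_of UNIV (sets borel) (hausdorff_outer s)"

definition surface_measure :: "(real^'d) set \<Rightarrow> (real^'d) measure" where
  "surface_measure \<Omega> = restrict_space (hausdorff_measure (CARD('d) - 1)) (frontier \<Omega>)"

section \<open>Sobolev functions\<close>

definition partial_deriv :: "'d \<Rightarrow> (real^'d \<Rightarrow> real) \<Rightarrow> real^'d \<Rightarrow> real" where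
  "partial_deriv i \<phi> x = frechet_derivative \<phi> (at x) (axis i 1)"

primrec Ck_function :: "nat \<Rightarrow> (real^'d \<Rightarrow> real) \<Rightarrow> bool" where
  "Ck_function 0 \<phi> \<longleftrightarrow> continuous_on UNIV \<phi>"
| "Ck_function (Suc k) \<phi> \<longleftrightarrow>
     (\<forall>x. \<phi> differentiable (at x)) \<and> (\<forall>i. Ck_function k (partial_deriv i \<phi>))"

definition smooth_function :: "(real^'d \<Rightarrow> real) \<Rightarrow> bool" where
  "smooth_function \<phi> \<longleftrightarrow> (\<forall>k. Ck_function k \<phi>)"

definition test_function :: "(real^'d) set \<Rightarrow> (real^'d \<Rightarrow> real) \<Rightarrow> bool" where
  "test_function \<Omega> \<phi> \<longleftrightarrow> smooth_function \<phi> \<and>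
     compact (closure {x. \<phi> x \<noteq> 0}) \<and> closure {x. \<phi> x \<noteq> 0} \<subseteq> \<Omega>"

text \<open>Functions on \<open>\<Omega>\<close> are represented by total functions, of which only the values on \<open>\<Omega>\<close> matter;
  elements of Lebesgue and Sobolev spaces are represented by functions, to be identified when they
  agree almost everywhere on \<open>\<Omega>\<close>.\<close>

definition has_weak_gradient ::
    "(real^'d) set \<Rightarrow> (real^'d \<Rightarrow> real) \<Rightarrow> (real^'d \<Rightarrow> real^'d) \<Rightarrow> bool" where
  "has_weak_gradient \<Omega> v G \<longleftrightarrow>
     integrable (lebesgue_on \<Omega>) v \<and> integrable (lebesgue_on \<Omega>) G \<and>
     (\<forall>\<phi> i. test_function \<Omega> \<phi> \<longrightarrow>
        (LINT x|lebesgue_on \<Omega>. v x * partial_deriv i \<phi> x) =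
        - (LINT x|lebesgue_on \<Omega>. G x $ i * \<phi> x))"

definition W11 :: "(real^'d) set \<Rightarrow> (real^'d \<Rightarrow> real) set" where
  "W11 \<Omega> = {v. \<exists>G. has_weak_gradient \<Omega> v G}"

text \<open>The choice is immaterial: the weak gradient is unique almost everywhere on an open \<open>\<Omega>\<close>.\<close>

definition weak_grad :: "(real^'d) set \<Rightarrow> (real^'d \<Rightarrow> real) \<Rightarrow> real^'d \<Rightarrow> real^'d" where
  "weak_grad \<Omega> v = (SOME G. has_weak_gradient \<Omega> v G)"

definition W11_norm :: "(real^'d) set \<Rightarrow> (real^'d \<Rightarrow> real) \<Rightarrow> real" where
  "W11_norm \<Omega> v =
     (LINT x|lebesgue_on \<Omega>. \<bar>v x\<bar>) + (LINT x|lebesgue_on \<Omega>. norm (weak_grad \<Omega> v x))"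

text \<open>The graph of the trace operator from \<open>W11 \<Omega>\<close> to \<open>L1\<close> of the boundary, i.e. of the unique
  continuous extension of the restriction map \<open>\<phi> \<mapsto> \<phi>|\<partial>\<Omega>\<close> from functions smooth up to the boundary
  (these are dense in \<open>W11 \<Omega>\<close> for a bounded Lipschitz domain). The nonnegative integral is used for
  the boundary distance so that it is meaningful without an integrability side condition.\<close>

definition has_trace :: "(real^'d) set \<Rightarrow> (real^'d \<Rightarrow> real) \<Rightarrow> (real^'d \<Rightarrow> real) \<Rightarrow> bool" where
  "has_trace \<Omega> v g \<longleftrightarrow>
     v \<in> W11 \<Omega> \<and> integrable (surface_measure \<Omega>) g \<and>
     (\<exists>\<phi> :: nat \<Rightarrow> real^'d \<Rightarrow> real. (\<forall>n. smooth_function (\<phi> n)) \<and>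
        (\<lambda>n. W11_norm \<Omega> (\<lambda>x. \<phi> n x - v x)) \<longlonglongrightarrow> 0 \<and>
        (\<lambda>n. \<integral>\<^sup>+x. ennreal \<bar>\<phi> n x - g x\<bar> \<partial>surface_measure \<Omega>) \<longlonglongrightarrow> 0)"

definition W11_zero_trace :: "(real^'d) set \<Rightarrow> (real^'d) set \<Rightarrow> (real^'d \<Rightarrow> real) set" where
  "W11_zero_trace \<Omega> \<Gamma>\<^sub>D =
     {v \<in> W11 \<Omega>. \<exists>g. has_trace \<Omega> v g \<and> (AE x in surface_measure \<Omega>. x \<in> \<Gamma>\<^sub>D \<longrightarrow> g x = 0)}"

section \<open>The gradient-constrained problem\<close>

definition lp_norm :: "ereal \<Rightarrow> real^'d \<Rightarrow> real" where
  "lp_norm p z =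
     (if p = \<infinity> then Max (range (\<lambda>i. \<bar>z $ i\<bar>))
      else (\<Sum>i\<in>UNIV. \<bar>z $ i\<bar> powr real_of_ereal p) powr (1 / real_of_ereal p))"

definition L2 :: "(real^'d) set \<Rightarrow> (real^'d \<Rightarrow> real) set" where
  "L2 \<Omega> = {f \<in> borel_measurable (lebesgue_on \<Omega>). integrable (lebesgue_on \<Omega>) (\<lambda>x. (f x)\<^sup>2)}"

definition grad_constraint_set ::
    "(real^'d) set \<Rightarrow> (real^'d) set \<Rightarrow> ereal \<Rightarrow> (real^'d \<Rightarrow> real) \<Rightarrow> (real^'d \<Rightarrow> real) set" where
  "grad_constraint_set \<Omega> \<Gamma>\<^sub>D p \<alpha> =
     {v \<in> W11_zero_trace \<Omega> \<Gamma>\<^sub>D. AE x in lebesgue_on \<Omega>. lp_norm p (weak_grad \<Omega> v x) \<le> \<alpha> x}"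

definition objective :: "(real^'d) set \<Rightarrow> (real^'d \<Rightarrow> real) \<Rightarrow> (real^'d \<Rightarrow> real) \<Rightarrow> ereal" where
  "objective \<Omega> f u =
     (if u \<in> L2 \<Omega>
      then ereal (1/2 * (LINT x|lebesgue_on \<Omega>. \<bar>u x\<bar>\<^sup>2) - (LINT x|lebesgue_on \<Omega>. f x * u x))
      else \<infinity>)"

definition is_solution ::
    "(real^'d) set \<Rightarrow> (real^'d) set \<Rightarrow> ereal \<Rightarrow> (real^'d \<Rightarrow> real) \<Rightarrow> (real^'d \<Rightarrow> real) \<Rightarrow>
     (real^'d \<Rightarrow> real) \<Rightarrow> bool" where
  "is_solution \<Omega> \<Gamma>\<^sub>D p \<alpha> f u \<longleftrightarrow>
     is_arg_min (objective \<Omega> f) (\<lambda>v. v \<in> grad_constraint_set \<Omega> \<Gamma>\<^sub>D p \<alpha>) u"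

end

theory Submission
  imports Defs
begin

text \<open>
  Completing the square turns the objective into half the squared \<open>L\<^sup>2\<close> distance to \<open>f\<close>, so along a
  minimising sequence in the convex set \<open>K\<close> the parallelogram identity gives convergence of the
  functions. Their gradients are controlled by a second parallelogram identity, for the energy
  \<open>\<integral> |\<nabla>v|\<^sup>2 / (1 + \<alpha>)\<close>, which is bounded on \<open>K\<close>: choosing almost minimisers of this energy among the
  almost minimisers of the objective makes the gradients converge strongly in \<open>L\<^sup>1\<close>, and no weak
  compactness is needed. The gradient constraint passes to the limit almost everywhere and the
  objective by Fatou's lemma.

  The boundary condition passes to the limit by the trace inequality
  \<open>\<integral>\<^sub>\<partial>\<^sub>\<Omega> |\<phi>| \<le> C \<integral>\<^sub>\<Omega> (|\<phi>| + |\<nabla>\<phi>|)\<close> for smooth \<open>\<phi>\<close>. Near a boundary point one integrates along the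
  direction in which \<open>\<Omega>\<close> is an epigraph; the surface measure swept in that direction is dominated by
  Lebesgue measure, since a graph over a disc of radius \<open>\<rho>\<close> has Hausdorff measure of order
  \<open>\<rho>\<^sup>d\<^sup>-\<^sup>1\<close>. Uniqueness is strict convexity.
\<close>

section \<open>Smooth functions and bumps supported in boxes\<close>

text \<open>Convergence of the functions says nothing about their gradients, and W11 is not
  reflexive, so the gradients of a minimising sequence have to be made convergent by choosing the
  sequence well. The plain Dirichlet energy cannot steer that choice: \<alpha> is only integrable,
  so |\<nabla>v|^2 may fail to be integrable for v in K. The weight 1/(1+\<alpha>) repairs this,
  because |\<nabla>v| \<le> d \<alpha> makes the integrand at most d^2 \<alpha>; and since
  1+\<alpha> is itself integrable, convergence in the weighted L2 norm still implies convergence in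
  L1. Tolerances 4^-n for squared quantities become 2^-n in L1, which is summable, so whole
  sequences converge almost everywhere, as the pointwise constraint and the boundary values require.
  Traces are defined by approximation with smooth functions, so the boundary estimate is proved for
  smooth functions and carried over by a diagonal sequence. Products of the functions exp(-c/t)
  provide enough test functions to identify a weak gradient almost everywhere.\<close>

lemma partial_deriv_eq:
  assumes "(\<phi> has_derivative D) (at x)"
  shows "partial_deriv i \<phi> x = D (axis i 1)"
  using assms frechet_derivative_at by (metis partial_deriv_def)

lemma Ck_function_SucD: "Ck_function (Suc k) \<phi> \<Longrightarrow> Ck_function k \<phi>"
proof (induction k arbitrary: \<phi>)
  case 0
  then show ?case
    by (auto intro!: continuous_at_imp_continuous_on differentiable_imp_continuous_within)
next
  case (Suc k)
  then show ?case by simp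
qed

lemma Ck_function_const [simp]: "Ck_function k (\<lambda>x. c)"
proof (induction k arbitrary: c)
  case (Suc k)
  have "partial_deriv i (\<lambda>x::real^'a. c) = (\<lambda>x. 0)" for i
    by (rule ext) (subst partial_deriv_eq[where D="\<lambda>_. 0"], auto)
  with Suc show ?case by simp
qed simp

lemma Ck_function_add:
  "Ck_function k f \<Longrightarrow> Ck_function k g \<Longrightarrow> Ck_function k (\<lambda>x. f x + g x)"
proof (induction k arbitrary: f g)
  case 0
  then show ?case by (auto intro: continuous_intros)
next
  case (Suc k)
  then have d: "f differentiable (at x)" "g differentiable (at x)" for x by auto
  have "partial_deriv i (\<lambda>x. f x + g x) = (\<lambda>x. partial_deriv i f x + partial_deriv i g x)" for i
    by (rule ext, subst partial_deriv_eq)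
       (auto intro!: has_derivative_add d[unfolded frechet_derivative_works] simp: partial_deriv_def)
  with Suc d show ?case by auto
qed

text \<open>The Leibniz terms contain undifferentiated factors, to which the induction hypothesis
  applies only after \<open>Ck_function_SucD\<close> has lowered their order by one.\<close>

lemma Ck_function_mult:
  "Ck_function k f \<Longrightarrow> Ck_function k g \<Longrightarrow> Ck_function k (\<lambda>x. f x * g x)"
proof (induction k arbitrary: f g)
  case 0
  then show ?case by (auto intro: continuous_intros)
next
  case (Suc k)
  then have d: "f differentiable (at x)" "g differentiable (at x)" for x by auto
  have "partial_deriv i (\<lambda>x. f x * g x)
      = (\<lambda>x. f x * partial_deriv i g x + partial_deriv i f x * g x)" for i
    by (rule ext, subst partial_deriv_eq)
       (auto intro!: has_derivative_mult d[unfolded frechet_derivative_works] simp: partial_deriv_def)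
  with Suc d Ck_function_SucD[OF Suc.prems(1)] Ck_function_SucD[OF Suc.prems(2)] show ?case
    by (auto intro!: Ck_function_add)
qed

lemma smooth_function_const [simp]: "smooth_function (\<lambda>x. c)"
  by (simp add: smooth_function_def)

lemma smooth_function_add:
  "smooth_function f \<Longrightarrow> smooth_function g \<Longrightarrow> smooth_function (\<lambda>x. f x + g x)"
  by (simp add: smooth_function_def Ck_function_add)

lemma smooth_function_mult:
  "smooth_function f \<Longrightarrow> smooth_function g \<Longrightarrow> smooth_function (\<lambda>x. f x * g x)"
  by (simp add: smooth_function_def Ck_function_mult)

lemma smooth_function_diff:
  assumes "smooth_function f" "smooth_function g"
  shows "smooth_function (\<lambda>x. f x - g x)"
proof -
  have "smooth_function (\<lambda>x. f x + (-1) * g x)"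
    by (intro smooth_function_add smooth_function_mult smooth_function_const assms)
  then show ?thesis by simp
qed

lemma smooth_function_prod:
  "(\<And>i. i \<in> I \<Longrightarrow> smooth_function (f i)) \<Longrightarrow> smooth_function (\<lambda>x. \<Prod>i\<in>I. f i x)"
  by (induction I rule: infinite_finite_induct) (auto intro: smooth_function_mult)

lemma smooth_function_differentiable: "smooth_function f \<Longrightarrow> f differentiable (at x)"
  unfolding smooth_function_def by (drule spec[of _ 1]) simp

lemma smooth_function_continuous: "smooth_function f \<Longrightarrow> continuous_on S f"
  unfolding smooth_function_def by (drule spec[of _ 0]) (auto intro: continuous_on_subset)

lemma smooth_function_partial_continuous:
  "smooth_function f \<Longrightarrow> continuous_on S (partial_deriv i f)"
  unfolding smooth_function_def by (drule spec[of _ 1]) (auto intro: continuous_on_subset)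

text \<open>The family is closed under differentiation, so each member is smooth although it vanishes
  identically on the negative half-line.\<close>

definition flat :: "real \<Rightarrow> nat \<Rightarrow> real \<Rightarrow> real" where
  "flat c k t = (if t > 0 then exp (- c / t) / t ^ k else 0)"

text \<open>With y = 1/t the claim says that the exponential beats every power: the function becomes
  y^k exp(-c y), a constant multiple of (c y)^k / exp(c y).\<close>

lemma flat_tendsto_0:
  assumes "c > 0"
  shows "(flat c k \<longlongrightarrow> 0) (at_right 0)"
proof -
  have lim: "filterlim (\<lambda>y. c * y) at_top at_top"
    by (rule filterlim_tendsto_pos_mult_at_top[OF tendsto_const assms filterlim_ident])
  have "((\<lambda>y. (1 / c ^ k) * ((c * y) ^ k / exp (c * y))) \<longlongrightarrow> (1 / c ^ k) * 0) at_top"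
    by (intro tendsto_mult tendsto_const filterlim_compose[OF tendsto_power_div_exp_0 lim])
  moreover have "\<forall>\<^sub>F y in at_top. (1 / c ^ k) * ((c * y) ^ k / exp (c * y)) = flat c k (inverse y)"
    using eventually_gt_at_top[of 0]
  proof eventually_elim
    case (elim y)
    then show ?case using assms by (auto simp: flat_def field_simps exp_minus)
  qed
  ultimately show ?thesis
    unfolding filterlim_at_right_to_top using tendsto_cong by fastforce
qed

lemma DERIV_flat:
  assumes "c > 0"
  shows "(flat c k has_field_derivative c * flat c (k + 2) t - real k * flat c (k + 1) t) (at t)"
proof -
  consider "t > 0" | "t < 0" | "t = 0" by linarith
  then show ?thesis
  proof cases
    case 1
    have "((\<lambda>t. exp (- c / t) / t ^ k) has_field_derivative
            c * flat c (k + 2) t - real k * flat c (k + 1) t) (at t)"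
      using 1 by (auto intro!: derivative_eq_intros simp: flat_def field_simps power2_eq_square)
         (cases k, auto simp: field_simps)
    then show ?thesis
      by (rule has_field_derivative_transform_within_open[of _ _ _ "{0<..}"])
         (use 1 in \<open>auto simp: flat_def\<close>)
  next
    case 2
    have "((\<lambda>t. 0) has_field_derivative c * flat c (k + 2) t - real k * flat c (k + 1) t) (at t)"
      using 2 by (auto simp: flat_def)
    then show ?thesis
      by (rule has_field_derivative_transform_within_open[of _ _ _ "{..<0}"])
         (use 2 in \<open>auto simp: flat_def\<close>)
  next
    case 3
    \<comment> \<open>For h > 0 the difference quotient at 0 is again a member of the family,
      \<open>flat c (Suc k) h\<close>.\<close>
    have "((\<lambda>h. flat c k h / h) \<longlongrightarrow> 0) (at_right 0)"
      using flat_tendsto_0[OF assms, of "Suc k"]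
      by (rule tendsto_cong[THEN iffD1, rotated])
         (auto simp: eventually_at_filter flat_def)
    moreover have "((\<lambda>h. flat c k h / h) \<longlongrightarrow> 0) (at_left 0)"
      by (rule tendsto_eventually) (auto simp: eventually_at_filter flat_def)
    ultimately have "((\<lambda>h. flat c k h / h) \<longlongrightarrow> 0) (at 0)"
      by (simp add: filterlim_split_at)
    then show ?thesis
      using 3 by (simp add: DERIV_def flat_def)
  qed
qed

text \<open>Differentiation raises k by one or two, so the induction on n is carried out for all k
  at once. Affine functions of a single coordinate are all that a box needs: s = 1 and s = -1 give
  its two faces in direction i.\<close>

lemma Ck_function_flat:
  assumes "c > 0"
  shows "Ck_function n (\<lambda>x::real^'d. flat c k (s * x $ i + b))"
proof (induction n arbitrary: k)
  case 0
  have "isCont (flat c k) t" for t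
    using DERIV_flat[OF assms] DERIV_isCont by blast
  then have "continuous_on UNIV (flat c k)"
    by (simp add: continuous_at_imp_continuous_on)
  then have "continuous_on UNIV (\<lambda>x::real^'d. flat c k (s * x $ i + b))"
    by (rule continuous_on_compose2) (auto intro!: continuous_intros)
  then show ?case by simp
next
  case (Suc n)
  let ?F' = "\<lambda>t. c * flat c (k + 2) t - real k * flat c (k + 1) t"
  have D: "((\<lambda>x::real^'d. flat c k (s * x $ i + b)) has_derivative
      (\<lambda>h. ?F' (s * x $ i + b) * (s * h $ i))) (at x)" for x
  proof -
    have "((\<lambda>x::real^'d. s * x $ i + b) has_derivative (\<lambda>h. s * h $ i)) (at x)"
      by (auto intro!: derivative_eq_intros bounded_linear.has_derivative[OF bounded_linear_vec_nth])
    from has_derivative_compose[OF this DERIV_flat[OF assms, unfolded has_field_derivative_def]]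
    show ?thesis by simp
  qed
  have "partial_deriv j (\<lambda>x::real^'d. flat c k (s * x $ i + b))
      = (\<lambda>x. (s * (if j = i then c else 0)) * flat c (k + 2) (s * x $ i + b)
         + (- (s * (if j = i then real k else 0))) * flat c (k + 1) (s * x $ i + b))" for j
    by (rule ext, subst partial_deriv_eq[OF D]) (simp add: axis_def algebra_simps)
  moreover have "(\<lambda>x::real^'d. flat c k (s * x $ i + b)) differentiable (at x)" for x
    using D unfolding differentiable_def by blast
  moreover have "Ck_function n (\<lambda>x::real^'d. u * flat c (k + 2) (s * x $ i + b)
      + v * flat c (k + 1) (s * x $ i + b))" for u v
    by (intro Ck_function_add Ck_function_mult Ck_function_const Suc.IH)
  ultimately show ?case
    by (simp only: Ck_function.simps simp_thms)
qed

text \<open>Only the rate c = 1/(n+1) varies with n while the support stays fixed, so the bumps tend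
  pointwise to the indicator of the open box. The factors 1 and -1 are spelled out to match the form
  in \<open>Ck_function_flat\<close>.\<close>

definition box_bump :: "real^'d \<Rightarrow> real^'d \<Rightarrow> nat \<Rightarrow> real^'d \<Rightarrow> real" where
  "box_bump a b n x = (\<Prod>i\<in>UNIV. flat (1 / Suc n) 0 (1 * x $ i + (- a $ i)) *
     flat (1 / Suc n) 0 ((- 1) * x $ i + b $ i))"

lemma smooth_function_box_bump: "smooth_function (box_bump a b n)"
proof -
  have "smooth_function (\<lambda>x. flat (1 / Suc n) 0 (1 * x $ i + (- a $ i)) *
     flat (1 / Suc n) 0 ((- 1) * x $ i + b $ i))" for i
    unfolding smooth_function_def by (intro allI Ck_function_mult Ck_function_flat) auto
  then have "smooth_function (\<lambda>x. box_bump a b n x)"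
    unfolding box_bump_def by (intro smooth_function_prod)
  then show ?thesis by simp
qed

lemma box_bump_eq_0_iff: "box_bump a b n x = 0 \<longleftrightarrow> x \<notin> box a b"
  by (auto simp: box_bump_def flat_def mem_box_cart not_less) (metis linorder_not_less)+

lemma flat_bounds: "c > 0 \<Longrightarrow> 0 \<le> flat c 0 t \<and> flat c 0 t \<le> 1"
  by (auto simp: flat_def)

lemma box_bump_nonneg: "0 \<le> box_bump a b n x"
  unfolding box_bump_def by (intro prod_nonneg mult_nonneg_nonneg ballI) (use flat_bounds in auto)

lemma box_bump_le_1: "box_bump a b n x \<le> 1"
  unfolding box_bump_def
  by (intro prod_le_1 conjI mult_nonneg_nonneg mult_le_one ballI) (use flat_bounds in auto)

lemma box_bump_tendsto_indicator: "(\<lambda>n. box_bump a b n x) \<longlonglongrightarrow> indicator (box a b) x"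
proof (cases "x \<in> box a b")
  case True
  have flat1: "(\<lambda>n. flat (1 / Suc n) 0 t) \<longlonglongrightarrow> 1" if "t > 0" for t
  proof -
    have "(\<lambda>n. exp (- (1 / Suc n) / t)) \<longlonglongrightarrow> exp (- 0 / t)"
      by (intro tendsto_intros LIMSEQ_inverse_real_of_nat[unfolded inverse_eq_divide]) (use that in auto)
    then show ?thesis using that by (simp add: flat_def)
  qed
  have "(\<lambda>n. box_bump a b n x) \<longlonglongrightarrow> (\<Prod>i\<in>(UNIV::'a set). 1 * 1)"
    unfolding box_bump_def by (intro tendsto_prod tendsto_mult flat1) (use True in \<open>auto simp: mem_box_cart\<close>)
  with True show ?thesis by simp
next
  case False
  then have "box_bump a b n x = 0" for n by (simp add: box_bump_eq_0_iff)
  with False show ?thesis by simp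
qed

lemma test_function_box_bump:
  assumes "cbox a b \<subseteq> \<Omega>"
  shows "test_function \<Omega> (box_bump a b n)"
proof -
  have "closure {x. box_bump a b n x \<noteq> 0} \<subseteq> cbox a b"
    by (intro closure_minimal) (auto simp: box_bump_eq_0_iff dest: subsetD[OF box_subset_cbox])
  then show ?thesis
    using assms smooth_function_box_bump
    by (auto simp: test_function_def compact_eq_bounded_closed intro: bounded_subset[OF bounded_cbox])
qed

section \<open>Weak gradients\<close>

text \<open>Open boxes are stable under intersection and generate the Borel sets, so a Dynkin
  argument extends the vanishing to all Borel sets, and a function whose integrals all vanish is
  zero almost everywhere.\<close>

lemma AE_zero_if_box_integrals_zero:
  fixes g :: "'a::euclidean_space \<Rightarrow> real"
  assumes int: "integrable lborel g" and box0: "\<And>a b. (LINT x|lborel. indicator (box a b) x * g x) = 0"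
  shows "AE x in lborel. g x = 0"
proof -
  have int': "integrable lborel (\<lambda>x. indicator A x * g x)" if "A \<in> sets borel" for A
    using integrable_mult_indicator[OF _ int, of A] that by simp
  \<comment> \<open>The whole space is not a box, yet the complement step of the induction subtracts
    from its integral; it is reached by exhaustion with growing boxes.\<close>
  have UNIV0: "(LINT x|lborel. g x) = 0"
  proof -
    have "(\<lambda>n. LINT x|lborel. indicator (box (- real n *\<^sub>R One) (real n *\<^sub>R One)) x * g x)
        \<longlonglongrightarrow> (LINT x|lborel. g x)"
    proof (rule integral_dominated_convergence[where w="\<lambda>x. \<bar>g x\<bar>"])
      show "AE x in lborel. (\<lambda>n. indicator (box (- real n *\<^sub>R One) (real n *\<^sub>R One)) x * g x) \<longlonglongrightarrow> g x"
      proof (rule AE_I2, rule tendsto_eventually)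
        fix x :: 'a
        obtain n0 :: nat where n0: "norm x < n0" using reals_Archimedean2 by blast
        show "\<forall>\<^sub>F n in sequentially. indicator (box (- real n *\<^sub>R One) (real n *\<^sub>R One)) x * g x = g x"
          using eventually_ge_at_top[of n0]
        proof eventually_elim
          case (elim n)
          have "\<bar>x \<bullet> i\<bar> < n" if "i \<in> Basis" for i
            using Basis_le_norm[OF that, of x] n0 elim by linarith
          then have "x \<in> box (- real n *\<^sub>R One) (real n *\<^sub>R One)"
            by (simp add: mem_box abs_less_iff minus_less_iff)
          then show ?case by simp
        qed
      qed
    qed (use int in \<open>auto simp: indicator_def\<close>)
    then show ?thesis unfolding box0 LIMSEQ_const_iff by simp
  qed
  have zero: "(LINT x|lborel. indicator A x * g x) = 0" if "A \<in> sets borel" for A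
  proof -
    let ?G = "range (\<lambda>(a, b). box a b :: 'a set)"
    have "Int_stable ?G"
      by (auto simp: Int_stable_def box_Int_box)
    moreover have "?G \<subseteq> Pow UNIV" by simp
    moreover have "A \<in> sigma_sets UNIV ?G"
      using that by (simp add: borel_eq_box)
    ultimately show ?thesis
    proof (induction rule: sigma_sets_induct_disjoint)
      case (basic A)
      then show ?case using box0 by auto
    next
      case empty
      then show ?case by simp
    next
      case (compl A)
      then have A: "A \<in> sets borel" by (simp add: borel_eq_box)
      have "(LINT x|lborel. indicator (UNIV - A) x * g x) = (LINT x|lborel. g x - indicator A x * g x)"
        by (intro Bochner_Integration.integral_cong) (auto simp: indicator_def)
      also have "\<dots> = 0"
        using compl UNIV0 int int'[OF A] by simp
      finally show ?case .
    next
      case (union A)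
      then have A: "A i \<in> sets borel" for i by (auto simp: borel_eq_box)
      have "(LINT x:(\<Union>i. A i)|lborel. g x) = (\<Sum>i. (LINT x:(A i)|lborel. g x))"
        by (intro lebesgue_integral_countable_add)
           (use A union int' in \<open>auto simp: disjoint_family_on_def set_integrable_def\<close>)
      then show ?case using union by (simp add: set_lebesgue_integral_def)
    qed
  qed
  show ?thesis
    by (intro sigma_finite_measure.density_zero[OF sigma_finite_lborel] int) (use zero in \<open>auto simp: set_lebesgue_integral_def\<close>)
qed

lemma AE_lebesgue_on_iff:
  assumes "S \<in> sets lebesgue"
  shows "(AE x in lebesgue_on S. P x) \<longleftrightarrow> (AE x in lebesgue. x \<in> S \<longrightarrow> P x)"
  using AE_restrict_space_iff[of S lebesgue] assms by simp

text \<open>The fundamental lemma of the calculus of variations. Bumps converge boundedly to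
  indicators of boxes whose closure lies in \<Omega>, which reduces the claim to box integrals on
  each of countably many closed boxes covering \<Omega>.\<close>

lemma AE_zero_if_test_integrals_zero:
  fixes g :: "real^'d \<Rightarrow> real"
  assumes "open \<Omega>" and int: "integrable (lebesgue_on \<Omega>) g"
    and test0: "\<And>\<phi>. test_function \<Omega> \<phi> \<Longrightarrow> (LINT x|lebesgue_on \<Omega>. g x * \<phi> x) = 0"
  shows "AE x in lebesgue_on \<Omega>. g x = 0"
proof -
  have \<Omega>: "\<Omega> \<in> sets lebesgue" using \<open>open \<Omega>\<close> by auto
  then have intG: "integrable lebesgue (\<lambda>x. indicator \<Omega> x * g x)"
    using int by (simp add: integrable_restrict_space)
  \<comment> \<open>The argument on boxes lives on Borel sets, so g, extended by 0, is replaced by a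
    Borel function that agrees with it almost everywhere.\<close>
  then obtain h where h[measurable]: "h \<in> borel_measurable lborel"
    and h_AE: "AE x in lborel. indicator \<Omega> x * g x = h x"
    using completion_ex_borel_measurable_real[OF borel_measurable_integrable] by blast
  have h_AE': "AE x in lebesgue. indicator \<Omega> x * g x = h x"
    using h_AE by (rule AE_completion)
  have int_h: "integrable lborel h"
  proof -
    have "integrable lebesgue h"
      by (rule integrable_cong_AE_imp[OF intG])
         (use h_AE' in \<open>auto intro: measurable_completion\<close>)
    then show ?thesis by (simp add: integrable_completion)
  qed
  have box0: "(LINT x|lborel. indicator (box a b) x * h x) = 0" if "cbox a b \<subseteq> \<Omega>" for a b
  proof -
    have "(\<lambda>n. LINT x|lebesgue_on \<Omega>. g x * box_bump a b n x)
        \<longlonglongrightarrow> (LINT x|lebesgue_on \<Omega>. g x * indicator (box a b) x)"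
    proof (rule integral_dominated_convergence[where w="\<lambda>x. \<bar>g x\<bar>"])
      show "AE x in lebesgue_on \<Omega>. (\<lambda>n. g x * box_bump a b n x) \<longlonglongrightarrow> g x * indicator (box a b) x"
        by (intro AE_I2 tendsto_mult tendsto_const box_bump_tendsto_indicator)
      have "box_bump a b n \<in> borel_measurable borel" for n
        using smooth_function_continuous[OF smooth_function_box_bump]
        by (rule borel_measurable_continuous_onI)
      then have "box_bump a b n \<in> borel_measurable (lebesgue_on \<Omega>)" for n
        by (intro measurable_restrict_space1 measurable_completion) auto
      then show "(\<lambda>x. g x * box_bump a b n x) \<in> borel_measurable (lebesgue_on \<Omega>)" for n
        using int by auto
      show "(\<lambda>x. g x * indicat_real (box a b) x) \<in> borel_measurable (lebesgue_on \<Omega>)"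
        by (intro borel_measurable_times borel_measurable_integrable[OF int] measurable_restrict_space1
            borel_measurable_indicator) simp
      show "AE x in lebesgue_on \<Omega>. norm (g x * box_bump a b n x) \<le> \<bar>g x\<bar>" for n
        by (intro AE_I2) (simp only: real_norm_def abs_mult abs_of_nonneg[OF box_bump_nonneg]
            mult_left_le[OF box_bump_le_1 abs_ge_zero])
    qed (use int in auto)
    then have "(LINT x|lebesgue_on \<Omega>. g x * indicator (box a b) x) = 0"
      unfolding test0[OF test_function_box_bump[OF that]] LIMSEQ_const_iff by simp
    also have "(LINT x|lebesgue_on \<Omega>. g x * indicator (box a b) x)
        = (LINT x|lebesgue. indicator (box a b) x * h x)"
      unfolding integral_restrict_space[of \<Omega> lebesgue, simplified, OF \<Omega>]
    proof (rule integral_cong_AE)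
      have "integrable lebesgue (\<lambda>x. indicator (box a b) x * (indicator \<Omega> x * g x))"
        using integrable_mult_indicator[OF _ intG, of "box a b"] by simp
      then show "(\<lambda>x. indicat_real \<Omega> x *\<^sub>R (g x * indicat_real (box a b) x)) \<in> borel_measurable lebesgue"
        by (simp add: mult_ac)
      show "(\<lambda>x. indicat_real (box a b) x * h x) \<in> borel_measurable lebesgue"
        by (intro measurable_completion) auto
      show "AE x in lebesgue. indicat_real \<Omega> x *\<^sub>R (g x * indicat_real (box a b) x) = indicat_real (box a b) x * h x"
        using h_AE'
      proof eventually_elim
        case (elim x)
        have "indicat_real \<Omega> x *\<^sub>R (g x * indicat_real (box a b) x)
            = indicat_real (box a b) x * (indicator \<Omega> x * g x)"
          by simp
        with elim show ?case by simp
      qed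
    qed
    also have "\<dots> = (LINT x|lborel. indicator (box a b) x * h x)"
      by (intro integral_completion) auto
    finally show ?thesis .
  qed
  have cbox_zero: "AE x in lborel. x \<in> cbox c d \<longrightarrow> h x = 0" if cd: "cbox c d \<subseteq> \<Omega>" for c d
  proof -
    have "AE x in lborel. indicator (box c d) x * h x = 0"
    proof (rule AE_zero_if_box_integrals_zero)
      show "integrable lborel (\<lambda>x. indicator (box c d) x * h x)"
        using integrable_mult_indicator[OF _ int_h, of "box c d"] by simp
      fix a b
      obtain a' b' where eq: "box a b \<inter> box c d = box a' b'"
        using box_Int_box by blast
      have "(LINT x|lborel. indicator (box a b) x * (indicator (box c d) x * h x))
          = (LINT x|lborel. indicator (box a' b') x * h x)"
        unfolding eq[symmetric] by (simp add: indicator_inter_arith mult.assoc)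
      \<comment> \<open>A nonempty open box has the corresponding closed box as its closure, which
        therefore stays inside \<open>cbox c d\<close>. For an empty box this may fail, but then the
        integral vanishes trivially.\<close>
      also have "\<dots> = 0"
      proof (cases "box a' b' = {}")
        case False
        then have "cbox a' b' \<subseteq> cbox c d"
          using eq by (metis closure_box closure_minimal closed_cbox Int_lower2 box_subset_cbox order_trans)
        with cd show ?thesis by (intro box0) auto
      qed simp
      finally show "(LINT x|lborel. indicator (box a b) x * (indicator (box c d) x * h x)) = 0" .
    qed
    \<comment> \<open>The cover of \<Omega> consists of closed boxes, whereas the indicator sees
      only the open ones; the faces in between are null.\<close>
    moreover have "AE x in lborel. x \<notin> cbox c d - box c d"
    proof (rule AE_not_in)
      have "cbox c d - box c d \<in> null_sets lebesgue"
        using negligible_frontier_interval by (simp add: negligible_iff_null_sets)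
      then show "cbox c d - box c d \<in> null_sets lborel"
        by (auto simp: null_sets_completion_iff)
    qed
    ultimately show ?thesis by eventually_elim (auto simp: indicator_def split: if_splits)
  qed
  obtain \<D> where \<D>: "countable \<D>" "\<And>X. X \<in> \<D> \<Longrightarrow> \<exists>a b. X = cbox a b" "\<Union>\<D> = \<Omega>"
    using open_countable_Union_open_cbox[OF \<open>open \<Omega>\<close>] by metis
  have "AE x in lborel. \<forall>X\<in>\<D>. x \<in> X \<longrightarrow> h x = 0"
    unfolding AE_ball_countable[OF \<D>(1)] using \<D> cbox_zero by blast
  then have "AE x in lborel. x \<in> \<Omega> \<longrightarrow> h x = 0"
    by eventually_elim (use \<D>(3) in auto)
  then have "AE x in lebesgue. x \<in> \<Omega> \<longrightarrow> h x = 0" by (rule AE_completion)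
  with h_AE' show ?thesis
    unfolding AE_lebesgue_on_iff[OF \<Omega>] by eventually_elim (auto simp: indicator_def)
qed

section \<open>Classical gradients and integration by parts\<close>

definition gradient :: "(real^'d \<Rightarrow> real) \<Rightarrow> real^'d \<Rightarrow> real^'d" where
  "gradient \<phi> x = (\<chi> i. partial_deriv i \<phi> x)"

lemma has_derivative_gradient:
  assumes "\<phi> differentiable (at x)"
  shows "(\<phi> has_derivative (\<lambda>h. gradient \<phi> x \<bullet> h)) (at x)"
proof -
  let ?D = "frechet_derivative \<phi> (at x)"
  have D: "(\<phi> has_derivative ?D) (at x)" using assms by (simp add: frechet_derivative_works)
  then have lin: "linear ?D" by (rule has_derivative_linear)
  have "?D h = gradient \<phi> x \<bullet> h" for h
  proof -
    have "?D h = ?D (\<Sum>i\<in>UNIV. h $ i *\<^sub>R axis i 1)"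
      using basis_expansion[of h] by (simp add: scalar_mult_eq_scaleR)
    also have "\<dots> = (\<Sum>i\<in>UNIV. h $ i *\<^sub>R ?D (axis i 1))"
      using lin by (simp add: linear_sum linear_scale)
    also have "\<dots> = gradient \<phi> x \<bullet> h"
      by (simp add: gradient_def inner_vec_def partial_deriv_def mult.commute)
    finally show ?thesis .
  qed
  then have "?D = (\<lambda>h. gradient \<phi> x \<bullet> h)" by (rule ext)
  with D show ?thesis by simp
qed

lemma DERIV_along_line:
  assumes "\<And>x. \<phi> differentiable (at x)"
  shows "((\<lambda>t. \<phi> (x + t *\<^sub>R v)) has_real_derivative gradient \<phi> (x + t *\<^sub>R v) \<bullet> v) (at t within S)"
proof -
  have "((\<lambda>t. x + t *\<^sub>R v) has_derivative (\<lambda>h. h *\<^sub>R v)) (at t within S)"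
    by (auto intro!: derivative_eq_intros)
  from has_derivative_compose[OF this has_derivative_gradient[OF assms]]
  show ?thesis by (simp add: has_field_derivative_def mult.commute[of _ "_ \<bullet> _"] mult_commute_abs)
qed

lemma smooth_function_continuous_gradient:
  "smooth_function \<phi> \<Longrightarrow> continuous_on S (gradient \<phi>)"
  unfolding gradient_def by (intro continuous_on_vec_lambda smooth_function_partial_continuous)

lemma partial_deriv_zero_outside_support:
  assumes "x \<notin> closure {x. \<phi> x \<noteq> 0}"
  shows "partial_deriv i \<phi> x = 0"
proof -
  have "((\<lambda>x. 0) has_derivative (\<lambda>h. 0)) (at x)" by simp
  then have "(\<phi> has_derivative (\<lambda>h. 0)) (at x)"
    by (rule has_derivative_transform_within_open[of _ _ _ _ "- closure {x. \<phi> x \<noteq> 0}"])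
       (use assms closure_subset[of "{x. \<phi> x \<noteq> 0}"] in auto)
  from partial_deriv_eq[OF this] show ?thesis .
qed

lemma partial_deriv_mult:
  assumes "f differentiable (at x)" "g differentiable (at x)"
  shows "partial_deriv i (\<lambda>x. f x * g x) x = f x * partial_deriv i g x + partial_deriv i f x * g x"
  by (subst partial_deriv_eq)
     (auto intro!: has_derivative_mult assms[unfolded frechet_derivative_works] simp: partial_deriv_def)

lemma bounded_if_zero_outside_compact:
  fixes f :: "'a::metric_space \<Rightarrow> 'b::real_normed_vector"
  assumes "continuous_on UNIV f" "compact K" "\<And>x. x \<notin> K \<Longrightarrow> f x = 0"
  obtains B where "\<And>x. norm (f x) \<le> B" "B \<ge> 0"
proof -
  have "bounded (f ` K)"
    by (intro compact_imp_bounded compact_continuous_image continuous_on_subset[OF assms(1)] assms(2)) simp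
  then obtain B where B: "\<And>x. x \<in> K \<Longrightarrow> norm (f x) \<le> B" by (auto simp: bounded_iff)
  have "norm (f x) \<le> max B 0" for x
    using B[of x] assms(3)[of x] by (cases "x \<in> K") auto
  then show ?thesis using that[of "max B 0"] by simp
qed

lemma integrable_continuous_zero_outside_compact:
  fixes f :: "'a::euclidean_space \<Rightarrow> real"
  assumes "continuous_on UNIV f" "compact K" "\<And>x. x \<notin> K \<Longrightarrow> f x = 0"
  shows "integrable lborel f"
proof -
  have "integrable lborel (\<lambda>x. indicator K x *\<^sub>R f x)"
    by (intro borel_integrable_compact assms continuous_on_subset[OF assms(1)]) simp
  also have "(\<lambda>x. indicator K x *\<^sub>R f x) = f" using assms(3) by (auto simp: indicator_def fun_eq_iff)
  finally show ?thesis .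
qed

text \<open>The difference quotients have integral 0 by translation invariance and converge to the
  partial derivative; the mean value theorem bounds them uniformly.\<close>

lemma integral_partial_deriv_eq_0:
  fixes F :: "real^'d \<Rightarrow> real"
  assumes F: "smooth_function F" and K: "compact (closure {x. F x \<noteq> 0})" (is "compact ?K")
  shows "(LINT x|lborel. partial_deriv i F x) = 0"
proof -
  let ?v = "axis i 1 :: real^'d"
  let ?h = "\<lambda>n. 1 / real (Suc n)"
  define q where "q n x = (F (x + ?h n *\<^sub>R ?v) - F x) / ?h n" for n x
  have v: "norm ?v = 1" by simp
  have grad: "gradient F x \<bullet> ?v = partial_deriv i F x" for x
    by (simp add: gradient_def inner_axis)
  have F0: "F x = 0" if "x \<notin> ?K" for x using that closure_subset[of "{x. F x \<noteq> 0}"] by blast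
  obtain B where B: "\<And>x. norm (partial_deriv i F x) \<le> B" "B \<ge> 0"
    by (rule bounded_if_zero_outside_compact[OF smooth_function_partial_continuous[OF F] K
        partial_deriv_zero_outside_support[where i = i]]) (assumption, rule that)
  obtain R where R: "\<And>x. x \<in> ?K \<Longrightarrow> norm x \<le> R"
    using compact_imp_bounded[OF K] unfolding bounded_iff by blast
  have intF: "integrable lborel F"
    by (rule integrable_continuous_zero_outside_compact[OF smooth_function_continuous[OF F] K F0])
  have shift: "integrable lborel (\<lambda>x. F (c + x))" "(LINT x|lborel. F (c + x)) = (LINT x|lborel. F x)" for c
  proof -
    have "integrable (distr lborel borel ((+) c)) F" using intF by (simp add: lborel_distr_plus)
    then show "integrable lborel (\<lambda>x. F (c + x))"
      by (subst (asm) integrable_distr_eq) (use intF in auto)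
    have "(LINT x|lborel. F x) = (LINT x|distr lborel borel ((+) c). F x)" by (simp add: lborel_distr_plus)
    also have "\<dots> = (LINT x|lborel. F (c + x))"
      by (rule integral_distr) (use intF in auto)
    finally show "(LINT x|lborel. F (c + x)) = (LINT x|lborel. F x)" ..
  qed
  have q0: "(LINT x|lborel. q n x) = 0" for n
    using shift[of "?h n *\<^sub>R ?v"] intF by (simp add: q_def add.commute)
  \<comment> \<open>The shifts have length at most 1, so all difference quotients vanish outside a
    ball of radius R + 1 when the support lies in the ball of radius R.\<close>
  have "(\<lambda>n. LINT x|lborel. q n x) \<longlonglongrightarrow> (LINT x|lborel. partial_deriv i F x)"
  proof (rule integral_dominated_convergence[where w="\<lambda>x. indicator (cball 0 (R + 1)) x * B"])
    show "partial_deriv i F \<in> borel_measurable lborel"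
      using smooth_function_partial_continuous[OF F] by (auto intro: borel_measurable_continuous_onI)
    show "q n \<in> borel_measurable lborel" for n
      unfolding q_def using shift(1)[of "?h n *\<^sub>R ?v"] intF
      by (intro borel_measurable_divide borel_measurable_diff) (auto simp: add.commute)
    have "integrable lborel (\<lambda>x::real^'d. indicator (cball 0 (R + 1)) x *\<^sub>R B)"
      by (intro borel_integrable_compact) auto
    then show "integrable lborel (\<lambda>x::real^'d. indicator (cball 0 (R + 1)) x * B)" by simp
    show "AE x in lborel. (\<lambda>n. q n x) \<longlonglongrightarrow> partial_deriv i F x"
    proof (rule AE_I2)
      fix x
      have "((\<lambda>t. F (x + t *\<^sub>R ?v)) has_real_derivative gradient F (x + 0 *\<^sub>R ?v) \<bullet> ?v) (at 0)"
        by (rule DERIV_along_line) (rule smooth_function_differentiable[OF F])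
      then have "((\<lambda>h. (F (x + h *\<^sub>R ?v) - F x) / h) \<longlongrightarrow> partial_deriv i F x) (at 0)"
        by (simp add: DERIV_def grad)
      moreover have "filterlim ?h (at 0) sequentially"
        unfolding filterlim_at by (auto intro!: LIMSEQ_inverse_real_of_nat[unfolded inverse_eq_divide] simp del: of_nat_Suc)
      ultimately show "(\<lambda>n. q n x) \<longlonglongrightarrow> partial_deriv i F x"
        unfolding q_def by (rule filterlim_compose)
    qed
    show "AE x in lborel. norm (q n x) \<le> indicator (cball 0 (R + 1)) x * B" for n
    proof (rule AE_I2)
      fix x
      show "norm (q n x) \<le> indicator (cball 0 (R + 1)) x * B"
      proof (cases "x \<in> cball 0 (R + 1)")
        case False
        then have x: "norm x > R + 1" by simp
        have "norm x \<le> norm (x + ?h n *\<^sub>R ?v) + norm (?h n *\<^sub>R ?v)"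
          by (metis add_diff_cancel norm_triangle_ineq4)
        moreover have "norm (?h n *\<^sub>R ?v) \<le> 1" using v by (simp add: field_simps)
        ultimately have "norm (x + ?h n *\<^sub>R ?v) > R" using x by linarith
        then have "x + ?h n *\<^sub>R ?v \<notin> ?K" "x \<notin> ?K" using R x by force+
        then have "F (x + ?h n *\<^sub>R ?v) = 0" "F x = 0" using F0 by blast+
        then show ?thesis using False by (simp add: q_def)
      next
        case True
        have "\<exists>z. 0 < z \<and> z < ?h n \<and> F (x + ?h n *\<^sub>R ?v) - F (x + 0 *\<^sub>R ?v)
            = (?h n - 0) * (gradient F (x + z *\<^sub>R ?v) \<bullet> ?v)"
          by (rule MVT2) (auto intro!: DERIV_along_line smooth_function_differentiable[OF F])
        then obtain z where "F (x + ?h n *\<^sub>R ?v) - F x = ?h n * partial_deriv i F (x + z *\<^sub>R ?v)"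
          by (auto simp: grad)
        then have "q n x = partial_deriv i F (x + z *\<^sub>R ?v)"
          by (simp add: q_def)
        then show ?thesis using B(1) True by simp
      qed
    qed
  qed
  then show ?thesis unfolding q0 LIMSEQ_const_iff by simp
qed

lemma test_functionD:
  assumes "test_function \<Omega> \<phi>"
  shows "smooth_function \<phi>" "\<exists>B. (\<forall>x. \<bar>\<phi> x\<bar> \<le> B) \<and> (\<forall>x. \<bar>partial_deriv i \<phi> x\<bar> \<le> B)"
proof -
  let ?K = "closure {x. \<phi> x \<noteq> 0}"
  show sm: "smooth_function \<phi>" using assms by (auto simp: test_function_def)
  have K: "compact ?K" using assms by (auto simp: test_function_def)
  have z: "\<phi> x = 0" if "x \<notin> ?K" for x using that closure_subset[of "{x. \<phi> x \<noteq> 0}"] by blast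
  obtain B1 where B1: "\<And>x. norm (\<phi> x) \<le> B1" "B1 \<ge> 0"
    by (rule bounded_if_zero_outside_compact[OF smooth_function_continuous[OF sm] K z]) (assumption, rule that)
  obtain B2 where B2: "\<And>x. norm (partial_deriv i \<phi> x) \<le> B2" "B2 \<ge> 0"
    by (rule bounded_if_zero_outside_compact[OF smooth_function_partial_continuous[OF sm] K
        partial_deriv_zero_outside_support[where i = i]]) (assumption, rule that)
  show "\<exists>B. (\<forall>x. \<bar>\<phi> x\<bar> \<le> B) \<and> (\<forall>x. \<bar>partial_deriv i \<phi> x\<bar> \<le> B)"
    using B1 B2 by (intro exI[of _ "max B1 B2"]) (auto simp: max.coboundedI1 max.coboundedI2)
qed

lemma borel_measurable_lebesgue_on_continuous:
  fixes f :: "'a::euclidean_space \<Rightarrow> 'b::topological_space"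
  assumes "continuous_on UNIV f"
  shows "f \<in> borel_measurable (lebesgue_on \<Omega>)"
proof -
  have "f \<in> borel_measurable lborel" using assms by (auto intro: borel_measurable_continuous_onI)
  then show ?thesis by (intro measurable_restrict_space1 measurable_completion)
qed

lemma integrable_lebesgue_on_continuous:
  fixes f :: "'a::euclidean_space \<Rightarrow> 'b::{banach, second_countable_topology}"
  assumes "continuous_on UNIV f" "bounded \<Omega>" "\<Omega> \<in> sets lebesgue"
  shows "integrable (lebesgue_on \<Omega>) f"
proof -
  obtain a b where ab: "\<Omega> \<subseteq> cbox a b" using bounded_subset_cbox_symmetric[OF assms(2)] by blast
  have "integrable lborel (\<lambda>x. indicator (cbox a b) x *\<^sub>R f x)"
    by (intro borel_integrable_compact continuous_on_subset[OF assms(1)]) auto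
  then have "integrable lebesgue (\<lambda>x. indicator (cbox a b) x *\<^sub>R f x)"
    using integrable_completion by (metis borel_measurable_integrable)
  then have "integrable lebesgue (\<lambda>x. indicator \<Omega> x *\<^sub>R indicator (cbox a b) x *\<^sub>R f x)"
    by (rule integrable_mult_indicator[OF assms(3)])
  also have "(\<lambda>x. indicator \<Omega> x *\<^sub>R indicator (cbox a b) x *\<^sub>R f x) = (\<lambda>x. indicator \<Omega> x *\<^sub>R f x)"
    using ab by (auto simp: indicator_def fun_eq_iff)
  finally show ?thesis using assms(3) by (simp add: integrable_restrict_space)
qed

lemma integrable_mult_bounded:
  fixes f g :: "'a \<Rightarrow> real"
  assumes "integrable M f" "g \<in> borel_measurable M" "\<And>x. \<bar>g x\<bar> \<le> B"
  shows "integrable M (\<lambda>x. f x * g x)"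
proof (rule Bochner_Integration.integrable_bound)
  show "integrable M (\<lambda>x. B * f x)" using assms(1) by simp
  show "AE x in M. norm (f x * g x) \<le> norm (B * f x)"
  proof (rule AE_I2)
    fix x
    have "\<bar>g x\<bar> \<le> \<bar>B\<bar>" using assms(3)[of x] by linarith
    then show "norm (f x * g x) \<le> norm (B * f x)"
      by (simp add: abs_mult mult.commute[of "\<bar>B\<bar>"] mult_left_mono)
  qed
qed (use assms in auto)

lemma integrable_vec_nth:
  fixes G :: "'a \<Rightarrow> real^'d"
  shows "integrable M G \<Longrightarrow> integrable M (\<lambda>x. G x $ i)"
  by (rule integrable_bounded_linear[OF bounded_linear_vec_nth])

lemma integrable_mult_test_function:
  assumes "integrable (lebesgue_on \<Omega>) v" "test_function \<Omega>' \<phi>"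
  shows "integrable (lebesgue_on \<Omega>) (\<lambda>x. v x * \<phi> x)"
    and "integrable (lebesgue_on \<Omega>) (\<lambda>x. v x * partial_deriv i \<phi> x)"
  using test_functionD(1)[OF assms(2)] test_functionD(2)[OF assms(2), of i] assms(1)
  by (auto intro!: integrable_mult_bounded borel_measurable_lebesgue_on_continuous
      smooth_function_continuous smooth_function_partial_continuous)

text \<open>For a test function \<eta> the product of \<phi> and \<eta> has compact support inside
  \<Omega>, so its partial derivatives integrate to 0, and the product rule splits this into the two
  sides of the identity.\<close>

lemma smooth_has_weak_gradient:
  fixes \<Omega> :: "(real^'d) set"
  assumes \<Omega>: "bounded \<Omega>" "open \<Omega>" and \<phi>: "smooth_function \<phi>"
  shows "has_weak_gradient \<Omega> \<phi> (gradient \<phi>)"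
  unfolding has_weak_gradient_def
proof (intro conjI allI impI)
  have meas: "\<Omega> \<in> sets lebesgue" using \<Omega> by auto
  show int: "integrable (lebesgue_on \<Omega>) \<phi>" "integrable (lebesgue_on \<Omega>) (gradient \<phi>)"
    using \<phi> \<Omega> meas by (auto intro!: integrable_lebesgue_on_continuous smooth_function_continuous
        smooth_function_continuous_gradient)
  fix \<eta> i assume \<eta>: "test_function \<Omega> \<eta>"
  let ?F = "\<lambda>x. \<phi> x * \<eta> x"
  let ?K = "closure {x. \<eta> x \<noteq> 0}"
  have sm\<eta>: "smooth_function \<eta>" and K: "compact ?K" "?K \<subseteq> \<Omega>" using \<eta> by (auto simp: test_function_def)
  have smF: "smooth_function ?F" by (intro smooth_function_mult \<phi> sm\<eta>)
  have KF: "closure {x. ?F x \<noteq> 0} \<subseteq> ?K" by (intro closure_mono) auto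
  have cF: "continuous_on UNIV (partial_deriv i ?F)"
    by (rule smooth_function_partial_continuous[OF smF])
  have "0 = (LINT x|lborel. partial_deriv i ?F x)"
    using K(1) KF by (subst integral_partial_deriv_eq_0[OF smF])
      (auto simp: compact_eq_bounded_closed intro: bounded_subset)
  also have "\<dots> = (LINT x|lebesgue. partial_deriv i ?F x)"
    by (rule integral_completion[symmetric]) (use cF in \<open>auto intro: borel_measurable_continuous_onI\<close>)
  also have "(\<lambda>x. partial_deriv i ?F x) = (\<lambda>x. indicator \<Omega> x *\<^sub>R partial_deriv i ?F x)"
  proof (rule ext)
    fix x
    show "partial_deriv i ?F x = indicator \<Omega> x *\<^sub>R partial_deriv i ?F x"
      using partial_deriv_zero_outside_support[of x ?F i] K(2) KF by (cases "x \<in> \<Omega>") auto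
  qed
  also have "(LINT x|lebesgue. indicator \<Omega> x *\<^sub>R partial_deriv i ?F x)
      = (LINT x|lebesgue_on \<Omega>. partial_deriv i ?F x)"
    using meas by (simp add: integral_restrict_space)
  also have "\<dots> = (LINT x|lebesgue_on \<Omega>. \<phi> x * partial_deriv i \<eta> x + gradient \<phi> x $ i * \<eta> x)"
    by (simp add: partial_deriv_mult smooth_function_differentiable \<phi> sm\<eta> gradient_def)
  also have "\<dots> = (LINT x|lebesgue_on \<Omega>. \<phi> x * partial_deriv i \<eta> x)
      + (LINT x|lebesgue_on \<Omega>. gradient \<phi> x $ i * \<eta> x)"
    by (intro Bochner_Integration.integral_add integrable_mult_test_function[OF _ \<eta>] integrable_vec_nth int)
  finally show "(LINT x|lebesgue_on \<Omega>. \<phi> x * partial_deriv i \<eta> x)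
      = - (LINT x|lebesgue_on \<Omega>. gradient \<phi> x $ i * \<eta> x)" by simp
qed

section \<open>Uniqueness, linearity and limits of weak gradients\<close>

lemma has_weak_gradient_AE_unique:
  fixes \<Omega> :: "(real^'d) set"
  assumes "open \<Omega>" "has_weak_gradient \<Omega> v G" "has_weak_gradient \<Omega> v H"
  shows "AE x in lebesgue_on \<Omega>. G x = H x"
proof -
  have int: "integrable (lebesgue_on \<Omega>) (\<lambda>x. G x $ i)" "integrable (lebesgue_on \<Omega>) (\<lambda>x. H x $ i)" for i
    using assms by (auto simp: has_weak_gradient_def intro: integrable_vec_nth)
  have "AE x in lebesgue_on \<Omega>. G x $ i - H x $ i = 0" for i
  proof (rule AE_zero_if_test_integrals_zero[OF \<open>open \<Omega>\<close>])
    fix \<phi> assume \<phi>: "test_function \<Omega> \<phi>"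
    show "(LINT x|lebesgue_on \<Omega>. (G x $ i - H x $ i) * \<phi> x) = 0"
      using assms(2,3) \<phi> integrable_mult_test_function(1)[OF int(1)[of i] \<phi>]
        integrable_mult_test_function(1)[OF int(2)[of i] \<phi>]
      by (auto simp: has_weak_gradient_def left_diff_distrib)
  qed (use int in auto)
  then have "AE x in lebesgue_on \<Omega>. \<forall>i. G x $ i - H x $ i = 0"
    by (intro AE_all_countable[THEN iffD2]) auto
  then show ?thesis by eventually_elim (simp add: vec_eq_iff)
qed

lemma has_weak_gradient_weak_grad:
  "has_weak_gradient \<Omega> v G \<Longrightarrow> has_weak_gradient \<Omega> v (weak_grad \<Omega> v)"
  unfolding weak_grad_def by (rule someI[of "has_weak_gradient \<Omega> v"])

lemma W11_iff: "v \<in> W11 \<Omega> \<longleftrightarrow> has_weak_gradient \<Omega> v (weak_grad \<Omega> v)"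
  unfolding W11_def using has_weak_gradient_weak_grad by blast

text \<open>Makes the choice in \<open>weak_grad\<close> harmless: integrals and almost-everywhere
  statements may be computed with whichever weak gradient is at hand.\<close>

lemma weak_grad_AE_eq:
  "open \<Omega> \<Longrightarrow> has_weak_gradient \<Omega> v G \<Longrightarrow> AE x in lebesgue_on \<Omega>. weak_grad \<Omega> v x = G x"
  by (rule has_weak_gradient_AE_unique[OF _ has_weak_gradient_weak_grad])

lemma W11_norm_eq:
  assumes "open \<Omega>" "has_weak_gradient \<Omega> v G"
  shows "W11_norm \<Omega> v = (LINT x|lebesgue_on \<Omega>. \<bar>v x\<bar>) + (LINT x|lebesgue_on \<Omega>. norm (G x))"
proof -
  have "(LINT x|lebesgue_on \<Omega>. norm (weak_grad \<Omega> v x)) = (LINT x|lebesgue_on \<Omega>. norm (G x))"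
    using weak_grad_AE_eq[OF assms] assms(2) has_weak_gradient_weak_grad[OF assms(2)]
    by (intro integral_cong_AE) (auto simp: has_weak_gradient_def)
  then show ?thesis by (simp add: W11_norm_def)
qed

lemma W11_norm_nonneg: "0 \<le> W11_norm \<Omega> v"
  by (simp add: W11_norm_def)

lemma has_weak_gradient_linear:
  assumes v: "has_weak_gradient \<Omega> v G" and w: "has_weak_gradient \<Omega> w H"
  shows "has_weak_gradient \<Omega> (\<lambda>x. a * v x + b * w x) (\<lambda>x. a *\<^sub>R G x + b *\<^sub>R H x)"
  unfolding has_weak_gradient_def
proof (intro conjI allI impI)
  have int: "integrable (lebesgue_on \<Omega>) v" "integrable (lebesgue_on \<Omega>) w"
    "integrable (lebesgue_on \<Omega>) G" "integrable (lebesgue_on \<Omega>) H"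
    using v w by (auto simp: has_weak_gradient_def)
  show "integrable (lebesgue_on \<Omega>) (\<lambda>x. a * v x + b * w x)"
    "integrable (lebesgue_on \<Omega>) (\<lambda>x. a *\<^sub>R G x + b *\<^sub>R H x)"
    using int by auto
  fix \<phi> i assume \<phi>: "test_function \<Omega> \<phi>"
  note I = integrable_mult_test_function(2)[OF int(1) \<phi>, of i] integrable_mult_test_function(2)[OF int(2) \<phi>, of i]
    integrable_mult_test_function(1)[OF integrable_vec_nth[OF int(3)] \<phi>, of i]
    integrable_mult_test_function(1)[OF integrable_vec_nth[OF int(4)] \<phi>, of i]
  have "(LINT x|lebesgue_on \<Omega>. (a * v x + b * w x) * partial_deriv i \<phi> x)
      = a * (LINT x|lebesgue_on \<Omega>. v x * partial_deriv i \<phi> x) + b * (LINT x|lebesgue_on \<Omega>. w x * partial_deriv i \<phi> x)"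
    using I by (simp add: distrib_right mult.assoc)
  moreover have "(LINT x|lebesgue_on \<Omega>. (a *\<^sub>R G x + b *\<^sub>R H x) $ i * \<phi> x)
      = a * (LINT x|lebesgue_on \<Omega>. G x $ i * \<phi> x) + b * (LINT x|lebesgue_on \<Omega>. H x $ i * \<phi> x)"
    using I by (simp add: distrib_right mult.assoc)
  ultimately show "(LINT x|lebesgue_on \<Omega>. (a * v x + b * w x) * partial_deriv i \<phi> x)
      = - (LINT x|lebesgue_on \<Omega>. (a *\<^sub>R G x + b *\<^sub>R H x) $ i * \<phi> x)"
    using v w \<phi> by (simp add: has_weak_gradient_def)
qed

lemma tendsto_integral_mult_bounded:
  fixes v :: "nat \<Rightarrow> 'a \<Rightarrow> real"
  assumes int: "\<And>n. integrable M (v n)" "integrable M u"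
    and g: "g \<in> borel_measurable M" "\<And>x. \<bar>g x\<bar> \<le> B"
    and lim: "(\<lambda>n. LINT x|M. \<bar>v n x - u x\<bar>) \<longlonglongrightarrow> 0"
  shows "(\<lambda>n. LINT x|M. v n x * g x) \<longlonglongrightarrow> (LINT x|M. u x * g x)"
proof (rule LIM_zero_cancel, rule Lim_null_comparison)
  have I: "integrable M (\<lambda>x. v n x * g x)" "integrable M (\<lambda>x. u x * g x)" for n
    using integrable_mult_bounded[OF int(1) g] integrable_mult_bounded[OF int(2) g] by auto
  show "\<forall>\<^sub>F n in sequentially. norm ((LINT x|M. v n x * g x) - (LINT x|M. u x * g x))
      \<le> B * (LINT x|M. \<bar>v n x - u x\<bar>)"
  proof (rule always_eventually, rule allI)
    fix n
    have "(LINT x|M. v n x * g x) - (LINT x|M. u x * g x) = (LINT x|M. (v n x - u x) * g x)"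
      using I by (simp add: left_diff_distrib)
    also have "norm \<dots> \<le> (LINT x|M. norm ((v n x - u x) * g x))" by (rule integral_norm_bound)
    also have "\<dots> \<le> (LINT x|M. B * \<bar>v n x - u x\<bar>)"
    proof (rule integral_mono)
      show "integrable M (\<lambda>x. norm ((v n x - u x) * g x))"
        using I by (intro integrable_norm) (simp add: left_diff_distrib)
      show "norm ((v n x - u x) * g x) \<le> B * \<bar>v n x - u x\<bar>" for x
        using g(2)[of x] by (simp add: abs_mult mult.commute mult_right_mono)
    qed (use int in auto)
    finally show "norm ((LINT x|M. v n x * g x) - (LINT x|M. u x * g x)) \<le> B * (LINT x|M. \<bar>v n x - u x\<bar>)"
      by simp
  qed
  show "(\<lambda>n. B * (LINT x|M. \<bar>v n x - u x\<bar>)) \<longlonglongrightarrow> 0"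
    using tendsto_mult[OF tendsto_const lim, of B] by simp
qed

text \<open>Both sides of the defining identity are integrals against bounded functions, a test
  function and its partial derivative, and hence are continuous in L1.\<close>

lemma has_weak_gradient_limit:
  fixes v :: "nat \<Rightarrow> real^'d \<Rightarrow> real"
  assumes vG: "\<And>n. has_weak_gradient \<Omega> (v n) (G n)"
    and int: "integrable (lebesgue_on \<Omega>) u" "integrable (lebesgue_on \<Omega>) H"
    and limv: "(\<lambda>n. LINT x|lebesgue_on \<Omega>. \<bar>v n x - u x\<bar>) \<longlonglongrightarrow> 0"
    and limG: "(\<lambda>n. LINT x|lebesgue_on \<Omega>. norm (G n x - H x)) \<longlonglongrightarrow> 0"
  shows "has_weak_gradient \<Omega> u H"
  unfolding has_weak_gradient_def
proof (intro conjI allI impI)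
  fix \<phi> i assume \<phi>: "test_function \<Omega> \<phi>"
  have intv: "integrable (lebesgue_on \<Omega>) (v n)" "integrable (lebesgue_on \<Omega>) (G n)" for n
    using vG by (auto simp: has_weak_gradient_def)
  obtain B where B: "\<And>x. \<bar>\<phi> x\<bar> \<le> B" "\<And>x. \<bar>partial_deriv i \<phi> x\<bar> \<le> B"
    using test_functionD(2)[OF \<phi>] by blast
  have meas: "\<phi> \<in> borel_measurable (lebesgue_on \<Omega>)" "partial_deriv i \<phi> \<in> borel_measurable (lebesgue_on \<Omega>)"
    using test_functionD(1)[OF \<phi>] by (auto intro!: borel_measurable_lebesgue_on_continuous
      smooth_function_continuous smooth_function_partial_continuous)
  have "(\<lambda>n. LINT x|lebesgue_on \<Omega>. v n x * partial_deriv i \<phi> x)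
      \<longlonglongrightarrow> (LINT x|lebesgue_on \<Omega>. u x * partial_deriv i \<phi> x)"
    by (rule tendsto_integral_mult_bounded[OF intv(1) int(1) meas(2) B(2) limv])
  moreover have "(\<lambda>n. LINT x|lebesgue_on \<Omega>. \<bar>G n x $ i - H x $ i\<bar>) \<longlonglongrightarrow> 0"
  proof (rule tendsto_sandwich[OF _ _ tendsto_const limG])
    show "\<forall>\<^sub>F n in sequentially. (LINT x|lebesgue_on \<Omega>. \<bar>G n x $ i - H x $ i\<bar>)
        \<le> (LINT x|lebesgue_on \<Omega>. norm (G n x - H x))"
      using intv(2) int(2)
      by (intro always_eventually allI integral_mono)
         (auto intro!: integrable_vec_nth integrable_abs Bochner_Integration.integrable_diff
            simp: vector_minus_component[symmetric] component_le_norm_cart simp del: vector_minus_component)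
  qed auto
  then have "(\<lambda>n. - (LINT x|lebesgue_on \<Omega>. G n x $ i * \<phi> x)) \<longlonglongrightarrow> - (LINT x|lebesgue_on \<Omega>. H x $ i * \<phi> x)"
    by (intro tendsto_minus tendsto_integral_mult_bounded[OF _ _ meas(1) B(1)]
        integrable_vec_nth intv int)
  ultimately show "(LINT x|lebesgue_on \<Omega>. u x * partial_deriv i \<phi> x) = - (LINT x|lebesgue_on \<Omega>. H x $ i * \<phi> x)"
    using vG \<phi> by (auto simp: has_weak_gradient_def intro: LIMSEQ_unique)
qed (rule int)+

section \<open>Convergence in \<open>L\<^sup>1\<close> and the \<open>\<ell>\<^sup>p\<close> norm\<close>

text \<open>The pointwise sum has a finite integral, so it is finite almost everywhere. Besides
  completeness of L1 this serves the boundary values, where summable errors have to vanish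
  pointwise.\<close>

lemma AE_summable_norm:
  fixes h :: "nat \<Rightarrow> 'a \<Rightarrow> 'b::{banach, second_countable_topology}"
  assumes int: "\<And>n. integrable M (h n)" and "summable (\<lambda>n. LINT x|M. norm (h n x))"
  shows "AE x in M. summable (\<lambda>n. norm (h n x))"
proof -
  have [measurable]: "h n \<in> borel_measurable M" for n using int by auto
  have "(\<integral>\<^sup>+x. (\<Sum>n. ennreal (norm (h n x))) \<partial>M) = (\<Sum>n. \<integral>\<^sup>+x. ennreal (norm (h n x)) \<partial>M)"
    by (rule nn_integral_suminf) simp
  also have "(\<lambda>n. \<integral>\<^sup>+x. ennreal (norm (h n x)) \<partial>M) = (\<lambda>n. ennreal (LINT x|M. norm (h n x)))"
    by (rule ext, rule nn_integral_eq_integral[OF integrable_norm[OF int] AE_I2[OF norm_ge_zero]])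
  also have "(\<Sum>n. ennreal (LINT x|M. norm (h n x))) \<noteq> \<infinity>"
    unfolding infinity_ennreal_def
    by (rule ennreal_suminf_neq_top[OF assms(2) Bochner_Integration.integral_nonneg[OF norm_ge_zero]])
  finally have "AE x in M. (\<Sum>n. ennreal (norm (h n x))) \<noteq> \<infinity>"
    by (intro nn_integral_PInf_AE) simp_all
  then show ?thesis
    by eventually_elim (rule summable_suminf_not_top, simp_all)
qed

text \<open>The telescoped form of the Riesz-Fischer argument. Summable increments make the sequence
  itself converge almost everywhere, not just a subsequence.\<close>

lemma L1_fast_Cauchy_converges:
  fixes f :: "nat \<Rightarrow> 'a \<Rightarrow> 'b::{banach, second_countable_topology}"
  assumes int: "\<And>n. integrable M (f n)"
    and fast: "summable (\<lambda>n. LINT x|M. norm (f (Suc n) x - f n x))"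
  obtains g where "integrable M g" "AE x in M. (\<lambda>n. f n x) \<longlonglongrightarrow> g x"
    "(\<lambda>n. LINT x|M. norm (f n x - g x)) \<longlonglongrightarrow> 0"
proof -
  define d where "d n x = f (Suc n) x - f n x" for n x
  have intd: "integrable M (d n)" for n unfolding d_def using int by auto
  have sumd: "summable (\<lambda>n. LINT x|M. norm (d n x))" using fast by (simp add: d_def)
  have AEs: "AE x in M. summable (\<lambda>n. norm (d n x))" by (rule AE_summable_norm[OF intd sumd])
  define g where "g x = f 0 x + (\<Sum>n. d n x)" for x
  \<comment> \<open>The difference between f n and its limit is a tail of the telescoping series, so
    W dominates it for every n and yields the L1 limit.\<close>
  define W where "W x = (\<Sum>n. norm (d n x))" for x
  have intW: "integrable M W"
    unfolding W_def
    by (rule integrable_suminf[OF integrable_norm[OF intd]]) (use AEs sumd in simp_all)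
  have intg: "integrable M g"
    unfolding g_def by (rule Bochner_Integration.integrable_add[OF int integrable_suminf[OF intd AEs sumd]])
  have f_eq: "f n x = f 0 x + (\<Sum>k<n. d k x)" for n x
  proof -
    have "(\<Sum>k<n. d k x) = f n x - f 0 x" unfolding d_def by (rule sum_lessThan_telescope)
    then show ?thesis by simp
  qed
  have lim: "AE x in M. (\<lambda>n. f n x) \<longlonglongrightarrow> g x"
    using AEs
  proof eventually_elim
    case (elim x)
    then have "(\<lambda>n. f 0 x + (\<Sum>k<n. d k x)) \<longlonglongrightarrow> g x"
      unfolding g_def by (intro tendsto_add tendsto_const summable_LIMSEQ) (rule summable_norm_cancel)
    then show ?case by (simp add: f_eq[symmetric])
  qed
  have bound: "AE x in M. norm (norm (f n x - g x)) \<le> W x" for n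
    using AEs
  proof eventually_elim
    case (elim x)
    then have s: "summable (\<lambda>n. d n x)" by (rule summable_norm_cancel)
    have sn: "summable (\<lambda>k. norm (d (k + n) x))" using elim by (rule summable_ignore_initial_segment)
    have "norm (f n x - g x) = norm (\<Sum>k. d (k + n) x)"
      unfolding suminf_minus_initial_segment[OF s] by (simp add: f_eq[of n] g_def norm_minus_commute)
    also have "\<dots> \<le> (\<Sum>k. norm (d (k + n) x))" by (rule summable_norm[OF sn])
    also have "\<dots> \<le> W x"
      unfolding suminf_minus_initial_segment[OF elim] W_def by (simp add: sum_nonneg)
    finally show ?case by simp
  qed
  have "(\<lambda>n. LINT x|M. norm (f n x - g x)) \<longlonglongrightarrow> (LINT x|M. 0)"
  proof (rule integral_dominated_convergence[where w=W])
    show "AE x in M. (\<lambda>n. norm (f n x - g x)) \<longlonglongrightarrow> 0"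
      using lim by eventually_elim (rule tendsto_norm_zero[OF LIM_zero])
    show "(\<lambda>x. norm (f n x - g x)) \<in> borel_measurable M" for n
      by (intro borel_measurable_integrable integrable_norm Bochner_Integration.integrable_diff int intg)
  qed (use intW bound in simp_all)
  then show ?thesis using that intg lim by simp
qed

section \<open>The l^p norms: comparison, convexity and closedness of balls\<close>

lemma abs_component_le_lp_norm:
  assumes "1 \<le> p"
  shows "\<bar>z $ i\<bar> \<le> lp_norm p z"
proof (cases "p = \<infinity>")
  case True
  then show ?thesis by (auto simp: lp_norm_def intro!: Max_ge)
next
  case False
  with assms obtain r where r: "p = ereal r" "1 \<le> r" by (cases p) auto
  have "\<bar>z $ i\<bar> = (\<bar>z $ i\<bar> powr r) powr (1 / r)" using r unfolding powr_powr by simp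
  also have "\<dots> \<le> (\<Sum>i\<in>UNIV. \<bar>z $ i\<bar> powr r) powr (1 / r)"
    using r by (intro powr_mono2) (auto intro!: member_le_sum)
  finally show ?thesis using r by (simp add: lp_norm_def)
qed

text \<open>The crude factor d serves every p at once. It is used to dominate the Euclidean length
  of a gradient by a multiple of \<alpha>, where the size of the multiple is immaterial.\<close>

lemma norm_le_lp_norm:
  fixes z :: "real^'d"
  assumes "1 \<le> p"
  shows "norm z \<le> real CARD('d) * lp_norm p z"
proof -
  have "norm z \<le> (\<Sum>i\<in>UNIV. \<bar>z $ i\<bar>)" by (rule norm_le_l1_cart)
  also have "\<dots> \<le> (\<Sum>i\<in>(UNIV::'d set). lp_norm p z)" by (intro sum_mono abs_component_le_lp_norm assms)
  finally show ?thesis by simp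
qed

lemma lp_norm_nonneg: "1 \<le> p \<Longrightarrow> 0 \<le> lp_norm p z"
  using abs_component_le_lp_norm[of p z] abs_ge_zero order_trans by blast

lemma lp_norm_le_iff_infinite: "lp_norm \<infinity> z \<le> a \<longleftrightarrow> (\<forall>i. \<bar>z $ i\<bar> \<le> a)"
  by (auto simp: lp_norm_def Max_le_iff)

text \<open>Without the outer root the ball is described by a sum of functions of single
  coordinates, so that midpoints and limits can be treated term by term.\<close>

lemma lp_norm_le_iff_finite:
  assumes "1 \<le> r" "0 \<le> a"
  shows "lp_norm (ereal r) z \<le> a \<longleftrightarrow> (\<Sum>i\<in>UNIV. \<bar>z $ i\<bar> powr r) \<le> a powr r"
proof -
  let ?s = "\<Sum>i\<in>UNIV. \<bar>z $ i\<bar> powr r"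
  have s: "0 \<le> ?s" by (intro sum_nonneg) simp
  have "(?s powr (1 / r)) powr r = ?s" "(a powr r) powr (1 / r) = a" using assms s by (auto simp: powr_powr)
  then have "?s powr (1 / r) \<le> a \<longleftrightarrow> ?s \<le> a powr r"
    using assms s powr_mono2[of r "?s powr (1 / r)" a] powr_mono2[of "1 / r" ?s "a powr r"] by auto
  then show ?thesis by (simp add: lp_norm_def)
qed

lemma powr_midpoint_le:
  fixes s t r :: real
  assumes "1 \<le> r" "0 \<le> s" "0 \<le> t"
  shows "((s + t) / 2) powr r \<le> (s powr r + t powr r) / 2"
proof -
  \<comment> \<open>If one endpoint is 0 the inequality is pure scaling: (1/2)^r \<le> 1/2 because r
    is at least 1.\<close>
  have half: "(x / 2) powr r \<le> x powr r / 2" if "0 \<le> x" for x :: real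
  proof -
    have "(x / 2) powr r = x powr r * (1 / 2) powr r" using that by (simp add: powr_divide)
    also have "(1 / 2 :: real) powr r \<le> (1 / 2) powr 1" using assms by (intro powr_mono') auto
    finally show ?thesis by (simp add: mult_left_mono)
  qed
  consider "s = 0" | "t = 0" | "s > 0" "t > 0" using assms by linarith
  then show ?thesis
  proof cases
    case 3
    have "((1 - 1/2) *\<^sub>R s + (1/2) *\<^sub>R t) powr r \<le> (1 - 1/2) * s powr r + (1/2) * t powr r"
      by (rule convex_onD[OF powr_convex[OF assms(1)]]) (use 3 in auto)
    then show ?thesis by (simp add: add_divide_distrib)
  qed (use half assms in auto)
qed

lemma lp_norm_midpoint_le:
  assumes p: "1 \<le> p" and zw: "lp_norm p z \<le> a" "lp_norm p w \<le> a"
  shows "lp_norm p ((1/2) *\<^sub>R z + (1/2) *\<^sub>R w) \<le> a"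
proof (cases "p = \<infinity>")
  case True
  have "\<bar>(1/2) * z $ i + (1/2) * w $ i\<bar> \<le> a" if "\<bar>z $ i\<bar> \<le> a" "\<bar>w $ i\<bar> \<le> a" for i
    using that by linarith
  then show ?thesis using zw by (simp add: True lp_norm_le_iff_infinite)
next
  case False
  with p obtain r where r: "p = ereal r" "1 \<le> r" by (cases p) auto
  have a: "0 \<le> a" using lp_norm_nonneg[OF p] zw order_trans by blast
  have "\<bar>(1/2) * s + (1/2) * t\<bar> powr r \<le> (1/2) * \<bar>s\<bar> powr r + (1/2) * \<bar>t\<bar> powr r" for s t :: real
  proof -
    have "\<bar>(1/2) * s + (1/2) * t\<bar> powr r \<le> ((\<bar>s\<bar> + \<bar>t\<bar>) / 2) powr r"
      using r abs_triangle_ineq[of "(1/2) * s" "(1/2) * t"]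
      by (intro powr_mono2) (simp_all add: abs_mult)
    also have "\<dots> \<le> (\<bar>s\<bar> powr r + \<bar>t\<bar> powr r) / 2"
      by (rule powr_midpoint_le) (use r in auto)
    finally show ?thesis by simp
  qed
  then have "(\<Sum>i\<in>UNIV. \<bar>((1/2) *\<^sub>R z + (1/2) *\<^sub>R w) $ i\<bar> powr r)
      \<le> (\<Sum>i\<in>UNIV. (1/2) * \<bar>z $ i\<bar> powr r + (1/2) * \<bar>w $ i\<bar> powr r)"
    by (intro sum_mono) simp
  also have "\<dots> = (1/2) * (\<Sum>i\<in>UNIV. \<bar>z $ i\<bar> powr r) + (1/2) * (\<Sum>i\<in>UNIV. \<bar>w $ i\<bar> powr r)"
    by (simp add: sum.distrib sum_divide_distrib)
  also have "\<dots> \<le> a powr r"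
    using zw a r by (simp add: lp_norm_le_iff_finite)
  finally show ?thesis using a r by (simp add: lp_norm_le_iff_finite)
qed

lemma lp_norm_le_limit:
  assumes p: "1 \<le> p" and lim: "z \<longlonglongrightarrow> w" and le: "\<And>n. lp_norm p (z n) \<le> a"
  shows "lp_norm p w \<le> a"
proof (cases "p = \<infinity>")
  case True
  have "\<bar>w $ i\<bar> \<le> a" for i
    by (rule Lim_bounded[of "\<lambda>n. \<bar>z n $ i\<bar>"])
       (use lim le in \<open>auto intro!: tendsto_intros simp: True lp_norm_le_iff_infinite\<close>)
  then show ?thesis by (simp add: True lp_norm_le_iff_infinite)
next
  case False
  with p obtain r where r: "p = ereal r" "1 \<le> r" by (cases p) auto
  have a: "0 \<le> a" using lp_norm_nonneg[OF p] le order_trans by blast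
  have "(\<lambda>n. \<Sum>i\<in>UNIV. \<bar>z n $ i\<bar> powr r) \<longlonglongrightarrow> (\<Sum>i\<in>UNIV. \<bar>w $ i\<bar> powr r)"
    using r by (intro tendsto_sum tendsto_powr' tendsto_rabs tendsto_vec_nth lim tendsto_const) auto
  then have "(\<Sum>i\<in>UNIV. \<bar>w $ i\<bar> powr r) \<le> a powr r"
    by (rule Lim_bounded) (use le a r in \<open>auto simp: lp_norm_le_iff_finite\<close>)
  then show ?thesis using a r by (simp add: lp_norm_le_iff_finite)
qed

section \<open>Hausdorff measure of Lipschitz graphs\<close>

definition hyper_proj :: "real^'d \<Rightarrow> real^'d \<Rightarrow> real^'d" where
  "hyper_proj e y = y - (y \<bullet> e) *\<^sub>R e"

lemma hyper_proj_diff: "hyper_proj e (x - y) = hyper_proj e x - hyper_proj e y"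
  by (simp add: hyper_proj_def inner_diff_left algebra_simps)

lemma hyper_proj_add_axis:
  assumes "norm e = 1"
  shows "hyper_proj e (x + t *\<^sub>R e) = hyper_proj e x"
  using assms by (simp add: hyper_proj_def inner_add_left algebra_simps norm_eq_1)

lemma hyper_proj_idem:
  assumes "norm e = 1"
  shows "hyper_proj e (hyper_proj e x) = hyper_proj e x"
  using hyper_proj_add_axis[OF assms, of x "- (x \<bullet> e)"] by (simp add: hyper_proj_def)

lemma inner_hyper_proj: "norm e = 1 \<Longrightarrow> hyper_proj e x \<bullet> e = 0"
  by (simp add: hyper_proj_def inner_diff_left norm_eq_1)

lemma norm_hyper_proj_le:
  assumes "norm e = 1"
  shows "norm (hyper_proj e x) \<le> norm x"
proof -
  have "(norm (hyper_proj e x))\<^sup>2 = (norm x)\<^sup>2 - (x \<bullet> e)\<^sup>2"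
    unfolding power2_norm_eq_inner using assms
    by (simp add: hyper_proj_def inner_diff_left inner_diff_right norm_eq_1 inner_commute[of e x] power2_eq_square)
  then show ?thesis by (intro power2_le_imp_le[OF _ norm_ge_zero]) simp
qed

text \<open>The cover is padded with empty sets to a sequence. They cost nothing thanks to their
  explicit weight 0, which matters when s = 0.\<close>

lemma hausdorff_premeasure_finite_cover:
  assumes "finite F" "A \<subseteq> (\<Union>x\<in>F. D x)" "\<And>x. x \<in> F \<Longrightarrow> bounded (D x) \<and> diameter (D x) \<le> \<delta>" "0 \<le> \<delta>"
  shows "hausdorff_premeasure s \<delta> A \<le> ennreal (real (card F) * (unit_ball_vol (real s) * (\<delta> / 2) ^ s))"
proof -
  obtain b where b: "bij_betw b {0..<card F} F" using ex_bij_betw_nat_finite[OF assms(1)] by blast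
  define E where "E i = (if i < card F then D (b i) else {})" for i
  have bF: "b i \<in> F" if "i < card F" for i using b that by (auto simp: bij_betw_def)
  have cover: "A \<subseteq> (\<Union>i. E i)"
  proof
    fix x assume "x \<in> A"
    then obtain y where y: "y \<in> F" "x \<in> D y" using assms(2) by blast
    then have "y \<in> b ` {0..<card F}" using b by (simp add: bij_betw_def)
    then obtain i where "i < card F" "b i = y" by auto
    with y show "x \<in> (\<Union>i. E i)" by (auto simp: E_def)
  qed
  have "E \<in> {E. A \<subseteq> (\<Union>i. E i) \<and> (\<forall>i. bounded (E i) \<and> diameter (E i) \<le> \<delta>)}"
    using cover assms(3)[OF bF] assms(4) by (auto simp: E_def)
  then have "hausdorff_premeasure s \<delta> A
      \<le> (\<Sum>i. if E i = {} then 0 else ennreal (unit_ball_vol (real s) * (diameter (E i) / 2) ^ s))"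
    unfolding hausdorff_premeasure_def by (rule INF_lower)
  also have "\<dots> = (\<Sum>i<card F. if E i = {} then 0 else ennreal (unit_ball_vol (real s) * (diameter (E i) / 2) ^ s))"
    by (rule suminf_finite) (auto simp: E_def)
  also have "\<dots> \<le> (\<Sum>i<card F. ennreal (unit_ball_vol (real s) * (\<delta> / 2) ^ s))"
  proof (rule sum_mono)
    fix i assume "i \<in> {..<card F}"
    then have "bounded (E i)" "diameter (E i) \<le> \<delta>" using assms(3)[OF bF] by (auto simp: E_def)
    then have "(diameter (E i) / 2) ^ s \<le> (\<delta> / 2) ^ s"
      by (intro power_mono) (auto simp: diameter_ge_0)
    then show "(if E i = {} then 0 else ennreal (unit_ball_vol (real s) * (diameter (E i) / 2) ^ s))
        \<le> ennreal (unit_ball_vol (real s) * (\<delta> / 2) ^ s)"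
      by (auto intro!: ennreal_leI mult_left_mono)
  qed
  also have "\<dots> = ennreal (real (card F) * (unit_ball_vol (real s) * (\<delta> / 2) ^ s))"
    using assms(4) by (subst ennreal_mult[of "real (card F)"]) (auto simp flip: ennreal_of_nat_eq_real_of_nat)
  finally show ?thesis .
qed

text \<open>Stacking \<open>m\<close> copies of each ball in the direction \<open>e\<close> turns the packing of the
  \<open>(d - 1)\<close>-dimensional disc into a packing of a \<open>d\<close>-dimensional ball, so that only
  \<open>d\<close>-dimensional volumes are compared.\<close>

lemma separated_card_bound:
  fixes F :: "(real^'d) set"
  assumes e: "norm e = 1" and m: "0 < (m::nat)" and \<rho>: "0 < \<rho>" and fin: "finite F"
    and near: "\<And>x. x \<in> F \<Longrightarrow> norm (hyper_proj e x - z) \<le> \<rho>"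
    and sep: "\<And>x y. x \<in> F \<Longrightarrow> y \<in> F \<Longrightarrow> x \<noteq> y \<Longrightarrow> \<rho> / m \<le> norm (hyper_proj e x - hyper_proj e y)"
  shows "real (card F) \<le> 6 ^ CARD('d) * real m ^ (CARD('d) - 1)"
proof -
  let ?\<delta> = "\<rho> / m"
  let ?d = "CARD('d)"
  \<comment> \<open>The vertical spacing equals the separation of the projections, so any two of the
    centres are at least this far apart, whether they share a column or not.\<close>
  define c where "c = (\<lambda>(x, k). hyper_proj e x + (real k * ?\<delta>) *\<^sub>R e)"
  let ?I = "F \<times> {..<m}"
  let ?V = "unit_ball_vol (real ?d)"
  have \<delta>: "0 < ?\<delta>" using m \<rho> by simp
  have V: "0 < ?V" by simp
  have far: "?\<delta> \<le> dist (c p) (c q)" if "p \<in> ?I" "q \<in> ?I" "p \<noteq> q" for p q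
  proof -
    obtain x k y l where p: "p = (x, k)" "q = (y, l)" by (metis surj_pair)
    show ?thesis
    proof (cases "x = y")
      case True
      with that p have "k \<noteq> l" by auto
      then have "1 \<le> \<bar>real k - real l\<bar>" by linarith
      then have "1 * ?\<delta> \<le> \<bar>real k - real l\<bar> * ?\<delta>" using \<delta> by (intro mult_right_mono) auto
      moreover have "dist (c p) (c q) = \<bar>real k - real l\<bar> * ?\<delta>"
        using e \<delta> p True \<rho>
        by (simp add: c_def dist_norm scaleR_left_diff_distrib[symmetric] left_diff_distrib[symmetric]
            diff_divide_distrib[symmetric] abs_mult)
      ultimately show ?thesis by simp
    next
      case False
      have "?\<delta> \<le> norm (hyper_proj e x - hyper_proj e y)" using sep that p False by auto
      also have "\<dots> = norm (hyper_proj e (c p - c q))"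
        using p by (simp add: hyper_proj_diff c_def hyper_proj_add_axis[OF e] hyper_proj_idem[OF e])
      also have "\<dots> \<le> dist (c p) (c q)" unfolding dist_norm by (rule norm_hyper_proj_le[OF e])
      finally show ?thesis .
    qed
  qed
  have inj: "inj_on c ?I"
  proof (rule inj_onI, rule ccontr)
    fix p q assume "p \<in> ?I" "q \<in> ?I" "c p = c q" "p \<noteq> q"
    with far[of p q] \<delta> show False by simp
  qed
  have disj: "disjoint_family_on (\<lambda>p. ball (c p) (?\<delta> / 2)) ?I"
    unfolding disjoint_family_on_def
  proof (intro ballI impI)
    fix p q assume "p \<in> ?I" "q \<in> ?I" "p \<noteq> q"
    then show "ball (c p) (?\<delta> / 2) \<inter> ball (c q) (?\<delta> / 2) = {}"
      using far[of p q] by (intro disjoint_ballI) simp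
  qed
  \<comment> \<open>The m layers of spacing \<rho>/m reach a height of at most \<rho>, so the
    centres lie within 2 \<rho> of z and the small balls within 3 \<rho>.\<close>
  have sub: "(\<Union>p\<in>?I. ball (c p) (?\<delta> / 2)) \<subseteq> ball z (3 * \<rho>)"
  proof (rule UN_least)
    fix p assume "p \<in> ?I"
    then obtain x k where p: "p = (x, k)" "x \<in> F" "k < m" by auto
    have "?\<delta> \<le> \<rho>" using m \<rho> by (simp add: field_simps)
    have "real k * ?\<delta> \<le> real m * ?\<delta>" using p \<delta> by (intro mult_right_mono) auto
    then have k: "real k * ?\<delta> \<le> \<rho>" using m by simp
    have "dist z (c p) \<le> norm (hyper_proj e x - z) + norm ((real k * ?\<delta>) *\<^sub>R e)"
      using norm_triangle_ineq[of "hyper_proj e x - z" "(real k * ?\<delta>) *\<^sub>R e"]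
      by (simp add: p c_def dist_norm norm_minus_commute algebra_simps)
    also have "\<dots> \<le> \<rho> + \<rho>" using near[OF p(2)] k e \<rho> by simp
    finally have "dist z (c p) \<le> 2 * \<rho>" by simp
    then show "ball (c p) (?\<delta> / 2) \<subseteq> ball z (3 * \<rho>)"
      using \<open>?\<delta> \<le> \<rho>\<close> \<rho> by (intro ball_subset_ball_iff[THEN iffD2] disjI1) (simp add: dist_commute)
  qed
  have "(\<Sum>p\<in>?I. measure lborel (ball (c p) (?\<delta> / 2))) = measure lborel (\<Union>p\<in>?I. ball (c p) (?\<delta> / 2))"
    by (intro measure_finite_Union[symmetric])
       (use fin disj less_imp_neq[OF emeasure_bounded_finite[OF bounded_ball]] in auto)
  also have "\<dots> \<le> measure lborel (ball z (3 * \<rho>))"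
    using sub fin emeasure_bounded_finite[OF bounded_ball]
    by (intro measure_mono_fmeasurable) (auto simp: fmeasurable_def intro!: borel_open)
  finally have "real (card F * m) * (?V * (?\<delta> / 2) ^ ?d) \<le> ?V * (3 * \<rho>) ^ ?d"
    using \<delta> \<rho> by (simp add: content_ball card_cartesian_product)
  also have "real (card F * m) * (?V * (?\<delta> / 2) ^ ?d) = ?V * (real (card F) * real m * (?\<delta> / 2) ^ ?d)"
    by (simp only: of_nat_mult mult_ac)
  finally have "real (card F) * real m * (?\<delta> / 2) ^ ?d \<le> (3 * \<rho>) ^ ?d"
    by (rule mult_left_le_imp_le[OF _ V])
  \<comment> \<open>The radii compare as 6 m to 1, so the volumes compare as (6 m)^d to 1; dividing
    by the m layers leaves the exponent d - 1 on m.\<close>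
  also have "3 * \<rho> = (6 * real m) * (?\<delta> / 2)"
    using m by simp
  finally have "real (card F) * real m * (?\<delta> / 2) ^ ?d \<le> (6 * real m) ^ ?d * (?\<delta> / 2) ^ ?d"
    unfolding power_mult_distrib .
  then have "real (card F) * real m \<le> (6 * real m) ^ ?d"
    by (rule mult_right_le_imp_le) (use \<delta> in simp)
  also have "\<dots> = 6 ^ ?d * real m ^ (?d - 1) * real m"
  proof -
    have "?d = Suc (?d - 1)" using zero_less_card_finite[where 'a='d] by simp
    then have "real m ^ ?d = real m ^ (?d - 1) * real m" by (metis power_Suc2)
    then show ?thesis by (simp only: power_mult_distrib mult.assoc)
  qed
  finally show ?thesis by (rule mult_right_le_imp_le) (use m in simp)
qed

text \<open>A maximal family of points whose projections are \<rho>/m apart yields a cover by at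
  most 6^d m^(d-1) pieces of diameter at most 2 (1 + L) \<rho>/m. In the product the powers of m
  cancel, so the bound is the same however fine the cover is.\<close>

lemma hausdorff_outer_graph_le:
  fixes A :: "(real^'d) set"
  assumes e: "norm e = 1" and L: "0 \<le> L" and \<rho>: "0 < \<rho>"
    and lip: "\<And>x y. x \<in> A \<Longrightarrow> y \<in> A \<Longrightarrow> norm (x - y) \<le> (1 + L) * norm (hyper_proj e x - hyper_proj e y)"
    and near: "\<And>x. x \<in> A \<Longrightarrow> norm (hyper_proj e x - z) \<le> \<rho>"
  shows "hausdorff_outer (CARD('d) - 1) A
    \<le> ennreal (6 ^ CARD('d) * unit_ball_vol (real (CARD('d) - 1)) * ((1 + L) * \<rho>) ^ (CARD('d) - 1))"
  unfolding hausdorff_outer_def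
proof (rule SUP_least)
  fix \<delta>0 :: real assume "\<delta>0 \<in> {0<..}"
  then have \<delta>0: "0 < \<delta>0" by simp
  let ?s = "CARD('d) - 1"
  let ?V = "unit_ball_vol (real ?s)"
  \<comment> \<open>Pieces of projected radius \<rho>/m have diameter at most 2 (1 + L) \<rho>/m on
    the graph; m is taken large enough to make them admissible for \<open>\<delta>0\<close>.\<close>
  obtain m :: nat where m: "2 * (1 + L) * \<rho> / \<delta>0 < m" using reals_Archimedean2 by blast
  have "0 \<le> 2 * (1 + L) * \<rho> / \<delta>0" using L \<rho> \<delta>0 by simp
  with m have m0: "0 < m" by (metis le_less_trans of_nat_0_less_iff)
  let ?\<delta> = "2 * (1 + L) * \<rho> / m"
  have "0 < 2 * (1 + L) * \<rho>" using \<rho> L by (intro mult_pos_pos) auto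
  then have \<delta>: "0 < ?\<delta>" using m0 by simp
  have \<delta>_le: "?\<delta> \<le> \<delta>0" using m m0 \<delta>0 by (simp add: field_simps)
  define sep where "sep F \<longleftrightarrow> finite F \<and> F \<subseteq> A \<and>
    (\<forall>x\<in>F. \<forall>y\<in>F. x \<noteq> y \<longrightarrow> \<rho> / m \<le> norm (hyper_proj e x - hyper_proj e y))" for F
  have card_le: "real (card F) \<le> 6 ^ CARD('d) * real m ^ ?s" if "sep F" for F
    using that by (intro separated_card_bound[OF e m0 \<rho>, of _ z]) (auto simp: sep_def near)
  obtain N :: nat where N: "6 ^ CARD('d) * real m ^ ?s < N" using reals_Archimedean2 by blast
  have bdd: "\<forall>F. sep F \<longrightarrow> card F < N"
  proof (intro allI impI)
    fix F assume "sep F"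
    from le_less_trans[OF card_le[OF this] N] show "card F < N" by simp
  qed
  have "sep {}" by (simp add: sep_def)
  \<comment> \<open>Cardinalities of separated sets are bounded, so one of greatest cardinality
    exists; an uncovered point of A could be added to it.\<close>
  from ex_has_greatest_nat[OF this bdd] obtain F where F: "sep F" "\<And>F'. sep F' \<Longrightarrow> card F' \<le> card F"
    by blast
  define D where "D x = {y \<in> A. norm (hyper_proj e y - hyper_proj e x) < \<rho> / m}" for x
  have cover: "A \<subseteq> (\<Union>x\<in>F. D x)"
  proof
    fix y assume y: "y \<in> A"
    show "y \<in> (\<Union>x\<in>F. D x)"
    proof (rule ccontr)
      assume "y \<notin> (\<Union>x\<in>F. D x)"
      then have far: "\<rho> / m \<le> norm (hyper_proj e y - hyper_proj e x)" if "x \<in> F" for x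
        using that y by (force simp: D_def)
      have "0 < \<rho> / m" using \<rho> m0 by simp
      then have "y \<notin> F" using far[of y] by fastforce
      have "sep (insert y F)"
        using F(1) y far by (auto simp: sep_def norm_minus_commute)
      then have "card (insert y F) \<le> card F" by (rule F(2))
      moreover have "finite F" using F(1) by (simp add: sep_def)
      ultimately show False using \<open>y \<notin> F\<close> by simp
    qed
  qed
  have D: "bounded (D x) \<and> diameter (D x) \<le> ?\<delta>" for x
  proof -
    have *: "norm (y - y') \<le> ?\<delta>" if "y \<in> D x" "y' \<in> D x" for y y'
    proof -
      have "norm (hyper_proj e y - hyper_proj e y') \<le> norm (hyper_proj e y - hyper_proj e x) + norm (hyper_proj e y' - hyper_proj e x)"
        using norm_triangle_ineq4[of "hyper_proj e y - hyper_proj e x" "hyper_proj e y' - hyper_proj e x"] by simp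
      also have "\<dots> \<le> \<rho> / m + \<rho> / m" using that by (intro add_mono) (auto simp: D_def)
      finally have "norm (hyper_proj e y - hyper_proj e y') \<le> 2 * \<rho> / m" by simp
      then have "(1 + L) * norm (hyper_proj e y - hyper_proj e y') \<le> (1 + L) * (2 * \<rho> / m)"
        using L by (intro mult_left_mono) auto
      then show ?thesis using lip[of y y'] that by (simp add: D_def field_simps)
    qed
    then have "diameter (D x) \<le> ?\<delta>" using \<delta> by (intro diameter_le) auto
    moreover have "bounded (D x)"
      unfolding bounded_two_points using * by (auto simp: dist_norm)
    ultimately show ?thesis by simp
  qed
  have "hausdorff_premeasure ?s \<delta>0 A \<le> hausdorff_premeasure ?s ?\<delta> A"
    unfolding hausdorff_premeasure_def using \<delta>_le by (intro INF_superset_mono) (auto intro: order_trans)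
  also have "\<dots> \<le> ennreal (real (card F) * (?V * (?\<delta> / 2) ^ ?s))"
    using F(1) cover D \<delta> by (intro hausdorff_premeasure_finite_cover) (auto simp: sep_def)
  also have "\<dots> \<le> ennreal (6 ^ CARD('d) * real m ^ ?s * (?V * (?\<delta> / 2) ^ ?s))"
    using card_le[OF F(1)] \<delta> by (intro ennreal_leI mult_right_mono) auto
  also have "6 ^ CARD('d) * real m ^ ?s * (?V * (?\<delta> / 2) ^ ?s)
      = 6 ^ CARD('d) * ?V * (real m * (?\<delta> / 2)) ^ ?s"
    by (simp only: power_mult_distrib[of "real m"] mult_ac)
  also have "real m * (?\<delta> / 2) = (1 + L) * \<rho>" using m0 by simp
  finally show "hausdorff_premeasure ?s \<delta>0 A \<le> ennreal (6 ^ CARD('d) * ?V * ((1 + L) * \<rho>) ^ ?s)" .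
qed

section \<open>The trace inequality\<close>

text \<open>Domination passes to bounded open sets through almost disjoint dyadic cubes, to open
  sets by exhaustion, and to Borel sets by outer regularity of Lebesgue measure, with the same
  constant throughout. The hypothesis speaks of cubes because a cube, unlike a long box, is
  comparable in volume with a ball around it.\<close>

lemma emeasure_le_lborel_if_cubes:
  fixes N :: "'a::euclidean_space measure"
  assumes sets: "sets N = sets borel" and C: "0 \<le> C"
    and cube: "\<And>u v l. 0 < l \<Longrightarrow> (\<And>i. i \<in> Basis \<Longrightarrow> v \<bullet> i - u \<bullet> i = l) \<Longrightarrow>
      emeasure N (cbox u v) \<le> ennreal C * emeasure lborel (cbox u v)"
    and A: "A \<in> sets borel"
  shows "emeasure N A \<le> ennreal C * emeasure lborel A"
proof -
  have bdd: "emeasure N U \<le> ennreal C * emeasure lborel U" if U: "open U" "bounded U" for U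
  proof -
    obtain r where r: "0 < r" "\<And>x. x \<in> U \<Longrightarrow> norm x \<le> r"
      using bounded_pos[of U] U by auto
    define a b :: 'a where "a = - r *\<^sub>R One" and "b = r *\<^sub>R One"
    have ab: "a \<bullet> i = - r" "b \<bullet> i = r" if "i \<in> Basis" for i using that by (simp_all add: a_def b_def)
    have sub: "U \<subseteq> cbox a b"
    proof
      fix x assume "x \<in> U"
      then have "\<bar>x \<bullet> i\<bar> \<le> r" if "i \<in> Basis" for i
        using Basis_le_norm[OF that, of x] r(2)[of x] by linarith
      then show "x \<in> cbox a b" by (auto simp: mem_box ab abs_le_iff minus_le_iff)
    qed
    have ne: "box a b \<noteq> {}" using r by (auto simp: box_ne_empty ab)
    \<comment> \<open>This gauge assigns U to every point of U, which forces each cube of the cover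
      to lie inside U.\<close>
    have g: "gauge (\<lambda>x. if x \<in> U then U else UNIV)" using U by (auto simp: gauge_def)
    obtain \<D> where \<D>: "countable \<D>" "\<And>K. K \<in> \<D> \<Longrightarrow> interior K \<noteq> {} \<and> (\<exists>c d. K = cbox c d)"
      "pairwise (\<lambda>A B. interior A \<inter> interior B = {}) \<D>"
      "\<And>K. K \<in> \<D> \<Longrightarrow> \<exists>x\<in>U \<inter> K. K \<subseteq> (if x \<in> U then U else UNIV)"
      "\<And>u v. cbox u v \<in> \<D> \<Longrightarrow> \<exists>n. \<forall>i\<in>Basis. v \<bullet> i - u \<bullet> i = (b \<bullet> i - a \<bullet> i) / 2 ^ n"
      "U \<subseteq> \<Union>\<D>"
      by (rule covering_lemma[OF sub ne g]) blast
    define X where "X n = (if n \<in> to_nat_on \<D> ` \<D> then from_nat_into \<D> n else {})" for n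
    have X: "X n \<in> \<D> \<or> X n = {}" for n
      using \<D>(1) by (auto simp: X_def)
    \<comment> \<open>N will be summed by subadditivity over the closed cubes, Lebesgue measure
      exactly over their disjoint interiors. The two fit together because faces have Lebesgue
      measure 0.\<close>
    have X_le: "emeasure N (X n) \<le> ennreal C * emeasure lborel (interior (X n))" for n
    proof (cases "X n = {}")
      case False
      with X have XD: "X n \<in> \<D>" by blast
      then obtain u v where uv: "X n = cbox u v" using \<D>(2) by blast
      then obtain k where k: "v \<bullet> i - u \<bullet> i = (b \<bullet> i - a \<bullet> i) / 2 ^ k" if "i \<in> Basis" for i
        using \<D>(5) XD by metis
      have "emeasure N (cbox u v) \<le> ennreal C * emeasure lborel (cbox u v)"
        by (rule cube[of "2 * r / 2 ^ k"]) (use r k ab in auto)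
      also have "emeasure lborel (cbox u v) = emeasure lborel (box u v)"
        by (simp add: emeasure_lborel_cbox_eq emeasure_lborel_box_eq)
      finally show ?thesis by (simp add: uv interior_cbox)
    qed simp
    have X_meas: "X n \<in> sets borel" for n
    proof (cases "X n = {}")
      case False
      then show ?thesis using X[of n] \<D>(2)[of "X n"] by auto
    qed simp
    have "U \<subseteq> (\<Union>n. X n)"
    proof
      fix x assume "x \<in> U"
      then obtain K where K: "K \<in> \<D>" "x \<in> K" using \<D>(6) by blast
      then have "X (to_nat_on \<D> K) = K" using \<D>(1) by (simp add: X_def)
      with K show "x \<in> (\<Union>n. X n)" by blast
    qed
    then have "emeasure N U \<le> emeasure N (\<Union>n. X n)"
      using X_meas by (intro emeasure_mono) (auto simp: sets)
    also have "\<dots> \<le> (\<Sum>n. emeasure N (X n))"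
      using X_meas by (intro emeasure_subadditive_countably) (auto simp: sets)
    also have "\<dots> \<le> (\<Sum>n. ennreal C * emeasure lborel (interior (X n)))"
      by (intro suminf_le X_le) auto
    also have "\<dots> = ennreal C * (\<Sum>n. emeasure lborel (interior (X n)))" by simp
    also have "(\<Sum>n. emeasure lborel (interior (X n))) = emeasure lborel (\<Union>n. interior (X n))"
    proof (rule suminf_emeasure)
      show "disjoint_family (\<lambda>n. interior (X n))"
        unfolding disjoint_family_on_def
      proof (intro ballI impI)
        fix m n :: nat assume "m \<noteq> n"
        show "interior (X m) \<inter> interior (X n) = {}"
        proof (cases "m \<in> to_nat_on \<D> ` \<D> \<and> n \<in> to_nat_on \<D> ` \<D>")
          case True
          then obtain K L where KL: "K \<in> \<D>" "L \<in> \<D>" "m = to_nat_on \<D> K" "n = to_nat_on \<D> L" by blast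
          with \<open>m \<noteq> n\<close> have "K \<noteq> L" by auto
          moreover have "X m = K" "X n = L" using KL \<D>(1) by (simp_all add: X_def)
          ultimately show ?thesis using \<D>(3) KL unfolding pairwise_def by blast
        next
          case False
          then have "X m = {} \<or> X n = {}" by (auto simp: X_def)
          then show ?thesis by auto
        qed
      qed
    qed auto
    also have "emeasure lborel (\<Union>n. interior (X n)) \<le> emeasure lborel U"
    proof (rule emeasure_mono)
      show "(\<Union>n. interior (X n)) \<subseteq> U"
      proof (rule UN_least)
        fix n
        show "interior (X n) \<subseteq> U"
        proof (cases "X n = {}")
          case False
          with X have "X n \<in> \<D>" by blast
          with \<D>(4) have "X n \<subseteq> U" by (metis IntD1)
          then show ?thesis using interior_subset by blast
        qed simp
      qed
    qed (use U in auto)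
    finally show ?thesis by (simp add: mult_left_mono)
  qed
  have opn: "emeasure N U \<le> ennreal C * emeasure lborel U" if U: "open U" for U
  proof -
    have UN: "(\<Union>n. U \<inter> ball 0 (real n)) = U"
      using reals_Archimedean2 by (auto simp: dist_norm)
    have "emeasure N U = (SUP n. emeasure N (U \<inter> ball 0 (real n)))"
      by (subst SUP_emeasure_incseq) (use U UN in \<open>auto simp: sets incseq_def\<close>)
    also have "\<dots> \<le> ennreal C * emeasure lborel U"
    proof (rule SUP_least)
      fix n :: nat
      have "emeasure N (U \<inter> ball 0 (real n)) \<le> ennreal C * emeasure lborel (U \<inter> ball 0 (real n))"
        using U by (intro bdd) auto
      also have "\<dots> \<le> ennreal C * emeasure lborel U"
        using U by (intro mult_left_mono emeasure_mono) auto
      finally show "emeasure N (U \<inter> ball 0 (real n)) \<le> ennreal C * emeasure lborel U" .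
    qed
    finally show ?thesis .
  qed
  show ?thesis
  proof (rule ennreal_le_epsilon)
    fix \<epsilon> :: real assume \<epsilon>: "0 < \<epsilon>"
    \<comment> \<open>The summand 1 covers the case C = 0 and still gives C \<eta> \<le>
      \<epsilon>.\<close>
    define \<eta> where "\<eta> = \<epsilon> / (C + 1)"
    have \<eta>: "0 < \<eta>" "C * \<eta> \<le> \<epsilon>" using \<epsilon> C by (auto simp: \<eta>_def field_simps)
    obtain U where U: "open U" "A \<subseteq> U" "emeasure lborel (U - A) < ennreal \<eta>"
      using outer_regular_lborel[OF A \<eta>(1)] by blast
    have "emeasure lborel U = emeasure lborel A + emeasure lborel (U - A)"
      using U A by (subst plus_emeasure) (auto intro: arg_cong[where f="emeasure lborel"])
    also have "\<dots> \<le> emeasure lborel A + ennreal \<eta>" using U(3) by (intro add_left_mono) simp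
    finally have "ennreal C * emeasure lborel U \<le> ennreal C * (emeasure lborel A + ennreal \<eta>)"
      by (intro mult_left_mono) simp_all
    also have "\<dots> = ennreal C * emeasure lborel A + ennreal (C * \<eta>)"
      using C \<eta> by (simp add: distrib_left ennreal_mult)
    also have "\<dots> \<le> ennreal C * emeasure lborel A + ennreal \<epsilon>"
      using \<eta> by (intro add_left_mono ennreal_leI)
    finally have "ennreal C * emeasure lborel U \<le> ennreal C * emeasure lborel A + ennreal \<epsilon>" .
    moreover have "emeasure N A \<le> emeasure N U" using U A by (intro emeasure_mono) (auto simp: sets)
    ultimately show "emeasure N A \<le> ennreal C * emeasure lborel A + ennreal \<epsilon>"
      using opn[OF U(1)] by (meson order_trans)
  qed
qed

lemma nn_integral_le_lborel_if_cubes: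
  fixes N :: "'a::euclidean_space measure"
  assumes sets: "sets N = sets borel" and C: "0 \<le> C"
    and cube: "\<And>u v l. 0 < l \<Longrightarrow> (\<And>i. i \<in> Basis \<Longrightarrow> v \<bullet> i - u \<bullet> i = l) \<Longrightarrow>
      emeasure N (cbox u v) \<le> ennreal C * emeasure lborel (cbox u v)"
    and f: "f \<in> borel_measurable borel"
  shows "(\<integral>\<^sup>+x. f x \<partial>N) \<le> ennreal C * (\<integral>\<^sup>+x. f x \<partial>lborel)"
proof -
  let ?D = "density lborel (\<lambda>_. ennreal C)"
  have "N \<le> ?D"
  proof (rule le_measure[THEN iffD2, rule_format])
    show "sets N = sets ?D" by (simp add: sets)
  next
    fix A assume "A \<in> sets N"
    then have A: "A \<in> sets borel" by (simp add: sets)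
    then show "emeasure N A \<le> emeasure ?D A"
      using emeasure_le_lborel_if_cubes[OF sets C cube A] by (simp add: emeasure_density_const)
  qed
  then have "(\<integral>\<^sup>+x. f x \<partial>N) \<le> (\<integral>\<^sup>+x. f x \<partial>?D)" by (intro nn_integral_mono_measure) (simp_all add: sets)
  also have "\<dots> = ennreal C * (\<integral>\<^sup>+x. f x \<partial>lborel)"
    using f by (simp add: nn_integral_density nn_integral_cmult)
  finally show ?thesis .
qed

text \<open>In the cylinder over a disc of radius \<open>\<rho>\<close> every line parallel to \<open>e\<close> meets a ball of that radius
  in length at most \<open>2 \<rho>\<close>, which supplies the missing power of \<open>\<rho>\<close>.\<close>

lemma swept_integral_le:
  fixes M :: "(real^'d) measure"
  assumes sets: "sets M = sets borel" and e: "norm e = 1" and c: "0 \<le> c" and S: "S \<in> sets borel"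
    and thin: "\<And>z \<rho>. 0 < \<rho> \<Longrightarrow>
      emeasure M (S \<inter> {x. norm (hyper_proj e (x - z)) \<le> \<rho>}) \<le> ennreal (c * \<rho> ^ (CARD('d) - 1))"
    and f[measurable]: "f \<in> borel_measurable borel"
  shows "(\<integral>\<^sup>+x. indicator S x * (\<integral>\<^sup>+t. f (x + t *\<^sub>R e) \<partial>lborel) \<partial>M)
    \<le> ennreal (2 * c * real CARD('d) ^ CARD('d)) * (\<integral>\<^sup>+x. f x \<partial>lborel)"
proof -
  let ?d = "CARD('d)"
  define Q where "Q = density M (indicator S)"
  \<comment> \<open>N spreads surface measure times length over the space, and the claim is a bound
    on its density, tested on balls. Lebesgue measure is the second factor, over which the inner
    integral runs, since it is the one known to be sigma-finite.\<close>
  define N where "N = distr (Q \<Otimes>\<^sub>M lborel) borel (\<lambda>(x, t). x + t *\<^sub>R e)"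
  have setsQ: "sets Q = sets borel" by (simp add: Q_def sets)
  have setsP: "sets (Q \<Otimes>\<^sub>M lborel) = sets (borel \<Otimes>\<^sub>M borel)" by (intro sets_pair_measure_cong setsQ) simp
  have T: "(\<lambda>(x, t). x + t *\<^sub>R e) \<in> (Q \<Otimes>\<^sub>M lborel) \<rightarrow>\<^sub>M borel"
    unfolding measurable_cong_sets[OF setsP refl] by measurable
  have ball: "emeasure N (cball z \<rho>) \<le> ennreal (2 * c * \<rho> ^ ?d)" if \<rho>: "0 < \<rho>" for z \<rho>
  proof -
    let ?cyl = "{x. norm (hyper_proj e (x - z)) \<le> \<rho>}"
    have cyl: "?cyl \<in> sets borel"
      by (intro borel_closed closed_Collect_le continuous_intros) (auto simp: hyper_proj_def intro!: continuous_intros)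
    have "emeasure N (cball z \<rho>) = emeasure (Q \<Otimes>\<^sub>M lborel) ((\<lambda>(x, t). x + t *\<^sub>R e) -` cball z \<rho> \<inter> space (Q \<Otimes>\<^sub>M lborel))"
      unfolding N_def by (rule emeasure_distr[OF T]) simp
    also have "\<dots> = (\<integral>\<^sup>+x. emeasure lborel (Pair x -` ((\<lambda>(x, t). x + t *\<^sub>R e) -` cball z \<rho> \<inter> space (Q \<Otimes>\<^sub>M lborel))) \<partial>Q)"
      by (intro lborel.emeasure_pair_measure_alt measurable_sets[OF T]) simp
    also have "\<dots> \<le> (\<integral>\<^sup>+x. ennreal (2 * \<rho>) * indicator ?cyl x \<partial>Q)"
    proof (rule nn_integral_mono)
      fix x
      let ?J = "Pair x -` ((\<lambda>(x, t). x + t *\<^sub>R e) -` cball z \<rho> \<inter> space (Q \<Otimes>\<^sub>M lborel))"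
      have J: "norm (x - z + t *\<^sub>R e) \<le> \<rho>" if "t \<in> ?J" for t
        using that by (simp add: dist_norm norm_minus_commute algebra_simps)
      show "emeasure lborel ?J \<le> ennreal (2 * \<rho>) * indicator ?cyl x"
      proof (cases "x \<in> ?cyl")
        case True
        have "?J \<subseteq> {- ((x - z) \<bullet> e) - \<rho> .. - ((x - z) \<bullet> e) + \<rho>}"
        proof
          fix t assume "t \<in> ?J"
          have "\<bar>(x - z + t *\<^sub>R e) \<bullet> e\<bar> \<le> norm (x - z + t *\<^sub>R e) * norm e" by (rule Cauchy_Schwarz_ineq2)
          also have "\<dots> \<le> \<rho>" using J[OF \<open>t \<in> ?J\<close>] e by simp
          finally have "\<bar>(x - z) \<bullet> e + t\<bar> \<le> \<rho>" using e by (simp add: inner_add_left norm_eq_1)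
          then show "t \<in> {- ((x - z) \<bullet> e) - \<rho> .. - ((x - z) \<bullet> e) + \<rho>}" by (auto simp: abs_le_iff)
        qed
        then have "emeasure lborel ?J \<le> emeasure lborel {- ((x - z) \<bullet> e) - \<rho> .. - ((x - z) \<bullet> e) + \<rho>}"
          by (intro emeasure_mono) simp_all
        also have "\<dots> = ennreal (2 * \<rho>)" using \<rho> by simp
        finally show ?thesis using True by simp
      next
        case False
        have "?J = {}"
        proof (rule equals0I)
          fix t assume "t \<in> ?J"
          have "norm (hyper_proj e (x - z)) = norm (hyper_proj e (x - z + t *\<^sub>R e))"
            by (simp add: hyper_proj_add_axis[OF e])
          also have "\<dots> \<le> \<rho>" using norm_hyper_proj_le[OF e] J[OF \<open>t \<in> ?J\<close>] by (rule order_trans)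
          finally show False using False by simp
        qed
        then show ?thesis by simp
      qed
    qed
    also have "\<dots> = ennreal (2 * \<rho>) * emeasure Q ?cyl"
      using cyl by (intro nn_integral_cmult_indicator) (simp add: setsQ)
    also have "emeasure Q ?cyl = emeasure M (S \<inter> ?cyl)"
      unfolding Q_def using S cyl by (subst emeasure_density)
        (auto simp: sets indicator_inter_arith[symmetric] borel_measurable_indicator_iff)
    also have "ennreal (2 * \<rho>) * \<dots> \<le> ennreal (2 * \<rho>) * ennreal (c * \<rho> ^ (?d - 1))"
      by (intro mult_left_mono thin \<rho>) simp_all
    also have "\<dots> = ennreal (2 * c * (\<rho> * \<rho> ^ (?d - 1)))"
      using \<rho> c by (simp add: ennreal_mult[symmetric] mult_ac)
    also have "\<rho> * \<rho> ^ (?d - 1) = \<rho> ^ ?d"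
      using zero_less_card_finite[where 'a='d] by (metis power_minus_mult mult.commute)
    finally show ?thesis .
  qed
  have "(\<integral>\<^sup>+x. f x \<partial>N) \<le> ennreal (2 * c * real ?d ^ ?d) * (\<integral>\<^sup>+x. f x \<partial>lborel)"
  proof (rule nn_integral_le_lborel_if_cubes)
    fix u v :: "real^'d" and l :: real
    assume l: "0 < l" and side: "\<And>i. i \<in> Basis \<Longrightarrow> v \<bullet> i - u \<bullet> i = l"
    \<comment> \<open>A cube of side l lies in the ball of radius d l about its corner u; this is
      the origin of the factor d^d.\<close>
    have "cbox u v \<subseteq> cball u (real ?d * l)"
    proof
      fix x assume x: "x \<in> cbox u v"
      have "norm (x - u) \<le> (\<Sum>i\<in>Basis. \<bar>(x - u) \<bullet> i\<bar>)" by (rule norm_le_l1)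
      also have "\<dots> \<le> (\<Sum>i\<in>(Basis::(real^'d) set). l)"
      proof (rule sum_mono)
        fix i :: "real^'d" assume "i \<in> Basis"
        then show "\<bar>(x - u) \<bullet> i\<bar> \<le> l" using x side[of i] by (auto simp: mem_box inner_diff_left)
      qed
      finally show "x \<in> cball u (real ?d * l)" by (simp add: dist_norm norm_minus_commute)
    qed
    then have "emeasure N (cbox u v) \<le> emeasure N (cball u (real ?d * l))"
      by (intro emeasure_mono) (simp_all add: N_def)
    also have "\<dots> \<le> ennreal (2 * c * (real ?d * l) ^ ?d)" using l by (intro ball) simp
    also have "\<dots> = ennreal (2 * c * real ?d ^ ?d) * ennreal (l ^ ?d)"
      using c l by (simp add: ennreal_mult[symmetric] power_mult_distrib mult_ac)
    also have "ennreal (l ^ ?d) = emeasure lborel (cbox u v)"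
    proof -
      have "\<forall>i\<in>Basis. u \<bullet> i \<le> v \<bullet> i" using l side by (metis diff_ge_0_iff_ge less_imp_le)
      then have "emeasure lborel (cbox u v) = ennreal (\<Prod>i\<in>Basis. (v - u) \<bullet> i)"
        by (simp add: emeasure_lborel_cbox_eq)
      also have "(\<Prod>i\<in>Basis. (v - u) \<bullet> i) = (\<Prod>i\<in>(Basis::(real^'d) set). l)"
        by (intro prod.cong refl) (simp add: inner_diff_left side)
      finally show ?thesis by simp
    qed
    finally show "emeasure N (cbox u v) \<le> ennreal (2 * c * real ?d ^ ?d) * emeasure lborel (cbox u v)" .
  qed (use c f in \<open>auto simp: N_def\<close>)
  moreover have "(\<integral>\<^sup>+x. f x \<partial>N) = (\<integral>\<^sup>+x. indicator S x * (\<integral>\<^sup>+t. f (x + t *\<^sub>R e) \<partial>lborel) \<partial>M)"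
  proof -
    have fT: "(\<lambda>(x, t). f (x + t *\<^sub>R e)) \<in> borel_measurable (Q \<Otimes>\<^sub>M lborel)"
      unfolding measurable_cong_sets[OF setsP refl] by measurable
    have "(\<integral>\<^sup>+x. f x \<partial>N) = (\<integral>\<^sup>+p. (\<lambda>(x, t). f (x + t *\<^sub>R e)) p \<partial>(Q \<Otimes>\<^sub>M lborel))"
      unfolding N_def by (subst nn_integral_distr[OF T]) (auto simp: case_prod_beta' intro: nn_integral_cong)
    also have "\<dots> = (\<integral>\<^sup>+x. (\<integral>\<^sup>+t. f (x + t *\<^sub>R e) \<partial>lborel) \<partial>Q)"
      using lborel.nn_integral_fst[OF fT] by simp
    also have "\<dots> = (\<integral>\<^sup>+x. indicator S x * (\<integral>\<^sup>+t. f (x + t *\<^sub>R e) \<partial>lborel) \<partial>M)"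
      unfolding Q_def
    proof (rule nn_integral_density)
      show "indicator S \<in> borel_measurable M" using S by (intro borel_measurable_indicator) (simp add: sets)
      have "(\<lambda>x. \<integral>\<^sup>+t. f (x + t *\<^sub>R e) \<partial>lborel) \<in> borel_measurable borel" by measurable
      then show "(\<lambda>x. \<integral>\<^sup>+t. f (x + t *\<^sub>R e) \<partial>lborel) \<in> borel_measurable M"
        by (simp add: measurable_cong_sets[OF sets refl])
    qed
    finally show ?thesis .
  qed
  ultimately show ?thesis by simp
qed

section \<open>Surface measure and averages along lines\<close>

lemma sets_hausdorff_measure [simp]: "sets (hausdorff_measure s) = sets borel"
  using sets.sigma_sets_eq[of borel] by (simp add: hausdorff_measure_def sets_measure_of_conv)

lemma space_hausdorff_measure [simp]: "space (hausdorff_measure s) = UNIV"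
  by (simp add: hausdorff_measure_def space_measure_of_conv)

text \<open>Only an upper bound on the surface measure is needed, so it does not matter here whether
  \<^const>\<open>measure_of\<close> collapses to the zero measure.\<close>

lemma emeasure_hausdorff_measure_le: "emeasure (hausdorff_measure s) A \<le> hausdorff_outer s A"
  by (simp add: hausdorff_measure_def emeasure_measure_of_conv)

lemma measurable_surface_measure_continuous:
  fixes f :: "real^'d \<Rightarrow> 'b::topological_space"
  assumes "continuous_on UNIV f"
  shows "f \<in> borel_measurable (surface_measure \<Omega>)"
proof -
  have "f \<in> borel_measurable borel" using assms by (rule borel_measurable_continuous_onI)
  then have "f \<in> borel_measurable (hausdorff_measure (CARD('d) - 1))"
    by (simp add: measurable_cong_sets[OF sets_hausdorff_measure refl])
  then show ?thesis unfolding surface_measure_def by (rule measurable_restrict_space1)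
qed

text \<open>The gradient is integrated over all of [0, h] and not just up to t. Then t enters only
  through the end value, and the bound can be averaged over t.\<close>

lemma abs_le_end_plus_line_integral:
  fixes \<phi> :: "real^'d \<Rightarrow> real"
  assumes \<phi>: "smooth_function \<phi>" and e: "norm e = 1" and t: "0 \<le> t" "t \<le> h"
  shows "ennreal \<bar>\<phi> x\<bar> \<le> ennreal \<bar>\<phi> (x + t *\<^sub>R e)\<bar>
    + (\<integral>\<^sup>+s. indicator {0..h} s * ennreal (norm (gradient \<phi> (x + s *\<^sub>R e))) \<partial>lborel)"
proof -
  let ?g = "\<lambda>s. gradient \<phi> (x + s *\<^sub>R e) \<bullet> e"
  have cont: "continuous_on {0..t} ?g"
    by (intro continuous_on_inner continuous_on_const
        continuous_on_compose2[OF smooth_function_continuous_gradient[OF \<phi>, of UNIV]] continuous_intros) auto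
  have "(\<integral>s. indicator {0..t} s *\<^sub>R ?g s \<partial>lborel) = \<phi> (x + t *\<^sub>R e) - \<phi> (x + 0 *\<^sub>R e)"
  proof (rule integral_FTC_atLeastAtMost[OF t(1) _ cont])
    fix s
    show "((\<lambda>s. \<phi> (x + s *\<^sub>R e)) has_vector_derivative ?g s) (at s within {0..t})"
      unfolding has_real_derivative_iff_has_vector_derivative[symmetric]
      by (rule DERIV_along_line) (rule smooth_function_differentiable[OF \<phi>])
  qed
  then have "ennreal \<bar>\<phi> (x + t *\<^sub>R e) - \<phi> x\<bar> = ennreal (norm (\<integral>s. indicator {0..t} s *\<^sub>R ?g s \<partial>lborel))"
    by simp
  also have "\<dots> \<le> (\<integral>\<^sup>+s. ennreal (norm (indicator {0..t} s *\<^sub>R ?g s)) \<partial>lborel)"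
    by (intro integral_norm_bound_ennreal borel_integrable_compact cont compact_Icc)
  also have "\<dots> \<le> (\<integral>\<^sup>+s. indicator {0..h} s * ennreal (norm (gradient \<phi> (x + s *\<^sub>R e))) \<partial>lborel)"
  proof (rule nn_integral_mono)
    fix s
    have "\<bar>?g s\<bar> \<le> norm (gradient \<phi> (x + s *\<^sub>R e))"
      using Cauchy_Schwarz_ineq2[of "gradient \<phi> (x + s *\<^sub>R e)" e] e by simp
    then show "ennreal (norm (indicator {0..t} s *\<^sub>R ?g s))
        \<le> indicator {0..h} s * ennreal (norm (gradient \<phi> (x + s *\<^sub>R e)))"
      using t by (auto simp: indicator_def intro!: ennreal_leI)
  qed
  finally have "ennreal \<bar>\<phi> (x + t *\<^sub>R e) - \<phi> x\<bar>
      \<le> (\<integral>\<^sup>+s. indicator {0..h} s * ennreal (norm (gradient \<phi> (x + s *\<^sub>R e))) \<partial>lborel)" .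
  note line = this
  have "ennreal \<bar>\<phi> x\<bar> \<le> ennreal (\<bar>\<phi> (x + t *\<^sub>R e)\<bar> + \<bar>\<phi> (x + t *\<^sub>R e) - \<phi> x\<bar>)"
    by (intro ennreal_leI) linarith
  also have "\<dots> = ennreal \<bar>\<phi> (x + t *\<^sub>R e)\<bar> + ennreal \<bar>\<phi> (x + t *\<^sub>R e) - \<phi> x\<bar>"
    by (rule ennreal_plus) simp_all
  finally show ?thesis using add_left_mono[OF line] by (rule order_trans)
qed

text \<open>Integrating the previous bound over the end point t in [0, h] replaces the end value,
  which an L1 norm does not control, by an integral; the term free of t picks up the factor
  h.\<close>

lemma abs_le_line_average:
  fixes \<phi> :: "real^'d \<Rightarrow> real"
  assumes \<phi>: "smooth_function \<phi>" and e: "norm e = 1" and h: "0 \<le> h"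
  shows "ennreal h * ennreal \<bar>\<phi> x\<bar> \<le> (\<integral>\<^sup>+t. indicator {0..h} t *
    ennreal (\<bar>\<phi> (x + t *\<^sub>R e)\<bar> + h * norm (gradient \<phi> (x + t *\<^sub>R e))) \<partial>lborel)"
proof -
  let ?I = "\<integral>\<^sup>+s. indicator {0..h} s * ennreal (norm (gradient \<phi> (x + s *\<^sub>R e))) \<partial>lborel"
  have line: "(\<lambda>t. x + t *\<^sub>R e) \<in> borel_measurable lborel" by measurable
  have "\<phi> \<in> borel_measurable borel" "gradient \<phi> \<in> borel_measurable borel"
    using smooth_function_continuous[OF \<phi>] smooth_function_continuous_gradient[OF \<phi>]
    by (auto intro: borel_measurable_continuous_onI)
  from measurable_compose[OF line this(1)] measurable_compose[OF line this(2)]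
  have [measurable]: "(\<lambda>t. \<phi> (x + t *\<^sub>R e)) \<in> borel_measurable lborel"
    "(\<lambda>t. gradient \<phi> (x + t *\<^sub>R e)) \<in> borel_measurable lborel" by simp_all
  have "ennreal h * ennreal \<bar>\<phi> x\<bar> = (\<integral>\<^sup>+t. ennreal \<bar>\<phi> x\<bar> * indicator {0..h} t \<partial>lborel)"
    using h by (simp add: nn_integral_cmult_indicator mult.commute)
  also have "\<dots> \<le> (\<integral>\<^sup>+t. indicator {0..h} t * ennreal \<bar>\<phi> (x + t *\<^sub>R e)\<bar> + ?I * indicator {0..h} t \<partial>lborel)"
    using abs_le_end_plus_line_integral[OF \<phi> e]
    by (intro nn_integral_mono) (auto simp: indicator_def)
  also have "\<dots> = (\<integral>\<^sup>+t. indicator {0..h} t * ennreal \<bar>\<phi> (x + t *\<^sub>R e)\<bar> \<partial>lborel) + ?I * ennreal h"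
    using h by (subst nn_integral_add) (simp_all add: nn_integral_cmult_indicator)
  also have "?I * ennreal h = (\<integral>\<^sup>+t. indicator {0..h} t * ennreal (norm (gradient \<phi> (x + t *\<^sub>R e))) * ennreal h \<partial>lborel)"
    by (subst nn_integral_multc) simp_all
  also have "(\<integral>\<^sup>+t. indicator {0..h} t * ennreal \<bar>\<phi> (x + t *\<^sub>R e)\<bar> \<partial>lborel)
      + (\<integral>\<^sup>+t. indicator {0..h} t * ennreal (norm (gradient \<phi> (x + t *\<^sub>R e))) * ennreal h \<partial>lborel)
      = (\<integral>\<^sup>+t. indicator {0..h} t * ennreal \<bar>\<phi> (x + t *\<^sub>R e)\<bar>
          + indicator {0..h} t * ennreal (norm (gradient \<phi> (x + t *\<^sub>R e))) * ennreal h \<partial>lborel)"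
    by (subst nn_integral_add) simp_all
  also have "\<dots> = (\<integral>\<^sup>+t. indicator {0..h} t *
      ennreal (\<bar>\<phi> (x + t *\<^sub>R e)\<bar> + h * norm (gradient \<phi> (x + t *\<^sub>R e))) \<partial>lborel)"
    using h by (intro nn_integral_cong) (simp add: ennreal_mult distrib_left mult_ac)
  finally show ?thesis .
qed

text \<open>One inequality holds because the open set \<Omega> contains none of its frontier points,
  the other by continuity of \<gamma> along points of \<Omega> converging to x inside the
  ball.\<close>

lemma frontier_on_graph:
  fixes \<Omega> :: "(real^'d) set"
  assumes "open \<Omega>" and e: "norm e = 1" and lip: "L-lipschitz_on {z. z \<bullet> e = 0} \<gamma>"
    and epi: "\<And>y. y \<in> ball x0 r \<Longrightarrow> y \<in> \<Omega> \<longleftrightarrow> y \<bullet> e > \<gamma> (hyper_proj e y)"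
    and x: "x \<in> frontier \<Omega>" "x \<in> ball x0 r"
  shows "x \<bullet> e = \<gamma> (hyper_proj e x)"
proof (rule antisym)
  have "x \<notin> \<Omega>" using x \<open>open \<Omega>\<close> by (simp add: frontier_def interior_open)
  then show "x \<bullet> e \<le> \<gamma> (hyper_proj e x)" using epi[OF x(2)] by simp
  have "x \<in> closure \<Omega>" using x by (simp add: frontier_def)
  then have "x \<in> closure (ball x0 r \<inter> \<Omega>)"
    using open_Int_closure_subset[of "ball x0 r" \<Omega>] x by auto
  then obtain y where y: "\<And>n. y n \<in> ball x0 r \<inter> \<Omega>" "y \<longlonglongrightarrow> x"
    unfolding closure_sequential by blast
  have cont: "continuous_on UNIV (\<lambda>y. \<gamma> (hyper_proj e y))"
    by (rule continuous_on_compose2[OF lipschitz_on_continuous_on[OF lip]])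
       (auto simp: hyper_proj_def inner_hyper_proj[OF e, unfolded hyper_proj_def] intro!: continuous_intros)
  have "(\<lambda>n. \<gamma> (hyper_proj e (y n))) \<longlonglongrightarrow> \<gamma> (hyper_proj e x)"
    using continuous_on_tendsto_compose[OF cont y(2)] by simp
  moreover have "(\<lambda>n. y n \<bullet> e) \<longlonglongrightarrow> x \<bullet> e" using y(2) by (intro tendsto_intros)
  moreover have "\<gamma> (hyper_proj e (y n)) \<le> y n \<bullet> e" for n using y(1)[of n] epi[of "y n"] by simp
  ultimately show "\<gamma> (hyper_proj e x) \<le> x \<bullet> e" by (intro LIMSEQ_le) auto
qed

lemma nn_integral_surface_indicator:
  fixes \<Omega> :: "(real^'d) set"
  shows "(\<integral>\<^sup>+x. indicator B x * f x \<partial>surface_measure \<Omega>)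
    = (\<integral>\<^sup>+x. indicator (frontier \<Omega> \<inter> B) x * f x \<partial>hausdorff_measure (CARD('d) - 1))"
  unfolding surface_measure_def
  by (subst nn_integral_restrict_space) (auto intro!: nn_integral_cong simp: indicator_def)

lemma nn_integral_lebesgue_on:
  assumes "\<Omega> \<in> sets lebesgue"
  shows "(\<integral>\<^sup>+x. f x \<partial>lebesgue_on \<Omega>) = (\<integral>\<^sup>+x. indicator \<Omega> x * f x \<partial>lborel)"
  using assms by (subst nn_integral_restrict_space) (auto simp: nn_integral_completion mult.commute)

text \<open>From each boundary point in the half ball a segment of fixed length in direction e runs
  inside \<Omega>, so the value at that point is bounded by averages along the segment. Sweeping the
  segments over the boundary piece costs only a constant, because the piece is a Lipschitz
  graph.\<close>

lemma trace_inequality_patch: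
  fixes \<Omega> :: "(real^'d) set"
  assumes \<Omega>: "open \<Omega>" and r: "0 < r" and e: "norm e = 1" and lip: "L-lipschitz_on {z. z \<bullet> e = 0} \<gamma>"
    and epi: "\<And>y. y \<in> ball x0 r \<Longrightarrow> y \<in> \<Omega> \<longleftrightarrow> y \<bullet> e > \<gamma> (hyper_proj e y)"
  shows "\<exists>C\<ge>0. \<forall>\<phi>. smooth_function \<phi> \<longrightarrow>
    (\<integral>\<^sup>+x. indicator (ball x0 (r / 2)) x * ennreal \<bar>\<phi> x\<bar> \<partial>surface_measure \<Omega>)
      \<le> ennreal C * (\<integral>\<^sup>+x. ennreal (\<bar>\<phi> x\<bar> + norm (gradient \<phi> x)) \<partial>lebesgue_on \<Omega>)"
proof -
  let ?d = "CARD('d)"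
  let ?M = "hausdorff_measure (?d - 1) :: (real^'d) measure"
  let ?V = "unit_ball_vol (real (?d - 1))"
  define S where "S = frontier \<Omega> \<inter> ball x0 (r / 2)"
  \<comment> \<open>Starting in the ball of radius r/2, a segment of length r/2 stays in the ball of
    radius r, where the graph description of \<Omega> is valid.\<close>
  define h where "h = r / 2"
  define c where "c = 6 ^ ?d * ?V * (1 + L) ^ (?d - 1)"
  \<comment> \<open>The factor 2 c d^d is the cost of sweeping a graph with measure constant c; max
    1 h merges the weights 1 and h of the function and its gradient; 1/h undoes the
    averaging.\<close>
  define C where "C = 2 * c * real ?d ^ ?d * max 1 h / h"
  have L: "0 \<le> L" by (rule lipschitz_on_nonneg[OF lip])
  have h: "0 < h" using r by (simp add: h_def)
  have c: "0 \<le> c" unfolding c_def using L by simp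
  have C: "0 \<le> C" unfolding C_def using c h by simp
  have S: "S \<in> sets borel" by (simp add: S_def)
  have graph: "x \<bullet> e = \<gamma> (hyper_proj e x)" if "x \<in> S" for x
    using that r by (intro frontier_on_graph[OF \<Omega> e lip epi]) (auto simp: S_def)
  have graph_lip: "norm (x - y) \<le> (1 + L) * norm (hyper_proj e x - hyper_proj e y)" if "x \<in> S" "y \<in> S" for x y
  proof -
    have "norm (x - y) = norm ((hyper_proj e x - hyper_proj e y) + (x \<bullet> e - y \<bullet> e) *\<^sub>R e)"
      by (simp add: hyper_proj_def algebra_simps)
    also have "\<dots> \<le> norm (hyper_proj e x - hyper_proj e y) + \<bar>x \<bullet> e - y \<bullet> e\<bar>"
      using norm_triangle_ineq[of "hyper_proj e x - hyper_proj e y" "(x \<bullet> e - y \<bullet> e) *\<^sub>R e"] e by simp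
    also have "\<bar>x \<bullet> e - y \<bullet> e\<bar> \<le> L * norm (hyper_proj e x - hyper_proj e y)"
      using lipschitz_onD[OF lip, of "hyper_proj e x" "hyper_proj e y"] graph that
      by (simp add: inner_hyper_proj[OF e] dist_norm)
    finally show ?thesis by (simp add: distrib_right)
  qed
  have up: "x + t *\<^sub>R e \<in> \<Omega>" if "x \<in> S" "0 < t" "t \<le> h" for x t
  proof -
    have "dist x0 (x + t *\<^sub>R e) \<le> dist x0 x + norm (t *\<^sub>R e)"
      using dist_triangle[of x0 "x + t *\<^sub>R e" x] by (simp add: dist_norm)
    also have "\<dots> < r" using that e by (simp add: S_def h_def)
    finally have "x + t *\<^sub>R e \<in> ball x0 r" by simp
    then show ?thesis
      using epi graph[OF that(1)] that e by (simp add: hyper_proj_add_axis[OF e] inner_add_left norm_eq_1)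
  qed
  have thin: "emeasure ?M (S \<inter> {x. norm (hyper_proj e (x - z)) \<le> \<rho>}) \<le> ennreal (c * \<rho> ^ (?d - 1))"
    if "0 < \<rho>" for z \<rho>
  proof -
    have "emeasure ?M (S \<inter> {x. norm (hyper_proj e (x - z)) \<le> \<rho>})
        \<le> hausdorff_outer (?d - 1) (S \<inter> {x. norm (hyper_proj e (x - z)) \<le> \<rho>})"
      by (rule emeasure_hausdorff_measure_le)
    also have "\<dots> \<le> ennreal (6 ^ ?d * ?V * ((1 + L) * \<rho>) ^ (?d - 1))"
      by (rule hausdorff_outer_graph_le[OF e L that, where z="hyper_proj e z"])
         (auto simp: graph_lip hyper_proj_diff)
    also have "6 ^ ?d * ?V * ((1 + L) * \<rho>) ^ (?d - 1) = c * \<rho> ^ (?d - 1)"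
      by (simp add: c_def power_mult_distrib)
    finally show ?thesis .
  qed
  have "(\<integral>\<^sup>+x. indicator (ball x0 (r / 2)) x * ennreal \<bar>\<phi> x\<bar> \<partial>surface_measure \<Omega>)
      \<le> ennreal C * (\<integral>\<^sup>+x. ennreal (\<bar>\<phi> x\<bar> + norm (gradient \<phi> x)) \<partial>lebesgue_on \<Omega>)" (is "?X \<le> ennreal C * ?Y")
    if \<phi>: "smooth_function \<phi>" for \<phi>
  proof -
    define f where "f y = indicator \<Omega> y * ennreal (\<bar>\<phi> y\<bar> + h * norm (gradient \<phi> y))" for y
    have [measurable]: "\<phi> \<in> borel_measurable borel" "gradient \<phi> \<in> borel_measurable borel" "\<Omega> \<in> sets borel"
      using smooth_function_continuous[OF \<phi>] smooth_function_continuous_gradient[OF \<phi>] \<Omega>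
      by (auto intro: borel_measurable_continuous_onI)
    have f_meas: "f \<in> borel_measurable borel" unfolding f_def by measurable
    have \<phi>M: "\<phi> \<in> borel_measurable ?M" by (simp add: measurable_cong_sets[OF sets_hausdorff_measure refl])
    have "ennreal h * ?X = ennreal h * (\<integral>\<^sup>+x. indicator S x * ennreal \<bar>\<phi> x\<bar> \<partial>?M)"
      by (simp add: nn_integral_surface_indicator S_def)
    also have "\<dots> = (\<integral>\<^sup>+x. ennreal h * (indicator S x * ennreal \<bar>\<phi> x\<bar>) \<partial>?M)"
      using S \<phi>M by (intro nn_integral_cmult[symmetric] borel_measurable_times_ennreal
          borel_measurable_indicator measurable_compose[OF _ measurable_ennreal] borel_measurable_abs) simp_all
    also have "\<dots> \<le> (\<integral>\<^sup>+x. indicator S x * (\<integral>\<^sup>+t. f (x + t *\<^sub>R e) \<partial>lborel) \<partial>?M)"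
    proof (rule nn_integral_mono)
      fix x
      show "ennreal h * (indicator S x * ennreal \<bar>\<phi> x\<bar>) \<le> indicator S x * (\<integral>\<^sup>+t. f (x + t *\<^sub>R e) \<partial>lborel)"
      proof (cases "x \<in> S")
        case True
        have "ennreal h * ennreal \<bar>\<phi> x\<bar> \<le> (\<integral>\<^sup>+t. indicator {0..h} t *
            ennreal (\<bar>\<phi> (x + t *\<^sub>R e)\<bar> + h * norm (gradient \<phi> (x + t *\<^sub>R e))) \<partial>lborel)"
          using h by (intro abs_le_line_average[OF \<phi> e]) simp
        also have "\<dots> \<le> (\<integral>\<^sup>+t. f (x + t *\<^sub>R e) \<partial>lborel)"
        proof (rule nn_integral_mono_AE)
          \<comment> \<open>At t = 0 the point lies on the frontier, where f vanishes; this single t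
            is negligible.\<close>
          show "AE t in lborel. indicator {0..h} t *
              ennreal (\<bar>\<phi> (x + t *\<^sub>R e)\<bar> + h * norm (gradient \<phi> (x + t *\<^sub>R e))) \<le> f (x + t *\<^sub>R e)"
            using AE_lborel_singleton[of 0]
            by eventually_elim (use up[OF True] in \<open>auto simp: f_def indicator_def\<close>)
        qed
        finally show ?thesis using True by simp
      qed simp
    qed
    also have "\<dots> \<le> ennreal (2 * c * real ?d ^ ?d) * (\<integral>\<^sup>+x. f x \<partial>lborel)"
      by (rule swept_integral_le[OF sets_hausdorff_measure e c S thin f_meas])
    also have "(\<integral>\<^sup>+x. f x \<partial>lborel)
        \<le> (\<integral>\<^sup>+x. ennreal (max 1 h) * (indicator \<Omega> x * ennreal (\<bar>\<phi> x\<bar> + norm (gradient \<phi> x))) \<partial>lborel)"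
    proof (rule nn_integral_mono)
      fix x
      have "\<bar>\<phi> x\<bar> + h * norm (gradient \<phi> x) \<le> max 1 h * (\<bar>\<phi> x\<bar> + norm (gradient \<phi> x))"
        unfolding distrib_left using mult_right_mono[of 1 "max 1 h" "\<bar>\<phi> x\<bar>"]
        by (intro add_mono mult_right_mono) auto
      then have "ennreal (\<bar>\<phi> x\<bar> + h * norm (gradient \<phi> x))
          \<le> ennreal (max 1 h * (\<bar>\<phi> x\<bar> + norm (gradient \<phi> x)))"
        by (rule ennreal_leI)
      also have "\<dots> = ennreal (max 1 h) * ennreal (\<bar>\<phi> x\<bar> + norm (gradient \<phi> x))"
        by (rule ennreal_mult) auto
      finally show "f x \<le> ennreal (max 1 h) * (indicator \<Omega> x * ennreal (\<bar>\<phi> x\<bar> + norm (gradient \<phi> x)))"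
        by (simp add: f_def indicator_def del: ennreal_plus)
    qed
    also have "\<dots> = ennreal (max 1 h) * ?Y"
      using \<Omega> by (subst nn_integral_cmult) (auto simp: nn_integral_lebesgue_on)
    also have "ennreal (2 * c * real ?d ^ ?d) * (ennreal (max 1 h) * ?Y) = ennreal h * (ennreal C * ?Y)"
      using h c by (simp add: C_def mult.assoc[symmetric] ennreal_mult[symmetric] C[unfolded C_def])
    finally have "ennreal h * ?X \<le> ennreal h * (ennreal C * ?Y)"
      by (simp add: mult_left_mono)
    then show ?thesis using h by (simp add: ennreal_mult_le_mult_iff)
  qed
  with C show ?thesis by blast
qed

text \<open>Compactness of the frontier leaves finitely many patches. Overlaps only enlarge the sum
  over the patches, so their constants may simply be added.\<close>

proposition trace_inequality:
  fixes \<Omega> :: "(real^'d) set"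
  assumes "bounded_lipschitz_domain \<Omega>"
  obtains C where "0 \<le> C" "\<And>\<phi>. smooth_function \<phi> \<Longrightarrow>
    (\<integral>\<^sup>+x. ennreal \<bar>\<phi> x\<bar> \<partial>surface_measure \<Omega>) \<le> ennreal (C * W11_norm \<Omega> \<phi>)"
proof -
  have \<Omega>: "open \<Omega>" "bounded \<Omega>" "lipschitz_boundary \<Omega>"
    using assms by (auto simp: bounded_lipschitz_domain_def)
  let ?Y = "\<lambda>\<phi>. \<integral>\<^sup>+x. ennreal (\<bar>\<phi> x\<bar> + norm (gradient \<phi> x)) \<partial>lebesgue_on \<Omega>"
  have "\<forall>x0\<in>frontier \<Omega>. \<exists>p. 0 < fst p \<and> 0 \<le> snd p \<and> (\<forall>\<phi>. smooth_function \<phi> \<longrightarrow>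
      (\<integral>\<^sup>+x. indicator (ball x0 (fst p)) x * ennreal \<bar>\<phi> x\<bar> \<partial>surface_measure \<Omega>) \<le> ennreal (snd p) * ?Y \<phi>)"
  proof
    fix x0 assume that: "x0 \<in> frontier \<Omega>"
    have "\<exists>r>0. \<exists>e L \<gamma>. norm e = 1 \<and> L-lipschitz_on {z. z \<bullet> e = 0} \<gamma> \<and>
        (\<forall>y \<in> ball x0 r. y \<in> \<Omega> \<longleftrightarrow> y \<bullet> e > \<gamma> (hyper_proj e y))"
      using \<Omega>(3) that unfolding lipschitz_boundary_def hyper_proj_def by (rule bspec)
    then obtain r e L \<gamma> where r: "0 < r" "norm e = 1" "L-lipschitz_on {z. z \<bullet> e = 0} \<gamma>"
      and "\<forall>y \<in> ball x0 r. y \<in> \<Omega> \<longleftrightarrow> y \<bullet> e > \<gamma> (hyper_proj e y)"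
      by (elim exE conjE) (rule that)
    note patch = r bspec[OF this(4)]
    obtain C where "0 \<le> C" and C: "\<forall>\<phi>. smooth_function \<phi> \<longrightarrow>
        (\<integral>\<^sup>+x. indicator (ball x0 (r / 2)) x * ennreal \<bar>\<phi> x\<bar> \<partial>surface_measure \<Omega>) \<le> ennreal C * ?Y \<phi>"
      using trace_inequality_patch[OF \<Omega>(1) patch] by blast
    then show "\<exists>p. 0 < fst p \<and> 0 \<le> snd p \<and> (\<forall>\<phi>. smooth_function \<phi> \<longrightarrow>
        (\<integral>\<^sup>+x. indicator (ball x0 (fst p)) x * ennreal \<bar>\<phi> x\<bar> \<partial>surface_measure \<Omega>) \<le> ennreal (snd p) * ?Y \<phi>)"
      using r(1) by (intro exI[of _ "(r / 2, C)"]) simp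
  qed
  from bchoice[OF this] obtain p where p: "\<forall>x0\<in>frontier \<Omega>. 0 < fst (p x0) \<and> 0 \<le> snd (p x0) \<and>
    (\<forall>\<phi>. smooth_function \<phi> \<longrightarrow> (\<integral>\<^sup>+x. indicator (ball x0 (fst (p x0))) x * ennreal \<bar>\<phi> x\<bar> \<partial>surface_measure \<Omega>)
      \<le> ennreal (snd (p x0)) * ?Y \<phi>)" by blast
  define R where "R x0 = fst (p x0)" for x0
  define K where "K x0 = snd (p x0)" for x0
  have RK: "0 < R x0" "0 \<le> K x0" "smooth_function \<phi> \<Longrightarrow>
      (\<integral>\<^sup>+x. indicator (ball x0 (R x0)) x * ennreal \<bar>\<phi> x\<bar> \<partial>surface_measure \<Omega>) \<le> ennreal (K x0) * ?Y \<phi>"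
    if "x0 \<in> frontier \<Omega>" for x0 \<phi>
    using bspec[OF p that] by (simp_all add: R_def K_def)
  have "compact (frontier \<Omega>)" by (rule compact_frontier_bounded[OF \<Omega>(2)])
  then obtain F where F: "F \<subseteq> frontier \<Omega>" "finite F" "frontier \<Omega> \<subseteq> (\<Union>x0\<in>F. ball x0 (R x0))"
    by (rule compactE_image[of _ "frontier \<Omega>" "\<lambda>x0. ball x0 (R x0)"]) (use RK(1) in force)+
  define C where "C = (\<Sum>x0\<in>F. K x0)"
  have K: "0 \<le> K x0" if "x0 \<in> F" for x0 using F RK(2) that by blast
  have C: "0 \<le> C" unfolding C_def by (intro sum_nonneg K)
  have "(\<integral>\<^sup>+x. ennreal \<bar>\<phi> x\<bar> \<partial>surface_measure \<Omega>) \<le> ennreal (C * W11_norm \<Omega> \<phi>)" if \<phi>: "smooth_function \<phi>" for \<phi>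
  proof -
    have meas: "\<phi> \<in> borel_measurable (surface_measure \<Omega>)"
      by (rule measurable_surface_measure_continuous[OF smooth_function_continuous[OF \<phi>]])
    have "(\<lambda>x. indicator (ball x0 (R x0)) x :: ennreal) \<in> borel_measurable (surface_measure \<Omega>)" for x0
      unfolding surface_measure_def by (intro measurable_restrict_space1 borel_measurable_indicator) simp
    note [measurable] = meas this
    have "(\<integral>\<^sup>+x. ennreal \<bar>\<phi> x\<bar> \<partial>surface_measure \<Omega>)
        \<le> (\<integral>\<^sup>+x. (\<Sum>x0\<in>F. indicator (ball x0 (R x0)) x * ennreal \<bar>\<phi> x\<bar>) \<partial>surface_measure \<Omega>)"
    proof (rule nn_integral_mono)
      fix x assume "x \<in> space (surface_measure \<Omega>)"
      then have "x \<in> frontier \<Omega>" by (simp add: surface_measure_def space_restrict_space)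
      then obtain x0 where x0: "x0 \<in> F" "x \<in> ball x0 (R x0)" using F(3) by blast
      then have "ennreal \<bar>\<phi> x\<bar> = indicator (ball x0 (R x0)) x * ennreal \<bar>\<phi> x\<bar>" by simp
      also have "\<dots> \<le> (\<Sum>x0\<in>F. indicator (ball x0 (R x0)) x * ennreal \<bar>\<phi> x\<bar>)"
        by (rule member_le_sum[OF x0(1) _ F(2)]) simp
      finally show "ennreal \<bar>\<phi> x\<bar> \<le> (\<Sum>x0\<in>F. indicator (ball x0 (R x0)) x * ennreal \<bar>\<phi> x\<bar>)" .
    qed
    also have "\<dots> = (\<Sum>x0\<in>F. \<integral>\<^sup>+x. indicator (ball x0 (R x0)) x * ennreal \<bar>\<phi> x\<bar> \<partial>surface_measure \<Omega>)"
      by (rule nn_integral_sum) measurable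
    also have "\<dots> \<le> (\<Sum>x0\<in>F. ennreal (K x0) * ?Y \<phi>)"
      using F(1) by (intro sum_mono RK(3) \<phi>) auto
    also have "\<dots> = ennreal C * ?Y \<phi>"
      using K by (simp add: C_def sum_distrib_right[symmetric] sum_ennreal)
    also have "?Y \<phi> = ennreal (W11_norm \<Omega> \<phi>)"
    proof -
      have wg: "has_weak_gradient \<Omega> \<phi> (gradient \<phi>)" by (rule smooth_has_weak_gradient[OF \<Omega>(2,1) \<phi>])
      then have int: "integrable (lebesgue_on \<Omega>) \<phi>" "integrable (lebesgue_on \<Omega>) (gradient \<phi>)"
        by (auto simp: has_weak_gradient_def)
      have "?Y \<phi> = ennreal (LINT x|lebesgue_on \<Omega>. \<bar>\<phi> x\<bar> + norm (gradient \<phi> x))"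
        using int by (intro nn_integral_eq_integral) auto
      also have "(LINT x|lebesgue_on \<Omega>. \<bar>\<phi> x\<bar> + norm (gradient \<phi> x)) = W11_norm \<Omega> \<phi>"
        unfolding W11_norm_eq[OF \<Omega>(1) wg] using int by (intro Bochner_Integration.integral_add) auto
      finally show ?thesis .
    qed
    also have "ennreal C * ennreal (W11_norm \<Omega> \<phi>) = ennreal (C * W11_norm \<Omega> \<phi>)"
      using C W11_norm_nonneg by (rule ennreal_mult[symmetric])
    finally show ?thesis .
  qed
  with C show ?thesis using that by blast
qed

section \<open>Convexity and closedness of the zero-trace space\<close>

text \<open>Suitable a and b yield the triangle inequality, the symmetry of the distance and the
  norm of the zero function.\<close>

lemma W11_norm_linear_le:
  fixes \<Omega> :: "(real^'d) set"
  assumes \<Omega>: "open \<Omega>" and v: "v \<in> W11 \<Omega>" and w: "w \<in> W11 \<Omega>"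
  shows "W11_norm \<Omega> (\<lambda>x. a * v x + b * w x) \<le> \<bar>a\<bar> * W11_norm \<Omega> v + \<bar>b\<bar> * W11_norm \<Omega> w"
proof -
  let ?G = "weak_grad \<Omega> v" and ?H = "weak_grad \<Omega> w"
  have wg: "has_weak_gradient \<Omega> v ?G" "has_weak_gradient \<Omega> w ?H" using v w by (simp_all add: W11_iff)
  then have int: "integrable (lebesgue_on \<Omega>) v" "integrable (lebesgue_on \<Omega>) w"
    "integrable (lebesgue_on \<Omega>) ?G" "integrable (lebesgue_on \<Omega>) ?H"
    by (auto simp: has_weak_gradient_def)
  have "(LINT x|lebesgue_on \<Omega>. \<bar>a * v x + b * w x\<bar>) \<le> (LINT x|lebesgue_on \<Omega>. \<bar>a\<bar> * \<bar>v x\<bar> + \<bar>b\<bar> * \<bar>w x\<bar>)"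
  proof (rule integral_mono)
    fix x show "\<bar>a * v x + b * w x\<bar> \<le> \<bar>a\<bar> * \<bar>v x\<bar> + \<bar>b\<bar> * \<bar>w x\<bar>"
      using abs_triangle_ineq[of "a * v x" "b * w x"] by (simp add: abs_mult)
  qed (use int in auto)
  moreover have "(LINT x|lebesgue_on \<Omega>. norm (a *\<^sub>R ?G x + b *\<^sub>R ?H x))
      \<le> (LINT x|lebesgue_on \<Omega>. \<bar>a\<bar> * norm (?G x) + \<bar>b\<bar> * norm (?H x))"
  proof (rule integral_mono)
    fix x show "norm (a *\<^sub>R ?G x + b *\<^sub>R ?H x) \<le> \<bar>a\<bar> * norm (?G x) + \<bar>b\<bar> * norm (?H x)"
      using norm_triangle_ineq[of "a *\<^sub>R ?G x" "b *\<^sub>R ?H x"] by simp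
  qed (use int in auto)
  ultimately show ?thesis
    unfolding W11_norm_eq[OF \<Omega> has_weak_gradient_linear[OF wg]] W11_norm_eq[OF \<Omega> wg(1)] W11_norm_eq[OF \<Omega> wg(2)]
    using int by (simp add: algebra_simps)
qed

lemma W11_linear: "v \<in> W11 \<Omega> \<Longrightarrow> w \<in> W11 \<Omega> \<Longrightarrow> (\<lambda>x. a * v x + b * w x) \<in> W11 \<Omega>"
  unfolding W11_def using has_weak_gradient_linear by blast

lemma W11_diff:
  assumes "v \<in> W11 \<Omega>" "w \<in> W11 \<Omega>"
  shows "(\<lambda>x. v x - w x) \<in> W11 \<Omega>"
  using W11_linear[OF assms, of 1 "-1"] by simp

lemma W11_norm_diff_triangle:
  fixes \<Omega> :: "(real^'d) set"
  assumes \<Omega>: "open \<Omega>" and "u \<in> W11 \<Omega>" "v \<in> W11 \<Omega>" "w \<in> W11 \<Omega>"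
  shows "W11_norm \<Omega> (\<lambda>x. u x - w x) \<le> W11_norm \<Omega> (\<lambda>x. u x - v x) + W11_norm \<Omega> (\<lambda>x. v x - w x)"
  using W11_norm_linear_le[OF \<Omega> W11_diff[OF assms(2,3)] W11_diff[OF assms(3,4)], of 1 1] by simp

lemma W11_norm_minus_commute:
  fixes \<Omega> :: "(real^'d) set"
  assumes \<Omega>: "open \<Omega>" and "u \<in> W11 \<Omega>" "v \<in> W11 \<Omega>"
  shows "W11_norm \<Omega> (\<lambda>x. u x - v x) \<le> W11_norm \<Omega> (\<lambda>x. v x - u x)"
  using W11_norm_linear_le[OF \<Omega> W11_diff[OF assms(3,2)] W11_diff[OF assms(3,2)], of "-1" 0] by simp

lemma smooth_W11: "bounded \<Omega> \<Longrightarrow> open \<Omega> \<Longrightarrow> smooth_function \<phi> \<Longrightarrow> \<phi> \<in> W11 \<Omega>"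
  unfolding W11_def using smooth_has_weak_gradient by blast

lemma zero_in_W11_zero_trace:
  fixes \<Omega> :: "(real^'d) set"
  assumes "bounded \<Omega>" "open \<Omega>"
  shows "(\<lambda>x. 0) \<in> W11_zero_trace \<Omega> \<Gamma>"
proof -
  have W: "(\<lambda>x. 0) \<in> W11 \<Omega>" by (rule smooth_W11[OF assms smooth_function_const])
  have "W11_norm \<Omega> (\<lambda>x. 0) \<le> 0"
    using W11_norm_linear_le[OF assms(2) W W, of 0 0] by simp
  then have "W11_norm \<Omega> (\<lambda>x. 0) = 0" using W11_norm_nonneg by (rule antisym)
  then have "has_trace \<Omega> (\<lambda>x. 0) (\<lambda>x. 0)"
    unfolding has_trace_def using W by (intro conjI exI[of _ "\<lambda>n x. 0"]) auto
  then show ?thesis using W by (auto simp: W11_zero_trace_def)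
qed

lemma W11_zero_trace_midpoint:
  fixes \<Omega> :: "(real^'d) set"
  assumes \<Omega>: "bounded \<Omega>" "open \<Omega>" and v: "v \<in> W11_zero_trace \<Omega> \<Gamma>" and w: "w \<in> W11_zero_trace \<Omega> \<Gamma>"
  shows "(\<lambda>x. (1/2) * v x + (1/2) * w x) \<in> W11_zero_trace \<Omega> \<Gamma>"
proof -
  let ?\<sigma> = "surface_measure \<Omega>"
  obtain g where g: "has_trace \<Omega> v g" "AE x in ?\<sigma>. x \<in> \<Gamma> \<longrightarrow> g x = 0" and vW: "v \<in> W11 \<Omega>"
    using v by (auto simp: W11_zero_trace_def)
  obtain k where k: "has_trace \<Omega> w k" "AE x in ?\<sigma>. x \<in> \<Gamma> \<longrightarrow> k x = 0" and wW: "w \<in> W11 \<Omega>"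
    using w by (auto simp: W11_zero_trace_def)
  obtain \<phi> where \<phi>: "\<And>n. smooth_function (\<phi> n)" "(\<lambda>n. W11_norm \<Omega> (\<lambda>x. \<phi> n x - v x)) \<longlonglongrightarrow> 0"
    "(\<lambda>n. \<integral>\<^sup>+x. ennreal \<bar>\<phi> n x - g x\<bar> \<partial>?\<sigma>) \<longlonglongrightarrow> 0" and intg: "integrable ?\<sigma> g"
    using g(1) by (auto simp: has_trace_def)
  obtain \<psi> where \<psi>: "\<And>n. smooth_function (\<psi> n)" "(\<lambda>n. W11_norm \<Omega> (\<lambda>x. \<psi> n x - w x)) \<longlonglongrightarrow> 0"
    "(\<lambda>n. \<integral>\<^sup>+x. ennreal \<bar>\<psi> n x - k x\<bar> \<partial>?\<sigma>) \<longlonglongrightarrow> 0" and intk: "integrable ?\<sigma> k"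
    using k(1) by (auto simp: has_trace_def)
  define \<xi> where "\<xi> n x = (1/2) * \<phi> n x + (1/2) * \<psi> n x" for n x
  let ?u = "\<lambda>x. (1/2) * v x + (1/2) * w x"
  let ?l = "\<lambda>x. (1/2) * g x + (1/2) * k x"
  have uW: "?u \<in> W11 \<Omega>" by (rule W11_linear[OF vW wW])
  have sm: "smooth_function (\<xi> n)" for n
    unfolding \<xi>_def by (intro smooth_function_add smooth_function_mult smooth_function_const \<phi> \<psi>)
  have "(\<lambda>n. W11_norm \<Omega> (\<lambda>x. \<xi> n x - ?u x)) \<longlonglongrightarrow> 0"
  proof (rule tendsto_sandwich[OF _ _ tendsto_const])
    show "\<forall>\<^sub>F n in sequentially. W11_norm \<Omega> (\<lambda>x. \<xi> n x - ?u x)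
        \<le> (1/2) * W11_norm \<Omega> (\<lambda>x. \<phi> n x - v x) + (1/2) * W11_norm \<Omega> (\<lambda>x. \<psi> n x - w x)"
    proof (rule always_eventually, rule allI)
      fix n
      have "(\<lambda>x. \<xi> n x - ?u x) = (\<lambda>x. (1/2) * (\<phi> n x - v x) + (1/2) * (\<psi> n x - w x))"
        by (auto simp: \<xi>_def fun_eq_iff field_simps)
      then show "W11_norm \<Omega> (\<lambda>x. \<xi> n x - ?u x)
          \<le> (1/2) * W11_norm \<Omega> (\<lambda>x. \<phi> n x - v x) + (1/2) * W11_norm \<Omega> (\<lambda>x. \<psi> n x - w x)"
        using W11_norm_linear_le[OF \<Omega>(2) W11_diff[OF smooth_W11[OF \<Omega> \<phi>(1)[of n]] vW]
          W11_diff[OF smooth_W11[OF \<Omega> \<psi>(1)[of n]] wW], of "1/2" "1/2"] by simp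
    qed
    show "(\<lambda>n. (1/2) * W11_norm \<Omega> (\<lambda>x. \<phi> n x - v x) + (1/2) * W11_norm \<Omega> (\<lambda>x. \<psi> n x - w x)) \<longlonglongrightarrow> 0"
      using tendsto_add[OF tendsto_mult_right_zero[OF \<phi>(2), of "1/2"] tendsto_mult_right_zero[OF \<psi>(2), of "1/2"]]
      by simp
  qed (simp add: W11_norm_nonneg)
  moreover have "(\<lambda>n. \<integral>\<^sup>+x. ennreal \<bar>\<xi> n x - ?l x\<bar> \<partial>?\<sigma>) \<longlonglongrightarrow> 0"
  proof (rule tendsto_sandwich[OF _ _ tendsto_const])
    show "\<forall>\<^sub>F n in sequentially. (\<integral>\<^sup>+x. ennreal \<bar>\<xi> n x - ?l x\<bar> \<partial>?\<sigma>)
        \<le> (\<integral>\<^sup>+x. ennreal \<bar>\<phi> n x - g x\<bar> \<partial>?\<sigma>) + (\<integral>\<^sup>+x. ennreal \<bar>\<psi> n x - k x\<bar> \<partial>?\<sigma>)"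
    proof (rule always_eventually, rule allI)
      fix n
      have [measurable]: "\<phi> n \<in> borel_measurable ?\<sigma>" "\<psi> n \<in> borel_measurable ?\<sigma>"
          "g \<in> borel_measurable ?\<sigma>" "k \<in> borel_measurable ?\<sigma>"
        using intg intk by (auto intro!: measurable_surface_measure_continuous smooth_function_continuous \<phi> \<psi>)
      have "(\<integral>\<^sup>+x. ennreal \<bar>\<xi> n x - ?l x\<bar> \<partial>?\<sigma>)
          \<le> (\<integral>\<^sup>+x. ennreal \<bar>\<phi> n x - g x\<bar> + ennreal \<bar>\<psi> n x - k x\<bar> \<partial>?\<sigma>)"
      proof (rule nn_integral_mono)
        fix x
        have "\<bar>\<xi> n x - ?l x\<bar> \<le> \<bar>\<phi> n x - g x\<bar> + \<bar>\<psi> n x - k x\<bar>" unfolding \<xi>_def by linarith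
        then have "ennreal \<bar>\<xi> n x - ?l x\<bar> \<le> ennreal (\<bar>\<phi> n x - g x\<bar> + \<bar>\<psi> n x - k x\<bar>)"
          by (rule ennreal_leI)
        then show "ennreal \<bar>\<xi> n x - ?l x\<bar> \<le> ennreal \<bar>\<phi> n x - g x\<bar> + ennreal \<bar>\<psi> n x - k x\<bar>"
          by simp
      qed
      also have "\<dots> = (\<integral>\<^sup>+x. ennreal \<bar>\<phi> n x - g x\<bar> \<partial>?\<sigma>) + (\<integral>\<^sup>+x. ennreal \<bar>\<psi> n x - k x\<bar> \<partial>?\<sigma>)"
        by (rule nn_integral_add) measurable
      finally show "(\<integral>\<^sup>+x. ennreal \<bar>\<xi> n x - ?l x\<bar> \<partial>?\<sigma>)
          \<le> (\<integral>\<^sup>+x. ennreal \<bar>\<phi> n x - g x\<bar> \<partial>?\<sigma>) + (\<integral>\<^sup>+x. ennreal \<bar>\<psi> n x - k x\<bar> \<partial>?\<sigma>)" .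
    qed
    show "(\<lambda>n. (\<integral>\<^sup>+x. ennreal \<bar>\<phi> n x - g x\<bar> \<partial>?\<sigma>) + (\<integral>\<^sup>+x. ennreal \<bar>\<psi> n x - k x\<bar> \<partial>?\<sigma>)) \<longlonglongrightarrow> 0"
      using tendsto_add[OF \<phi>(3) \<psi>(3)] by simp
  qed simp
  ultimately have "has_trace \<Omega> ?u ?l"
    unfolding has_trace_def using uW intg intk sm by (intro conjI exI[of _ \<xi>]) auto
  moreover have "AE x in ?\<sigma>. x \<in> \<Gamma> \<longrightarrow> ?l x = 0"
    using g(2) k(2) by eventually_elim simp
  ultimately show ?thesis using uW unfolding W11_zero_trace_def by blast
qed

text \<open>Smooth functions are picked close to u in \<Omega> and, on the boundary, close to the
  traces of members of the sequence, which vanish on \<Gamma>. The trace inequality for their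
  differences makes them a Cauchy sequence on the boundary, and its limit is a trace of u.\<close>

lemma W11_zero_trace_limit:
  fixes \<Omega> :: "(real^'d) set"
  assumes dom: "bounded_lipschitz_domain \<Omega>"
    and v: "\<And>n. v n \<in> W11_zero_trace \<Omega> \<Gamma>" and u: "u \<in> W11 \<Omega>"
    and lim: "(\<lambda>n. W11_norm \<Omega> (\<lambda>x. v n x - u x)) \<longlonglongrightarrow> 0"
  shows "u \<in> W11_zero_trace \<Omega> \<Gamma>"
proof -
  let ?\<sigma> = "surface_measure \<Omega>"
  let ?e = "\<lambda>n::nat. (1/2) ^ n :: real"
  have \<Omega>: "bounded \<Omega>" "open \<Omega>" using dom by (auto simp: bounded_lipschitz_domain_def)
  obtain C where C: "0 \<le> C" "\<And>\<phi>. smooth_function \<phi> \<Longrightarrow>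
      (\<integral>\<^sup>+x. ennreal \<bar>\<phi> x\<bar> \<partial>?\<sigma>) \<le> ennreal (C * W11_norm \<Omega> \<phi>)"
    by (rule trace_inequality[OF dom]) blast
  \<comment> \<open>One 2^-n is the distance from u to some v N, the other the error in
    approximating v N by a smooth function.\<close>
  have "\<exists>\<phi> g. smooth_function \<phi> \<and> integrable ?\<sigma> g \<and> (AE x in ?\<sigma>. x \<in> \<Gamma> \<longrightarrow> g x = 0) \<and>
      W11_norm \<Omega> (\<lambda>x. \<phi> x - u x) \<le> 2 * ?e n \<and> (\<integral>\<^sup>+x. ennreal \<bar>\<phi> x - g x\<bar> \<partial>?\<sigma>) \<le> ennreal (?e n)" for n
  proof -
    have e: "0 < ?e n" by simp
    obtain N where N: "W11_norm \<Omega> (\<lambda>x. v N x - u x) < ?e n"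
      using order_tendstoD(2)[OF lim e] by (auto simp: eventually_sequentially)
    have vW: "v N \<in> W11 \<Omega>" using v by (auto simp: W11_zero_trace_def)
    obtain g where g: "has_trace \<Omega> (v N) g" "AE x in ?\<sigma>. x \<in> \<Gamma> \<longrightarrow> g x = 0"
      using v[of N] by (auto simp: W11_zero_trace_def)
    then obtain \<phi> where \<phi>: "\<And>n. smooth_function (\<phi> n)" "(\<lambda>n. W11_norm \<Omega> (\<lambda>x. \<phi> n x - v N x)) \<longlonglongrightarrow> 0"
      "(\<lambda>n. \<integral>\<^sup>+x. ennreal \<bar>\<phi> n x - g x\<bar> \<partial>?\<sigma>) \<longlonglongrightarrow> 0" and intg: "integrable ?\<sigma> g"
      by (auto simp: has_trace_def)
    have "\<forall>\<^sub>F k in sequentially. W11_norm \<Omega> (\<lambda>x. \<phi> k x - v N x) < ?e n \<and>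
        (\<integral>\<^sup>+x. ennreal \<bar>\<phi> k x - g x\<bar> \<partial>?\<sigma>) < ennreal (?e n)"
      using order_tendstoD(2)[OF \<phi>(2) e] order_tendstoD(2)[OF \<phi>(3), of "ennreal (?e n)"]
      by (intro eventually_conj) auto
    then obtain k where k: "W11_norm \<Omega> (\<lambda>x. \<phi> k x - v N x) < ?e n"
        "(\<integral>\<^sup>+x. ennreal \<bar>\<phi> k x - g x\<bar> \<partial>?\<sigma>) < ennreal (?e n)"
      by (auto simp: eventually_sequentially)
    have "W11_norm \<Omega> (\<lambda>x. \<phi> k x - u x) \<le> 2 * ?e n"
      using W11_norm_diff_triangle[OF \<Omega>(2) smooth_W11[OF \<Omega> \<phi>(1)[of k]] vW u] k(1) N by linarith
    then show ?thesis using \<phi>(1) intg g(2) k(2) by (intro exI[of _ "\<phi> k"] exI[of _ g]) auto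
  qed
  then have "\<forall>n. \<exists>p. smooth_function (fst p) \<and> integrable ?\<sigma> (snd p) \<and> (AE x in ?\<sigma>. x \<in> \<Gamma> \<longrightarrow> snd p x = 0) \<and>
      W11_norm \<Omega> (\<lambda>x. fst p x - u x) \<le> 2 * ?e n \<and> (\<integral>\<^sup>+x. ennreal \<bar>fst p x - snd p x\<bar> \<partial>?\<sigma>) \<le> ennreal (?e n)"
    by simp
  from choice[OF this] obtain P where P: "\<forall>n. smooth_function (fst (P n)) \<and> integrable ?\<sigma> (snd (P n)) \<and>
      (AE x in ?\<sigma>. x \<in> \<Gamma> \<longrightarrow> snd (P n) x = 0) \<and>
      W11_norm \<Omega> (\<lambda>x. fst (P n) x - u x) \<le> 2 * ?e n \<and>
      (\<integral>\<^sup>+x. ennreal \<bar>fst (P n) x - snd (P n) x\<bar> \<partial>?\<sigma>) \<le> ennreal (?e n)" by blast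
  define \<xi> where "\<xi> n = fst (P n)" for n
  define g where "g n = snd (P n)" for n
  have sm: "smooth_function (\<xi> n)" and intg: "integrable ?\<sigma> (g n)"
    and g0: "AE x in ?\<sigma>. x \<in> \<Gamma> \<longrightarrow> g n x = 0" and \<xi>u: "W11_norm \<Omega> (\<lambda>x. \<xi> n x - u x) \<le> 2 * ?e n"
    and \<xi>g: "(\<integral>\<^sup>+x. ennreal \<bar>\<xi> n x - g n x\<bar> \<partial>?\<sigma>) \<le> ennreal (?e n)" for n
    using spec[OF P, of n] by (simp_all add: \<xi>_def g_def)
  have \<xi>W: "\<xi> n \<in> W11 \<Omega>" for n by (rule smooth_W11[OF \<Omega> sm])
  have meas: "\<xi> n \<in> borel_measurable ?\<sigma>" "g n \<in> borel_measurable ?\<sigma>" for n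
    using intg[of n] by (auto intro!: measurable_surface_measure_continuous smooth_function_continuous sm)
  have int_diff: "integrable ?\<sigma> (\<lambda>x. \<xi> n x - g n x)" for n
  proof (rule integrableI_bounded)
    have "ennreal (?e n) < \<infinity>" by simp
    then show "(\<integral>\<^sup>+x. ennreal (norm (\<xi> n x - g n x)) \<partial>?\<sigma>) < \<infinity>"
      using \<xi>g[of n] unfolding real_norm_def by (rule le_less_trans[rotated])
  qed (use meas in simp)
  have int\<xi>: "integrable ?\<sigma> (\<xi> n)" for n
    using Bochner_Integration.integrable_add[OF int_diff[of n] intg[of n]] by simp
  have diff_le: "(LINT x|?\<sigma>. norm (\<xi> n x - g n x)) \<le> ?e n" for n
    using \<xi>g[of n] int_diff[of n] nn_integral_eq_integral[of ?\<sigma> "\<lambda>x. \<bar>\<xi> n x - g n x\<bar>"]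
    by (simp add: integrable_abs)
  \<comment> \<open>The distances of two consecutive approximants to u add up to 2^-n + 2 * 2^-n,
    for which 4 * 2^-n is a round majorant.\<close>
  have step: "(LINT x|?\<sigma>. norm (\<xi> (Suc n) x - \<xi> n x)) \<le> 4 * C * ?e n" for n
  proof -
    have "W11_norm \<Omega> (\<lambda>x. \<xi> (Suc n) x - \<xi> n x)
        \<le> W11_norm \<Omega> (\<lambda>x. \<xi> (Suc n) x - u x) + W11_norm \<Omega> (\<lambda>x. u x - \<xi> n x)"
      by (rule W11_norm_diff_triangle[OF \<Omega>(2) \<xi>W u \<xi>W])
    also have "W11_norm \<Omega> (\<lambda>x. u x - \<xi> n x) \<le> W11_norm \<Omega> (\<lambda>x. \<xi> n x - u x)"
      by (rule W11_norm_minus_commute[OF \<Omega>(2) u \<xi>W])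
    finally have W: "W11_norm \<Omega> (\<lambda>x. \<xi> (Suc n) x - \<xi> n x) \<le> 4 * ?e n"
      using \<xi>u[of n] \<xi>u[of "Suc n"] zero_le_power[of "1/2::real" n] unfolding power_Suc by linarith
    have "ennreal (LINT x|?\<sigma>. norm (\<xi> (Suc n) x - \<xi> n x)) = (\<integral>\<^sup>+x. ennreal \<bar>\<xi> (Suc n) x - \<xi> n x\<bar> \<partial>?\<sigma>)"
      using int\<xi> by (subst nn_integral_eq_integral) (auto intro!: integrable_abs)
    also have "\<dots> \<le> ennreal (C * W11_norm \<Omega> (\<lambda>x. \<xi> (Suc n) x - \<xi> n x))"
      by (intro C smooth_function_diff sm)
    also have "\<dots> \<le> ennreal (C * (4 * ?e n))" by (intro ennreal_leI mult_left_mono W C)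
    finally show ?thesis using C(1) by (simp add: mult_ac)
  qed
  have geo: "summable (\<lambda>n. c * ?e n)" for c by (intro summable_mult summable_geometric) simp
  have "summable (\<lambda>n. LINT x|?\<sigma>. norm (\<xi> (Suc n) x - \<xi> n x))"
    by (rule summable_comparison_test'[OF geo, of 0]) (use step in simp)
  then obtain h where h: "integrable ?\<sigma> h" "AE x in ?\<sigma>. (\<lambda>n. \<xi> n x) \<longlonglongrightarrow> h x"
    "(\<lambda>n. LINT x|?\<sigma>. norm (\<xi> n x - h x)) \<longlonglongrightarrow> 0"
    by (rule L1_fast_Cauchy_converges[OF int\<xi>])
  \<comment> \<open>L1 convergence to 0 alone would not give pointwise convergence; summability
    does, so on \<Gamma>, where every \<open>g n\<close> is 0, the limit of \<open>\<xi> n\<close>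
    is 0 almost everywhere.\<close>
  have "summable (\<lambda>n. LINT x|?\<sigma>. norm (\<xi> n x - g n x))"
    by (rule summable_comparison_test'[OF geo[of 1], of 0]) (use diff_le in simp)
  then have AEd: "AE x in ?\<sigma>. summable (\<lambda>n. norm (\<xi> n x - g n x))"
    by (rule AE_summable_norm[OF int_diff])
  have "AE x in ?\<sigma>. \<forall>n. x \<in> \<Gamma> \<longrightarrow> g n x = 0" using g0 by (intro AE_all_countable[THEN iffD2] allI)
  then have h0: "AE x in ?\<sigma>. x \<in> \<Gamma> \<longrightarrow> h x = 0"
    using AEd h(2)
  proof eventually_elim
    case (elim x)
    show ?case
    proof
      assume "x \<in> \<Gamma>"
      then have "(\<lambda>n. norm (\<xi> n x - g n x)) = (\<lambda>n. \<bar>\<xi> n x\<bar>)" using elim(1) by simp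
      then have "(\<lambda>n. \<bar>\<xi> n x\<bar>) \<longlonglongrightarrow> 0" using summable_LIMSEQ_zero[OF elim(2)] by simp
      then have "(\<lambda>n. \<xi> n x) \<longlonglongrightarrow> 0" by (rule tendsto_rabs_zero_cancel)
      then show "h x = 0" using elim(3) LIMSEQ_unique by blast
    qed
  qed
  have "(\<lambda>n. W11_norm \<Omega> (\<lambda>x. \<xi> n x - u x)) \<longlonglongrightarrow> 0"
  proof (rule tendsto_sandwich[OF _ _ tendsto_const])
    show "(\<lambda>n. 2 * ?e n) \<longlonglongrightarrow> 0" by (rule tendsto_mult_right_zero[OF LIMSEQ_power_zero]) simp
  qed (simp_all add: W11_norm_nonneg \<xi>u)
  moreover have "(\<lambda>n. \<integral>\<^sup>+x. ennreal \<bar>\<xi> n x - h x\<bar> \<partial>?\<sigma>) \<longlonglongrightarrow> 0"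
  proof -
    have "(\<integral>\<^sup>+x. ennreal \<bar>\<xi> n x - h x\<bar> \<partial>?\<sigma>) = ennreal (LINT x|?\<sigma>. norm (\<xi> n x - h x))" for n
      using int\<xi> h(1) by (subst nn_integral_eq_integral) (auto intro!: integrable_abs)
    then show ?thesis using tendsto_ennrealI[OF h(3)] by simp
  qed
  ultimately have "has_trace \<Omega> u h"
    unfolding has_trace_def using u h(1) sm by (intro conjI exI[of _ \<xi>]) auto
  then show ?thesis using h0 u unfolding W11_zero_trace_def by blast
qed

section \<open>Existence and uniqueness of the minimiser\<close>

lemma L2_linear:
  assumes v: "v \<in> L2 \<Omega>" and w: "w \<in> L2 \<Omega>"
  shows "(\<lambda>x. a * v x + b * w x) \<in> L2 \<Omega>"
proof -
  have [measurable]: "v \<in> borel_measurable (lebesgue_on \<Omega>)" "w \<in> borel_measurable (lebesgue_on \<Omega>)"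
    using v w by (auto simp: L2_def)
  have "integrable (lebesgue_on \<Omega>) (\<lambda>x. (a * v x + b * w x)\<^sup>2)"
  proof (rule Bochner_Integration.integrable_bound)
    show "integrable (lebesgue_on \<Omega>) (\<lambda>x. 2 * a\<^sup>2 * (v x)\<^sup>2 + 2 * b\<^sup>2 * (w x)\<^sup>2)"
      using v w by (auto simp: L2_def)
    show "AE x in lebesgue_on \<Omega>. norm ((a * v x + b * w x)\<^sup>2) \<le> norm (2 * a\<^sup>2 * (v x)\<^sup>2 + 2 * b\<^sup>2 * (w x)\<^sup>2)"
    proof (rule AE_I2)
      fix x
      have "2 * a\<^sup>2 * (v x)\<^sup>2 + 2 * b\<^sup>2 * (w x)\<^sup>2 = (a * v x + b * w x)\<^sup>2 + (a * v x - b * w x)\<^sup>2"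
        by (simp add: power2_eq_square algebra_simps)
      then have "(a * v x + b * w x)\<^sup>2 \<le> 2 * a\<^sup>2 * (v x)\<^sup>2 + 2 * b\<^sup>2 * (w x)\<^sup>2" by simp
      then show "norm ((a * v x + b * w x)\<^sup>2) \<le> norm (2 * a\<^sup>2 * (v x)\<^sup>2 + 2 * b\<^sup>2 * (w x)\<^sup>2)"
        by simp
    qed
  qed measurable
  then show ?thesis by (simp add: L2_def)
qed

lemma L2_diff: "v \<in> L2 \<Omega> \<Longrightarrow> w \<in> L2 \<Omega> \<Longrightarrow> (\<lambda>x. v x - w x) \<in> L2 \<Omega>"
  using L2_linear[of v \<Omega> w 1 "-1"] by simp

lemma L2_mult_integrable:
  assumes "v \<in> L2 \<Omega>" "w \<in> L2 \<Omega>"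
  shows "integrable (lebesgue_on \<Omega>) (\<lambda>x. v x * w x)"
proof -
  have "integrable (lebesgue_on \<Omega>) (\<lambda>x. (1/4) * ((1 * v x + 1 * w x)\<^sup>2 - (1 * v x + (-1) * w x)\<^sup>2))"
    using L2_linear[OF assms, of 1 1] L2_linear[OF assms, of 1 "-1"]
    by (intro integrable_mult_right Bochner_Integration.integrable_diff) (simp_all add: L2_def)
  also have "(\<lambda>x. (1/4) * ((1 * v x + 1 * w x)\<^sup>2 - (1 * v x + (-1) * w x)\<^sup>2)) = (\<lambda>x. v x * w x)"
    by (auto simp: fun_eq_iff power2_eq_square algebra_simps)
  finally show ?thesis .
qed

definition sq_dist :: "(real^'d) set \<Rightarrow> (real^'d \<Rightarrow> real) \<Rightarrow> (real^'d \<Rightarrow> real) \<Rightarrow> real" where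
  "sq_dist \<Omega> f v = (LINT x|lebesgue_on \<Omega>. (v x - f x)\<^sup>2)"

lemma sq_dist_nonneg: "0 \<le> sq_dist \<Omega> f v"
  by (simp add: sq_dist_def)

lemma objective_eq_sq_dist:
  assumes f: "f \<in> L2 \<Omega>" and v: "v \<in> L2 \<Omega>"
  shows "objective \<Omega> f v = ereal (1/2 * sq_dist \<Omega> f v - 1/2 * (LINT x|lebesgue_on \<Omega>. (f x)\<^sup>2))"
proof -
  have int: "integrable (lebesgue_on \<Omega>) (\<lambda>x. (v x)\<^sup>2)" "integrable (lebesgue_on \<Omega>) (\<lambda>x. (f x)\<^sup>2)"
    "integrable (lebesgue_on \<Omega>) (\<lambda>x. f x * v x)"
    using f v L2_mult_integrable[OF f v] by (auto simp: L2_def)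
  have "sq_dist \<Omega> f v = (LINT x|lebesgue_on \<Omega>. (v x)\<^sup>2 - 2 * (f x * v x) + (f x)\<^sup>2)"
    unfolding sq_dist_def by (intro Bochner_Integration.integral_cong) (auto simp: power2_eq_square algebra_simps)
  also have "\<dots> = (LINT x|lebesgue_on \<Omega>. (v x)\<^sup>2) - 2 * (LINT x|lebesgue_on \<Omega>. f x * v x)
      + (LINT x|lebesgue_on \<Omega>. (f x)\<^sup>2)"
    using int by simp
  finally show ?thesis using v by (simp add: objective_def field_simps)
qed

text \<open>Relative to f the midpoint of v and w is the half sum of v - f and w - f, while their
  difference is unchanged. Hence near minimisers are close to each other and two minimisers
  coincide.\<close>

lemma sq_dist_parallelogram:
  assumes f: "f \<in> L2 \<Omega>" and v: "v \<in> L2 \<Omega>" and w: "w \<in> L2 \<Omega>"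
  shows "(LINT x|lebesgue_on \<Omega>. (v x - w x)\<^sup>2) = 2 * sq_dist \<Omega> f v + 2 * sq_dist \<Omega> f w
    - 4 * sq_dist \<Omega> f (\<lambda>x. (1/2) * v x + (1/2) * w x)"
proof -
  have int: "integrable (lebesgue_on \<Omega>) (\<lambda>x. (v x - f x)\<^sup>2)" "integrable (lebesgue_on \<Omega>) (\<lambda>x. (w x - f x)\<^sup>2)"
    "integrable (lebesgue_on \<Omega>) (\<lambda>x. ((1/2) * v x + (1/2) * w x - f x)\<^sup>2)"
    using L2_diff[OF v f] L2_diff[OF w f] L2_diff[OF L2_linear[OF v w, of "1/2" "1/2"] f] by (auto simp: L2_def)
  have "(LINT x|lebesgue_on \<Omega>. (v x - w x)\<^sup>2) = (LINT x|lebesgue_on \<Omega>. 2 * (v x - f x)\<^sup>2 + 2 * (w x - f x)\<^sup>2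
      - 4 * ((1/2) * v x + (1/2) * w x - f x)\<^sup>2)"
    by (intro Bochner_Integration.integral_cong) (auto simp: power2_eq_square field_simps)
  also have "\<dots> = 2 * sq_dist \<Omega> f v + 2 * sq_dist \<Omega> f w - 4 * sq_dist \<Omega> f (\<lambda>x. (1/2) * v x + (1/2) * w x)"
    unfolding sq_dist_def using int by (simp del: times_divide_eq_left)
  finally show ?thesis .
qed

section \<open>Convexity of the constraint set and the weighted gradient energy\<close>

lemma grad_constraint_set_midpoint:
  fixes \<Omega> :: "(real^'d) set"
  assumes \<Omega>: "bounded \<Omega>" "open \<Omega>" and p: "1 \<le> p"
    and v: "v \<in> grad_constraint_set \<Omega> \<Gamma> p \<alpha>" and w: "w \<in> grad_constraint_set \<Omega> \<Gamma> p \<alpha>"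
  shows "(\<lambda>x. (1/2) * v x + (1/2) * w x) \<in> grad_constraint_set \<Omega> \<Gamma> p \<alpha>"
    and "AE x in lebesgue_on \<Omega>. weak_grad \<Omega> (\<lambda>x. (1/2) * v x + (1/2) * w x) x
      = (1/2) *\<^sub>R weak_grad \<Omega> v x + (1/2) *\<^sub>R weak_grad \<Omega> w x"
proof -
  have vw: "v \<in> W11_zero_trace \<Omega> \<Gamma>" "w \<in> W11_zero_trace \<Omega> \<Gamma>"
    using v w by (simp_all add: grad_constraint_set_def)
  then have wg: "has_weak_gradient \<Omega> v (weak_grad \<Omega> v)" "has_weak_gradient \<Omega> w (weak_grad \<Omega> w)"
    by (simp_all add: W11_zero_trace_def W11_iff)
  show AE: "AE x in lebesgue_on \<Omega>. weak_grad \<Omega> (\<lambda>x. (1/2) * v x + (1/2) * w x) x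
      = (1/2) *\<^sub>R weak_grad \<Omega> v x + (1/2) *\<^sub>R weak_grad \<Omega> w x"
    by (rule weak_grad_AE_eq[OF \<Omega>(2) has_weak_gradient_linear[OF wg]])
  have "AE x in lebesgue_on \<Omega>. lp_norm p (weak_grad \<Omega> v x) \<le> \<alpha> x"
    "AE x in lebesgue_on \<Omega>. lp_norm p (weak_grad \<Omega> w x) \<le> \<alpha> x"
    using v w by (simp_all add: grad_constraint_set_def)
  with AE have "AE x in lebesgue_on \<Omega>. lp_norm p (weak_grad \<Omega> (\<lambda>x. (1/2) * v x + (1/2) * w x) x) \<le> \<alpha> x"
    by eventually_elim (simp only: lp_norm_midpoint_le[OF p])
  then show "(\<lambda>x. (1/2) * v x + (1/2) * w x) \<in> grad_constraint_set \<Omega> \<Gamma> p \<alpha>"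
    unfolding grad_constraint_set_def using W11_zero_trace_midpoint[OF \<Omega> vw] by blast
qed

lemma zero_in_grad_constraint_set:
  fixes \<Omega> :: "(real^'d) set"
  assumes \<Omega>: "bounded \<Omega>" "open \<Omega>" and p: "1 \<le> p" and \<alpha>: "AE x in lebesgue_on \<Omega>. 0 \<le> \<alpha> x"
  shows "(\<lambda>x. 0) \<in> grad_constraint_set \<Omega> \<Gamma> p \<alpha>"
proof -
  have "gradient (\<lambda>x::real^'d. 0) = (\<lambda>x. 0)"
    unfolding gradient_def by (rule ext, subst partial_deriv_eq[where D="\<lambda>_. 0"]) (auto simp: vec_eq_iff)
  then have "AE x in lebesgue_on \<Omega>. weak_grad \<Omega> (\<lambda>x. 0) x = 0"
    using weak_grad_AE_eq[OF \<Omega>(2) smooth_has_weak_gradient[OF \<Omega> smooth_function_const[of 0]]] by simp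
  note grad0 = this
  have lp0: "lp_norm p (0 :: real^'d) = 0"
    using p by (auto simp: lp_norm_def)
  have "AE x in lebesgue_on \<Omega>. lp_norm p (weak_grad \<Omega> (\<lambda>x. 0) x) \<le> \<alpha> x"
    using grad0 \<alpha> by eventually_elim (simp add: lp0)
  then show ?thesis
    unfolding grad_constraint_set_def using zero_in_W11_zero_trace[OF \<Omega>] by blast
qed

text \<open>The absolute value keeps the denominator at least 1 everywhere, although \<alpha> is
  nonnegative only almost everywhere. The Euclidean norm is used whatever p is, as the parallelogram
  identity needs an inner product.\<close>

definition energy :: "(real^'d) set \<Rightarrow> (real^'d \<Rightarrow> real) \<Rightarrow> (real^'d \<Rightarrow> real) \<Rightarrow> real" where
  "energy \<Omega> \<alpha> v = (LINT x|lebesgue_on \<Omega>. (norm (weak_grad \<Omega> v x))\<^sup>2 / (1 + \<bar>\<alpha> x\<bar>))"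

lemma energy_nonneg: "0 \<le> energy \<Omega> \<alpha> v"
  unfolding energy_def by (intro Bochner_Integration.integral_nonneg) simp

text \<open>The constraint gives |\<nabla>v| \<le> d |\<alpha>|, and d^2 \<alpha>^2 / (1 +
  |\<alpha>|) \<le> d^2 |\<alpha>|. That the bound is uniform in v keeps the infima of the energy
  bounded later on.\<close>

lemma grad_constraint_energy:
  fixes \<Omega> :: "(real^'d) set"
  assumes p: "1 \<le> p" and \<alpha>: "integrable (lebesgue_on \<Omega>) \<alpha>" and v: "v \<in> grad_constraint_set \<Omega> \<Gamma> p \<alpha>"
  shows "integrable (lebesgue_on \<Omega>) (\<lambda>x. (norm (weak_grad \<Omega> v x))\<^sup>2 / (1 + \<bar>\<alpha> x\<bar>))"
    and "energy \<Omega> \<alpha> v \<le> (real CARD('d))\<^sup>2 * (LINT x|lebesgue_on \<Omega>. \<bar>\<alpha> x\<bar>)"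
proof -
  let ?d = "real CARD('d)"
  have G: "integrable (lebesgue_on \<Omega>) (weak_grad \<Omega> v)"
    using v by (auto simp: grad_constraint_set_def W11_zero_trace_def W11_iff has_weak_gradient_def)
  then have [measurable]: "weak_grad \<Omega> v \<in> borel_measurable (lebesgue_on \<Omega>)" "\<alpha> \<in> borel_measurable (lebesgue_on \<Omega>)"
    using \<alpha> by auto
  have "AE x in lebesgue_on \<Omega>. lp_norm p (weak_grad \<Omega> v x) \<le> \<alpha> x"
    using v by (simp add: grad_constraint_set_def)
  then have bound: "AE x in lebesgue_on \<Omega>. (norm (weak_grad \<Omega> v x))\<^sup>2 / (1 + \<bar>\<alpha> x\<bar>) \<le> ?d\<^sup>2 * \<bar>\<alpha> x\<bar>"
  proof eventually_elim
    case (elim x)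
    have "norm (weak_grad \<Omega> v x) \<le> ?d * lp_norm p (weak_grad \<Omega> v x)" by (rule norm_le_lp_norm[OF p])
    also have "\<dots> \<le> ?d * \<bar>\<alpha> x\<bar>" using elim by (intro mult_left_mono) auto
    finally have "(norm (weak_grad \<Omega> v x))\<^sup>2 \<le> (?d * \<bar>\<alpha> x\<bar>)\<^sup>2" by (intro power_mono) auto
    also have "\<dots> \<le> ?d\<^sup>2 * \<bar>\<alpha> x\<bar> * (1 + \<bar>\<alpha> x\<bar>)"
      by (simp add: power2_eq_square algebra_simps)
    finally show ?case by (simp add: divide_le_eq)
  qed
  show int: "integrable (lebesgue_on \<Omega>) (\<lambda>x. (norm (weak_grad \<Omega> v x))\<^sup>2 / (1 + \<bar>\<alpha> x\<bar>))"
  proof (rule Bochner_Integration.integrable_bound)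
    show "integrable (lebesgue_on \<Omega>) (\<lambda>x. ?d\<^sup>2 * \<bar>\<alpha> x\<bar>)" using \<alpha> by auto
    show "AE x in lebesgue_on \<Omega>. norm ((norm (weak_grad \<Omega> v x))\<^sup>2 / (1 + \<bar>\<alpha> x\<bar>)) \<le> norm (?d\<^sup>2 * \<bar>\<alpha> x\<bar>)"
      using bound by eventually_elim (simp add: abs_mult)
  qed measurable
  have "energy \<Omega> \<alpha> v \<le> (LINT x|lebesgue_on \<Omega>. ?d\<^sup>2 * \<bar>\<alpha> x\<bar>)"
    unfolding energy_def by (rule integral_mono_AE[OF int _ bound]) (use \<alpha> in auto)
  then show "energy \<Omega> \<alpha> v \<le> ?d\<^sup>2 * (LINT x|lebesgue_on \<Omega>. \<bar>\<alpha> x\<bar>)" by simp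
qed

text \<open>The chosen gradient of the midpoint is the average of the two gradients only almost
  everywhere, so the identity for vectors is transferred through integrals; integrability of the
  weighted difference comes with it.\<close>

lemma energy_parallelogram:
  fixes \<Omega> :: "(real^'d) set"
  assumes \<Omega>: "bounded \<Omega>" "open \<Omega>" and p: "1 \<le> p" and \<alpha>: "integrable (lebesgue_on \<Omega>) \<alpha>"
    and v: "v \<in> grad_constraint_set \<Omega> \<Gamma> p \<alpha>" and w: "w \<in> grad_constraint_set \<Omega> \<Gamma> p \<alpha>"
  defines "D \<equiv> \<lambda>x. (norm (weak_grad \<Omega> v x - weak_grad \<Omega> w x))\<^sup>2 / (1 + \<bar>\<alpha> x\<bar>)"
  shows "integrable (lebesgue_on \<Omega>) D"
    and "(LINT x|lebesgue_on \<Omega>. D x) = 2 * energy \<Omega> \<alpha> v + 2 * energy \<Omega> \<alpha> w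
      - 4 * energy \<Omega> \<alpha> (\<lambda>x. (1/2) * v x + (1/2) * w x)"
proof -
  let ?m = "\<lambda>x. (1/2) * v x + (1/2) * w x"
  let ?e = "\<lambda>v x. (norm (weak_grad \<Omega> v x))\<^sup>2 / (1 + \<bar>\<alpha> x\<bar>)"
  note mid = grad_constraint_set_midpoint[OF \<Omega> p v w]
  note int = grad_constraint_energy(1)[OF p \<alpha> v] grad_constraint_energy(1)[OF p \<alpha> w]
    grad_constraint_energy(1)[OF p \<alpha> mid(1)]
  have "integrable (lebesgue_on \<Omega>) (weak_grad \<Omega> v)" "integrable (lebesgue_on \<Omega>) (weak_grad \<Omega> w)"
    using v w by (auto simp: grad_constraint_set_def W11_zero_trace_def W11_iff has_weak_gradient_def)
  then have [measurable]: "weak_grad \<Omega> v \<in> borel_measurable (lebesgue_on \<Omega>)"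
    "weak_grad \<Omega> w \<in> borel_measurable (lebesgue_on \<Omega>)" "\<alpha> \<in> borel_measurable (lebesgue_on \<Omega>)"
    using \<alpha> by auto
  have D_meas: "D \<in> borel_measurable (lebesgue_on \<Omega>)" unfolding D_def by measurable
  have pl: "(norm (a - b))\<^sup>2 = 2 * (norm a)\<^sup>2 + 2 * (norm b)\<^sup>2 - 4 * (norm ((1/2) *\<^sub>R a + (1/2) *\<^sub>R b))\<^sup>2" for a b :: "real^'d"
    unfolding power2_norm_eq_inner
    by (simp add: inner_add_left inner_add_right inner_diff_left inner_diff_right inner_commute[of b a] algebra_simps)
  have AE: "AE x in lebesgue_on \<Omega>. 2 * ?e v x + 2 * ?e w x - 4 * ?e ?m x = D x"
    using mid(2)
  proof eventually_elim
    case (elim x)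
    show ?case unfolding D_def elim pl[of "weak_grad \<Omega> v x"]
      by (simp only: diff_divide_distrib add_divide_distrib times_divide_eq_right)
  qed
  have intE: "integrable (lebesgue_on \<Omega>) (\<lambda>x. 2 * ?e v x + 2 * ?e w x - 4 * ?e ?m x)"
    by (intro Bochner_Integration.integrable_diff Bochner_Integration.integrable_add integrable_mult_right int)
  then show "integrable (lebesgue_on \<Omega>) D"
    by (rule integrable_cong_AE_imp[OF _ D_meas]) (use AE in \<open>auto elim: eventually_mono\<close>)
  have "(LINT x|lebesgue_on \<Omega>. D x) = (LINT x|lebesgue_on \<Omega>. 2 * ?e v x + 2 * ?e w x - 4 * ?e ?m x)"
    using intE D_meas AE by (intro integral_cong_AE) (auto elim: eventually_mono)
  also have "\<dots> = 2 * energy \<Omega> \<alpha> v + 2 * energy \<Omega> \<alpha> w - 4 * energy \<Omega> \<alpha> ?m"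
    unfolding energy_def
    by (simp only: Bochner_Integration.integral_diff Bochner_Integration.integral_add integral_mult_right_zero
        Bochner_Integration.integrable_add integrable_mult_right int simp_thms)
  finally show "(LINT x|lebesgue_on \<Omega>. D x) = 2 * energy \<Omega> \<alpha> v + 2 * energy \<Omega> \<alpha> w - 4 * energy \<Omega> \<alpha> ?m" .
qed

text \<open>AM-GM with a free parameter \<open>\<kappa>\<close> replaces the Cauchy-Schwarz inequality.\<close>

lemma integral_norm_le_weighted_square:
  fixes Z :: "'a \<Rightarrow> 'b::{banach, second_countable_topology}"
  assumes "integrable M Z" "integrable M W" "integrable M (\<lambda>x. (norm (Z x))\<^sup>2 / W x)"
    and W: "\<And>x. 0 < W x" and \<kappa>: "0 < \<kappa>"
  shows "(LINT x|M. norm (Z x)) \<le> \<kappa> * (LINT x|M. (norm (Z x))\<^sup>2 / W x) + (LINT x|M. W x) / \<kappa>"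
proof -
  have "(LINT x|M. norm (Z x)) \<le> (LINT x|M. \<kappa> * ((norm (Z x))\<^sup>2 / W x) + W x / \<kappa>)"
  proof (rule integral_mono)
    fix x
    let ?z = "norm (Z x)"
    \<comment> \<open>Division by \<kappa> W gives the claim. The added product lowers the
      coefficient of the mixed term from 2 to 1, so that exactly one norm remains.\<close>
    have "0 \<le> (\<kappa> * ?z - W x)\<^sup>2 + \<kappa> * ?z * W x" using W[of x] \<kappa> by simp
    also have "\<dots> = (\<kappa> * W x) * (\<kappa> * (?z\<^sup>2 / W x) + W x / \<kappa> - ?z)"
      using W[of x] \<kappa> by (simp add: power2_eq_square field_simps)
    finally have "0 \<le> \<kappa> * (?z\<^sup>2 / W x) + W x / \<kappa> - ?z"
      using mult_pos_pos[OF \<kappa> W[of x]] by (auto simp: zero_le_mult_iff)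
    then show "?z \<le> \<kappa> * (?z\<^sup>2 / W x) + W x / \<kappa>" by simp
  qed (intro Bochner_Integration.integrable_add integrable_mult_right integrable_divide integrable_norm assms)+
  then show ?thesis
    by (simp only: Bochner_Integration.integral_add integrable_mult_right integrable_divide
        integral_mult_right_zero integral_divide_zero assms)
qed

text \<open>\<open>E\<close> is almost minimised over the sublevel sets of \<open>q\<close>; as these decrease, the infima of \<open>E\<close>
  increase to a limit, and the midpoint of two members stays in the larger of their sublevel sets.\<close>

lemma near_minimizers_with_small_gaps:
  fixes q E :: "'v \<Rightarrow> real"
  assumes ne: "X \<noteq> {}" and q0: "\<And>v. v \<in> X \<Longrightarrow> 0 \<le> q v" and E: "\<And>v. v \<in> X \<Longrightarrow> 0 \<le> E v \<and> E v \<le> B"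
    and mid: "\<And>v w. v \<in> X \<Longrightarrow> w \<in> X \<Longrightarrow> mid v w \<in> X \<and> q (mid v w) \<le> max (q v) (q w)"
  obtains v :: "nat \<Rightarrow> 'v" where "\<And>n. v n \<in> X" "\<And>n. q (v n) \<le> Inf (q ` X) + (1/4) ^ n"
    "\<And>k l. E (v k) + E (v l) - 2 * E (mid (v k) (v l)) \<le> 3 * ((1/4) ^ k + (1/4) ^ l)"
proof -
  let ?\<eta> = "\<lambda>n::nat. (1/4) ^ n :: real"
  define m where "m = Inf (q ` X)"
  define A where "A \<epsilon> = {v \<in> X. q v \<le> m + \<epsilon>}" for \<epsilon>
  define D where "D \<epsilon> = Inf (E ` A \<epsilon>)" for \<epsilon>
  \<comment> \<open>D increases as its argument decreases to 0, so this supremum is its limit at 0;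
    it is finite because the energies are bounded by B.\<close>
  define S where "S = Sup (D ` {0<..})"
  have A_ne: "A \<epsilon> \<noteq> {}" if "0 < \<epsilon>" for \<epsilon>
  proof -
    have "Inf (q ` X) < m + \<epsilon>" using that by (simp add: m_def)
    then obtain v where "v \<in> X" "q v < m + \<epsilon>"
      using cInf_lessD[of "q ` X"] ne by auto
    then show ?thesis by (auto simp: A_def intro: less_imp_le)
  qed
  have E_bdd: "bdd_below (E ` A \<epsilon>)" for \<epsilon> using E by (auto simp: A_def intro!: bdd_belowI[of _ 0])
  have D_le: "D \<epsilon> \<le> E v" if "v \<in> A \<epsilon>" for v \<epsilon>
    unfolding D_def using that E_bdd by (intro cInf_lower) auto
  have D_mono: "D \<epsilon> \<le> D \<epsilon>'" if "0 < \<epsilon>'" "\<epsilon>' \<le> \<epsilon>" for \<epsilon> \<epsilon>'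
    unfolding D_def by (rule cInf_superset_mono) (use that A_ne E_bdd in \<open>auto simp: A_def\<close>)
  have D_B: "D \<epsilon> \<le> B" if \<epsilon>: "0 < \<epsilon>" for \<epsilon>
  proof -
    obtain v where v: "v \<in> A \<epsilon>" using A_ne[OF \<epsilon>] by blast
    then have "E v \<le> B" using E by (simp add: A_def)
    with D_le[OF v] show ?thesis by simp
  qed
  have D_bdd: "bdd_above (D ` {0<..})" using D_B by (auto intro!: bdd_aboveI[of _ B])
  have D_S: "D \<epsilon> \<le> S" if "0 < \<epsilon>" for \<epsilon>
    unfolding S_def using that D_bdd by (intro cSup_upper) auto
  \<comment> \<open>The tolerance has to be small in two respects: q may exceed its infimum by at
    most 4^-n, and the infimum of E over the sublevel set must be within 4^-n of S.\<close>
  have "\<exists>p. 0 < snd p \<and> snd p \<le> ?\<eta> n \<and> S - ?\<eta> n < D (snd p) \<and> fst p \<in> A (snd p) \<and> E (fst p) < S + ?\<eta> n" for n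
  proof -
    have \<eta>: "0 < ?\<eta> n" by simp
    then have "S - ?\<eta> n < Sup (D ` {0<..})" by (simp add: S_def)
    then obtain \<epsilon>' where \<epsilon>': "0 < \<epsilon>'" "S - ?\<eta> n < D \<epsilon>'"
      using less_cSupD[of "D ` {0<..}"] by auto
    define \<epsilon> where "\<epsilon> = min \<epsilon>' (?\<eta> n)"
    have \<epsilon>: "0 < \<epsilon>" "\<epsilon> \<le> ?\<eta> n" "\<epsilon> \<le> \<epsilon>'" using \<eta> \<epsilon>' by (auto simp: \<epsilon>_def)
    have "Inf (E ` A \<epsilon>) < S + ?\<eta> n" using D_S[OF \<epsilon>(1)] \<eta> unfolding D_def by linarith
    then obtain v where v: "v \<in> A \<epsilon>" "E v < S + ?\<eta> n"
      using cInf_lessD[of "E ` A \<epsilon>"] A_ne[OF \<epsilon>(1)] by auto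
    have "S - ?\<eta> n < D \<epsilon>" using \<epsilon>'(2) D_mono[OF \<epsilon>(1,3)] by simp
    then show ?thesis using v \<epsilon> by (intro exI[of _ "(v, \<epsilon>)"]) simp
  qed
  then have "\<forall>n. \<exists>p. 0 < snd p \<and> snd p \<le> ?\<eta> n \<and> S - ?\<eta> n < D (snd p) \<and> fst p \<in> A (snd p) \<and> E (fst p) < S + ?\<eta> n"
    by blast
  from choice[OF this] obtain P where P: "\<forall>n. 0 < snd (P n) \<and> snd (P n) \<le> ?\<eta> n \<and> S - ?\<eta> n < D (snd (P n)) \<and>
      fst (P n) \<in> A (snd (P n)) \<and> E (fst (P n)) < S + ?\<eta> n" by blast
  define v where "v n = fst (P n)" for n
  define \<epsilon> where "\<epsilon> n = snd (P n)" for n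
  have \<epsilon>: "0 < \<epsilon> n" "\<epsilon> n \<le> ?\<eta> n" "S - ?\<eta> n < D (\<epsilon> n)" "v n \<in> A (\<epsilon> n)" "E (v n) < S + ?\<eta> n" for n
    using spec[OF P, of n] by (simp_all add: v_def \<epsilon>_def)
  have vX: "v n \<in> X" and q_le: "q (v n) \<le> m + \<epsilon> n" for n using \<epsilon>(4)[of n] by (simp_all add: A_def)
  have q_le': "q (v n) \<le> Inf (q ` X) + ?\<eta> n" for n using q_le[of n] \<epsilon>(2)[of n] by (simp add: m_def)
  \<comment> \<open>Each energy exceeds S by less than its own tolerance. The midpoint energy falls
    short of S by at most the sum of both and enters twice, which makes the factor 3.\<close>
  have gap: "E (v k) + E (v l) - 2 * E (mid (v k) (v l)) \<le> 3 * (?\<eta> k + ?\<eta> l)" for k l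
  proof -
    let ?\<epsilon> = "max (\<epsilon> k) (\<epsilon> l)"
    have "q (mid (v k) (v l)) \<le> max (q (v k)) (q (v l))" using mid vX by blast
    then have "mid (v k) (v l) \<in> A ?\<epsilon>"
      using mid[OF vX[of k] vX[of l]] q_le[of k] q_le[of l] by (auto simp: A_def max_def split: if_splits)
    then have "D ?\<epsilon> \<le> E (mid (v k) (v l))" by (rule D_le)
    moreover have "S - (?\<eta> k + ?\<eta> l) \<le> D ?\<epsilon>"
    proof -
      have "0 \<le> ?\<eta> k" "0 \<le> ?\<eta> l" by simp_all
      then have "S - (?\<eta> k + ?\<eta> l) \<le> D (\<epsilon> k)" "S - (?\<eta> k + ?\<eta> l) \<le> D (\<epsilon> l)"
        using \<epsilon>(3)[of k] \<epsilon>(3)[of l] by linarith+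
      then show ?thesis by (simp add: max_def)
    qed
    ultimately show ?thesis using \<epsilon>(5)[of k] \<epsilon>(5)[of l] by (simp add: distrib_left)
  qed
  show ?thesis by (rule that[OF vX q_le' gap])
qed

lemma summable_if_le_half_power:
  fixes a :: "nat \<Rightarrow> real"
  assumes "\<And>n. 0 \<le> a n" "\<And>n. a n \<le> c * (1/2) ^ n"
  shows "summable a"
proof (rule summable_comparison_test')
  show "summable (\<lambda>n. c * (1/2 :: real) ^ n)" by (intro summable_mult summable_geometric) simp
  show "norm (a n) \<le> c * (1/2) ^ n" if "0 \<le> n" for n using assms[of n] by simp
qed

text \<open>In Hilbert space terms u is the projection of f onto a convex set. Admissibility of the
  limit is established only along the special sequence chosen here, whose gradients converge as
  well.\<close>

proposition closest_point_exists:
  fixes \<Omega> :: "(real^'d) set"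
  assumes dom: "bounded_lipschitz_domain \<Omega>" and p: "1 \<le> p" and f: "f \<in> L2 \<Omega>"
    and \<alpha>: "integrable (lebesgue_on \<Omega>) \<alpha>" "AE x in lebesgue_on \<Omega>. 0 \<le> \<alpha> x"
  obtains u where "u \<in> grad_constraint_set \<Omega> \<Gamma> p \<alpha>" "u \<in> L2 \<Omega>"
    "\<And>v. v \<in> grad_constraint_set \<Omega> \<Gamma> p \<alpha> \<Longrightarrow> v \<in> L2 \<Omega> \<Longrightarrow> sq_dist \<Omega> f u \<le> sq_dist \<Omega> f v"
proof -
  let ?M = "lebesgue_on \<Omega>"
  let ?K = "grad_constraint_set \<Omega> \<Gamma> p \<alpha>"
  let ?mid = "\<lambda>v w x. (1/2) * v x + (1/2) * w x"
  let ?q = "sq_dist \<Omega> f" and ?E = "energy \<Omega> \<alpha>"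
  have \<Omega>: "bounded \<Omega>" "open \<Omega>" using dom by (auto simp: bounded_lipschitz_domain_def)
  define X where "X = ?K \<inter> L2 \<Omega>"
  define m where "m = Inf (?q ` X)"
  have "(\<lambda>x. 0) \<in> X"
    using zero_in_grad_constraint_set[OF \<Omega> p \<alpha>(2)] by (simp add: X_def L2_def)
  then have ne: "X \<noteq> {}" by blast
  have m_le: "m \<le> ?q v" if "v \<in> X" for v
    unfolding m_def using that by (intro cInf_lower bdd_belowI[of _ 0]) (auto simp: sq_dist_nonneg)
  have midX: "?mid v w \<in> X" if "v \<in> X" "w \<in> X" for v w
    using that grad_constraint_set_midpoint(1)[OF \<Omega> p] L2_linear unfolding X_def by blast
  have mid: "?mid v w \<in> X \<and> ?q (?mid v w) \<le> max (?q v) (?q w)" if "v \<in> X" "w \<in> X" for v w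
  proof -
    have "0 \<le> (LINT x|?M. (v x - w x)\<^sup>2)" by simp
    also have "\<dots> = 2 * ?q v + 2 * ?q w - 4 * ?q (?mid v w)"
      using that by (intro sq_dist_parallelogram f) (auto simp: X_def)
    finally show ?thesis using midX[OF that] by (simp add: max_def)
  qed
  have EB: "0 \<le> ?E v \<and> ?E v \<le> (real CARD('d))\<^sup>2 * (LINT x|?M. \<bar>\<alpha> x\<bar>)" if "v \<in> X" for v
    using that grad_constraint_energy(2)[OF p \<alpha>(1)] by (auto simp: X_def energy_nonneg)
  obtain v where vX: "\<And>n. v n \<in> X" and q_le: "\<And>n. ?q (v n) \<le> m + (1/4) ^ n"
    and gap: "\<And>k l. ?E (v k) + ?E (v l) - 2 * ?E (?mid (v k) (v l)) \<le> 3 * ((1/4) ^ k + (1/4) ^ l)"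
    using near_minimizers_with_small_gaps[of X ?q ?E _ ?mid, OF ne sq_dist_nonneg EB mid] unfolding m_def
    by blast
  let ?G = "\<lambda>n. weak_grad \<Omega> (v n)"
  have vK: "v n \<in> ?K" and vL2: "v n \<in> L2 \<Omega>" for n using vX by (simp_all add: X_def)
  have vZ: "v n \<in> W11_zero_trace \<Omega> \<Gamma>" for n using vK by (simp add: grad_constraint_set_def)
  then have wg: "has_weak_gradient \<Omega> (v n) (?G n)" for n by (simp add: W11_zero_trace_def W11_iff)
  then have int: "integrable ?M (v n)" "integrable ?M (?G n)" for n by (auto simp: has_weak_gradient_def)
  have one: "integrable ?M (\<lambda>x. 1 :: real)"
    using \<Omega> by (intro integrable_lebesgue_on_continuous) auto
  have weight: "integrable ?M (\<lambda>x. 1 + \<bar>\<alpha> x\<bar>)" using one \<alpha>(1) by auto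
  \<comment> \<open>The parameter 2^n balances the weighted inequality: it turns a squared error of
    order 4^-n and the fixed integral of the weight both into order 2^-n.\<close>
  have scale: "2 ^ n * (c * (1/4) ^ n) + W / 2 ^ n = (c + W) * (1/2) ^ n" for n and c W :: real
  proof -
    have "(1/4 :: real) ^ n = (1/2) ^ n * (1/2) ^ n" by (simp add: power_mult_distrib[symmetric])
    then show ?thesis by (simp add: power_divide field_simps)
  qed
  have e0: "0 \<le> (1/4 :: real) ^ n" for n :: nat by simp
  have v_step: "(LINT x|?M. norm (v (Suc n) x - v n x)) \<le> (4 + (LINT x|?M. 1)) * (1/2) ^ n" for n
  proof -
    have intsq: "integrable ?M (\<lambda>x. (v (Suc n) x - v n x)\<^sup>2)"
      using L2_diff[OF vL2 vL2] by (simp add: L2_def)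
    have "(LINT x|?M. (v (Suc n) x - v n x)\<^sup>2) = 2 * ?q (v (Suc n)) + 2 * ?q (v n) - 4 * ?q (?mid (v (Suc n)) (v n))"
      by (rule sq_dist_parallelogram[OF f vL2 vL2])
    \<comment> \<open>The midpoint value is at least m, so the multiples of m cancel and (5/2) 4^-n
      remains.\<close>
    also have "\<dots> \<le> 4 * (1/4) ^ n"
      using q_le[of n] q_le[of "Suc n"] m_le[OF midX[OF vX vX, of "Suc n" n]] e0[of n]
      unfolding power_Suc by linarith
    finally have sq: "(LINT x|?M. (v (Suc n) x - v n x)\<^sup>2) \<le> 4 * (1/4) ^ n" .
    have "(LINT x|?M. norm (v (Suc n) x - v n x))
        \<le> 2 ^ n * (LINT x|?M. (norm (v (Suc n) x - v n x))\<^sup>2 / 1) + (LINT x|?M. 1) / 2 ^ n"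
      by (rule integral_norm_le_weighted_square) (use int one intsq in simp_all)
    also have "\<dots> \<le> 2 ^ n * (4 * (1/4) ^ n) + (LINT x|?M. 1) / 2 ^ n"
      using sq by simp
    finally show ?thesis unfolding scale .
  qed
  have G_step: "(LINT x|?M. norm (?G (Suc n) x - ?G n x)) \<le> (12 + (LINT x|?M. 1 + \<bar>\<alpha> x\<bar>)) * (1/2) ^ n" for n
  proof -
    note par = energy_parallelogram[OF \<Omega> p \<alpha>(1) vK[of "Suc n"] vK[of n]]
    have sq: "(LINT x|?M. (norm (?G (Suc n) x - ?G n x))\<^sup>2 / (1 + \<bar>\<alpha> x\<bar>)) \<le> 12 * (1/4) ^ n"
    proof -
      \<comment> \<open>Twice the gap bound is (15/2) t; the constant 12 is a round
        majorant.\<close>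
      have arith: "2 * a + 2 * b - 4 * c \<le> 12 * t" if "a + b - 2 * c \<le> 3 * (1/4 * t + t)" "0 \<le> t" for a b c t :: real
      proof -
        have "3 * (1/4 * t + t) = (15/4) * t" by simp
        with that show ?thesis by linarith
      qed
      show ?thesis unfolding par(2) by (rule arith[OF gap[of "Suc n" n, unfolded power_Suc] e0])
    qed
    have "(LINT x|?M. norm (?G (Suc n) x - ?G n x))
        \<le> 2 ^ n * (LINT x|?M. (norm (?G (Suc n) x - ?G n x))\<^sup>2 / (1 + \<bar>\<alpha> x\<bar>)) + (LINT x|?M. 1 + \<bar>\<alpha> x\<bar>) / 2 ^ n"
      by (rule integral_norm_le_weighted_square[OF Bochner_Integration.integrable_diff[OF int(2) int(2)] weight par(1)])
         (simp_all add: add_pos_nonneg)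
    also have "\<dots> \<le> 2 ^ n * (12 * (1/4) ^ n) + (LINT x|?M. 1 + \<bar>\<alpha> x\<bar>) / 2 ^ n"
      using sq by simp
    finally show ?thesis unfolding scale .
  qed
  have "summable (\<lambda>n. LINT x|?M. norm (v (Suc n) x - v n x))"
    by (rule summable_if_le_half_power[OF _ v_step]) simp
  then obtain u where u: "integrable ?M u" "AE x in ?M. (\<lambda>n. v n x) \<longlonglongrightarrow> u x"
    "(\<lambda>n. LINT x|?M. norm (v n x - u x)) \<longlonglongrightarrow> 0"
    by (rule L1_fast_Cauchy_converges[OF int(1)])
  have "summable (\<lambda>n. LINT x|?M. norm (?G (Suc n) x - ?G n x))"
    by (rule summable_if_le_half_power[OF _ G_step]) simp
  then obtain H where H: "integrable ?M H" "AE x in ?M. (\<lambda>n. ?G n x) \<longlonglongrightarrow> H x"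
    "(\<lambda>n. LINT x|?M. norm (?G n x - H x)) \<longlonglongrightarrow> 0"
    by (rule L1_fast_Cauchy_converges[OF int(2)])
  have uH: "has_weak_gradient \<Omega> u H"
    using has_weak_gradient_limit[OF wg u(1) H(1)] u(3) H(3) by simp
  then have uW: "u \<in> W11 \<Omega>" by (auto simp: W11_def)
  have "W11_norm \<Omega> (\<lambda>x. v n x - u x) = (LINT x|?M. norm (v n x - u x)) + (LINT x|?M. norm (?G n x - H x))" for n
    using W11_norm_eq[OF \<Omega>(2) has_weak_gradient_linear[OF wg[of n] uH, of 1 "-1"]] by simp
  then have "(\<lambda>n. W11_norm \<Omega> (\<lambda>x. v n x - u x)) \<longlonglongrightarrow> 0"
    using tendsto_add[OF u(3) H(3)] by simp
  then have uZ: "u \<in> W11_zero_trace \<Omega> \<Gamma>" by (rule W11_zero_trace_limit[OF dom vZ uW])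
  \<comment> \<open>One null set serves all n, so that the pointwise limit of the gradients inherits
    the bound.\<close>
  have "AE x in ?M. \<forall>n. lp_norm p (?G n x) \<le> \<alpha> x"
    using vK by (intro AE_all_countable[THEN iffD2] allI) (simp add: grad_constraint_set_def)
  then have "AE x in ?M. lp_norm p (weak_grad \<Omega> u x) \<le> \<alpha> x"
    using H(2) weak_grad_AE_eq[OF \<Omega>(2) uH]
  proof eventually_elim
    case (elim x)
    show ?case unfolding elim(3) by (rule lp_norm_le_limit[OF p elim(2)]) (use elim(1) in blast)
  qed
  then have uK: "u \<in> ?K" using uZ by (simp add: grad_constraint_set_def)
  have meas: "u \<in> borel_measurable ?M" "f \<in> borel_measurable ?M" "v n \<in> borel_measurable ?M" for n
    using u(1) f int by (auto simp: L2_def)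
  \<comment> \<open>Square integrability of u is still open here, so the estimate is made for the
    nonnegative integral; it yields membership in L2 and minimality together.\<close>
  have "(\<integral>\<^sup>+x. ennreal ((u x - f x)\<^sup>2) \<partial>?M) = (\<integral>\<^sup>+x. liminf (\<lambda>n. ennreal ((v n x - f x)\<^sup>2)) \<partial>?M)"
  proof (rule nn_integral_cong_AE)
    show "AE x in ?M. ennreal ((u x - f x)\<^sup>2) = liminf (\<lambda>n. ennreal ((v n x - f x)\<^sup>2))"
      using u(2)
    proof eventually_elim
      case (elim x)
      have "(\<lambda>n. ennreal ((v n x - f x)\<^sup>2)) \<longlonglongrightarrow> ennreal ((u x - f x)\<^sup>2)"
        by (intro tendsto_ennrealI tendsto_power tendsto_diff elim tendsto_const)
      from lim_imp_Liminf[OF _ this] show ?case by simp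
    qed
  qed
  also have "\<dots> \<le> liminf (\<lambda>n. \<integral>\<^sup>+x. ennreal ((v n x - f x)\<^sup>2) \<partial>?M)"
    by (rule nn_integral_liminf) (use meas in simp)
  also have "(\<lambda>n. \<integral>\<^sup>+x. ennreal ((v n x - f x)\<^sup>2) \<partial>?M) = (\<lambda>n. ennreal (?q (v n)))"
    unfolding sq_dist_def using L2_diff[OF vL2 f]
    by (intro ext nn_integral_eq_integral) (simp_all add: L2_def)
  also have "liminf (\<lambda>n. ennreal (?q (v n))) \<le> liminf (\<lambda>n. ennreal (m + (1/4) ^ n))"
    by (intro Liminf_mono always_eventually allI ennreal_leI q_le)
  also have "\<dots> = ennreal m"
  proof -
    have "(\<lambda>n. m + (1/4 :: real) ^ n) \<longlonglongrightarrow> m + 0"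
      by (intro tendsto_add tendsto_const LIMSEQ_power_zero) simp
    then show ?thesis by (intro lim_imp_Liminf tendsto_ennrealI) simp_all
  qed
  finally have fatou: "(\<integral>\<^sup>+x. ennreal ((u x - f x)\<^sup>2) \<partial>?M) \<le> ennreal m" .
  have int_uf: "integrable ?M (\<lambda>x. (u x - f x)\<^sup>2)"
  proof (rule integrableI_bounded)
    show "(\<integral>\<^sup>+x. ennreal (norm ((u x - f x)\<^sup>2)) \<partial>?M) < \<infinity>"
      using le_less_trans[OF fatou ennreal_less_top] by simp
  qed (use meas in simp)
  then have "(\<lambda>x. u x - f x) \<in> L2 \<Omega>" using meas by (simp add: L2_def)
  from L2_linear[OF this f, of 1 1] have uL2: "u \<in> L2 \<Omega>" by simp
  have m0: "0 \<le> m" unfolding m_def using ne by (intro cInf_greatest) (auto simp: sq_dist_nonneg)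
  have "ennreal (?q u) \<le> ennreal m"
    using fatou unfolding sq_dist_def by (subst nn_integral_eq_integral[symmetric, OF int_uf]) simp_all
  then have "?q u \<le> m" using m0 by simp
  then have "?q u \<le> ?q w" if "w \<in> ?K" "w \<in> L2 \<Omega>" for w
    using m_le[of w] that by (simp add: X_def)
  with uK uL2 show ?thesis by (rule that)
qed

theorem theorem3p4:
  fixes \<Omega> \<Gamma>\<^sub>D \<Gamma>\<^sub>N :: "(real^'d) set" and p :: ereal and f \<alpha> :: "real^'d \<Rightarrow> real"
  assumes "bounded_lipschitz_domain \<Omega>"
    and "boundary_partition \<Omega> \<Gamma>\<^sub>D \<Gamma>\<^sub>N"
    and "1 \<le> p"
    and "f \<in> L2 \<Omega>"
    and "integrable (lebesgue_on \<Omega>) \<alpha>"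
    and "AE x in lebesgue_on \<Omega>. 0 \<le> \<alpha> x"
  shows "\<exists>u. is_solution \<Omega> \<Gamma>\<^sub>D p \<alpha> f u \<and>
           (\<forall>w. is_solution \<Omega> \<Gamma>\<^sub>D p \<alpha> f w \<longrightarrow> (AE x in lebesgue_on \<Omega>. w x = u x))"
proof -
  let ?M = "lebesgue_on \<Omega>"
  let ?K = "grad_constraint_set \<Omega> \<Gamma>\<^sub>D p \<alpha>"
  let ?q = "sq_dist \<Omega> f"
  have \<Omega>: "bounded \<Omega>" "open \<Omega>" using assms(1) by (auto simp: bounded_lipschitz_domain_def)
  note f = \<open>f \<in> L2 \<Omega>\<close>
  obtain u where uK: "u \<in> ?K" and uL2: "u \<in> L2 \<Omega>"
    and min: "\<And>v. v \<in> ?K \<Longrightarrow> v \<in> L2 \<Omega> \<Longrightarrow> ?q u \<le> ?q v"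
    by (rule closest_point_exists[OF assms(1,3-6), of \<Gamma>\<^sub>D]) blast
  have obj: "objective \<Omega> f v < objective \<Omega> f w \<longleftrightarrow> ?q v < ?q w" if "v \<in> L2 \<Omega>" "w \<in> L2 \<Omega>" for v w
    by (simp add: objective_eq_sq_dist[OF f] that)
  have obj_top: "objective \<Omega> f v = \<infinity>" if "v \<notin> L2 \<Omega>" for v using that by (simp add: objective_def)
  have sol: "is_solution \<Omega> \<Gamma>\<^sub>D p \<alpha> f u"
    unfolding is_solution_def is_arg_min_def
  proof (intro conjI uK notI)
    assume "\<exists>y. y \<in> ?K \<and> objective \<Omega> f y < objective \<Omega> f u"
    then obtain y where y: "y \<in> ?K" "objective \<Omega> f y < objective \<Omega> f u" by blast
    then have "y \<in> L2 \<Omega>" using obj_top by fastforce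
    with y obj[OF this uL2] min[OF y(1)] show False by simp
  qed
  have "AE x in ?M. w x = u x" if w: "is_solution \<Omega> \<Gamma>\<^sub>D p \<alpha> f w" for w
  proof -
    have wK: "w \<in> ?K" and w_min: "\<not> objective \<Omega> f u < objective \<Omega> f w"
      using w uK by (auto simp: is_solution_def is_arg_min_def)
    \<comment> \<open>The objective of u is finite, so a solution cannot have an infinite
      one.\<close>
    have wL2: "w \<in> L2 \<Omega>"
    proof (rule ccontr)
      assume "w \<notin> L2 \<Omega>"
      then show False using w_min obj_top[of w] by (simp add: objective_eq_sq_dist[OF f uL2])
    qed
    have "?q w \<le> ?q u" using w_min obj[OF uL2 wL2] by simp
    \<comment> \<open>The midpoint of the two solutions is feasible and hence no better than u; the
      parallelogram identity then leaves no room for a difference.\<close>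
    moreover have "?q u \<le> ?q (\<lambda>x. (1/2) * w x + (1/2) * u x)"
      using grad_constraint_set_midpoint(1)[OF \<Omega> assms(3) wK uK] L2_linear[OF wL2 uL2]
      by (rule min)
    ultimately have "(LINT x|?M. (w x - u x)\<^sup>2) \<le> 0"
      unfolding sq_dist_parallelogram[OF f wL2 uL2] by linarith
    then have "(LINT x|?M. (w x - u x)\<^sup>2) = 0" by (intro antisym) simp_all
    moreover have "integrable ?M (\<lambda>x. (w x - u x)\<^sup>2)" using L2_diff[OF wL2 uL2] by (simp add: L2_def)
    ultimately have "AE x in ?M. (w x - u x)\<^sup>2 = 0" by (simp add: integral_nonneg_eq_0_iff_AE)
    then show ?thesis by eventually_elim simp
  qed
  with sol show ?thesis by blast
qed

end
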